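(* Let $(B_t)$ be one-dimensional Brownian motion started at $0$, let $Z=\{t\in[0,1]:B_t=0\}$ be its zero set, and let $K=\left\{\sum_{n=1}^\infty b_n4^{-n}:b_n\in\{0,3\}\right\}$ be the middle-$1/2$ Cantor set. Then $Z$ is almost surely capacity-equivalent to $K$. More precisely, with probability one there exist random constants $C_1,C_2>0$ (not depending on $f$) such that $$C_1\,\mathrm{Cap}_f(K)\;\le\;\mathrm{Cap}_f(Z)\;\le\;C_2\,\mathrm{Cap}_f(K)\qquad\text{for all kernels } f.$$
   Context: A kernel is a weakly decreasing function $f:[0,\infty)\to[0,\infty]$ such that $\lim_{r\downarrow0}f(r)=f(0)$ if this limit is finite. For a Borel measure $\nu$ on $\mathbf R$, the energy is $\mathcal E_f(\nu)=\int\int f(|x-y|)\,d\nu(x)\,d\nu(y)$. For a Borel set $\Lambda\subset\mathbf R$, the capacity is $\mathrm{Cap}_f(\Lambda)=\left[\inf_\nu\mathcal E_f(\nu)\right]^{-1}$, the infimum being over Borel probability measures $\nu$ with $\nu(\Lambda)=1$ (with $1/\infty=0$, $1/0=\infty$). Two sets $A,A'$ are capacity-equivalent if there exist positive constants $C_1,C_2$ such that $C_1\mathrm{Cap}_f(A')\le\mathrm{Cap}_f(A)\le C_2\mathrm{Cap}_f(A')$ for all kernels $f$. Constants are finite. *)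

theory Defs
  imports "HOL-Probability.Probability"
begin

text \<open>
  A kernel is a function on \<open>[0,\<infinity>)\<close> with values in \<open>[0,\<infinity>]\<close>; its values at negative arguments
  are irrelevant. The right limit at \<open>0\<close> always exists because of monotonicity.
\<close>

definition kernel :: "(real \<Rightarrow> ennreal) \<Rightarrow> bool" where
  "kernel f \<longleftrightarrow>
     antimono_on {0..} f \<and>
     (\<forall>L. (f \<longlongrightarrow> L) (at_right 0) \<and> L < \<infinity> \<longrightarrow> L = f 0)"

definition energy :: "(real \<Rightarrow> ennreal) \<Rightarrow> real measure \<Rightarrow> ennreal" where
  "energy f \<nu> = (\<integral>\<^sup>+ y. (\<integral>\<^sup>+ x. f \<bar>x - y\<bar> \<partial>\<nu>) \<partial>\<nu>)"

text \<open>
  Meaningful for Borel sets only. The conventions \<open>1/\<infinity> = 0\<close> and \<open>1/0 = \<infinity>\<close> are those of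
  \<^typ>\<open>ennreal\<close>, and the infimum of the empty set is \<open>\<infinity>\<close>.
\<close>

definition capacity :: "(real \<Rightarrow> ennreal) \<Rightarrow> real set \<Rightarrow> ennreal" where
  "capacity f \<Lambda> =
     1 / (INF \<nu> \<in> {\<nu>. prob_space \<nu> \<and> sets \<nu> = sets borel \<and> emeasure \<nu> \<Lambda> = 1}. energy f \<nu>)"

definition capacity_equivalent :: "real set \<Rightarrow> real set \<Rightarrow> bool" where
  "capacity_equivalent A A' \<longleftrightarrow>
     (\<exists>C1 C2 :: real. C1 > 0 \<and> C2 > 0 \<and>
        (\<forall>f. kernel f \<longrightarrow>
           ennreal C1 * capacity f A' \<le> capacity f A \<and>
           capacity f A \<le> ennreal C2 * capacity f A'))"

text \<open>
  Standard one-dimensional Brownian motion started at \<open>0\<close>. Only times \<open>t \<ge> 0\<close> matter.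
  The second parameter of \<^const>\<open>normal_density\<close> is the standard deviation.
\<close>

locale brownian_motion = prob_space M
  for M :: "'a measure" and B :: "real \<Rightarrow> 'a \<Rightarrow> real" +
  assumes random_variable: "\<And>t. 0 \<le> t \<Longrightarrow> B t \<in> borel_measurable M"
    and start_zero: "AE \<omega> in M. B 0 \<omega> = 0"
    and normal_increments: "\<And>s t. 0 \<le> s \<Longrightarrow> s < t \<Longrightarrow>
      distributed M lborel (\<lambda>\<omega>. B t \<omega> - B s \<omega>) (normal_density 0 (sqrt (t - s)))"
    and indep_increments: "\<And>(t :: nat \<Rightarrow> real) n. 0 \<le> t 0 \<Longrightarrow> (\<forall>i<n. t i < t (Suc i)) \<Longrightarrow>
      indep_vars (\<lambda>_. borel) (\<lambda>i \<omega>. B (t (Suc i)) \<omega> - B (t i) \<omega>) {..<n}"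
    and continuous_paths: "AE \<omega> in M. continuous_on {0..} (\<lambda>t. B t \<omega>)"

definition zero_set :: "(real \<Rightarrow> 'a \<Rightarrow> real) \<Rightarrow> 'a \<Rightarrow> real set" where
  "zero_set B \<omega> = {t \<in> {0..1}. B t \<omega> = 0}"

text \<open>The digits are indexed from \<open>0\<close> here, so digit \<open>b n\<close> has weight \<open>4\<close> to the power \<open>-(n + 1)\<close>.\<close>

definition middle_half_cantor :: "real set" where
  "middle_half_cantor =
     {x. \<exists>b :: nat \<Rightarrow> real. (\<forall>n. b n \<in> {0, 3}) \<and> (\<lambda>n. b n / 4 ^ Suc n) sums x}"

end

theory Submission
  imports Defs
begin

text \<open>
  Call \<open>\<Lambda>\<close> half-dimensional if, at every scale \<open>4\<^sup>-\<^sup>n\<close>, it is covered by \<open>O(2\<^sup>n)\<close> cells and it carries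
  a probability measure \<open>\<nu>\<close> with \<open>(\<nu> \<otimes> \<nu>) {\<bar>x - y\<bar> \<le> 4\<^sup>-\<^sup>n} = O(2\<^sup>-\<^sup>n)\<close>. By Cauchy-Schwarz the covering gives
  the reverse inequality for every measure on \<open>\<Lambda>\<close>, so the layer-cake formula makes any two
  half-dimensional sets capacity-equivalent. The Cantor set is half-dimensional with its natural measure.

  For the zero set one looks at the walk \<open>S\<close> obtained by sampling \<open>B\<close> at the times \<open>i 4\<^sup>-\<^sup>m\<close>, and at the
  compensator \<open>V\<close> of the submartingale \<open>\<bar>S\<bar>\<close>, a discrete local time whose increments decay fast away
  from \<open>0\<close>. Both the number of level-\<open>n\<close> intervals coming close to \<open>0\<close> and the sum of the squared \<open>V\<close>-masses
  of these intervals are at most a multiple of \<open>V\<close> (with the right power of \<open>2\<^sup>n\<close>) plus a martingale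
  transform whose second moment is summable in \<open>n\<close>; and \<open>\<bar>S\<bar> / sqrt V - 2 sqrt V\<close> is a supermartingale,
  so \<open>V\<close> is not small. All the constants have bounded mean uniformly in \<open>m\<close>, so by Fatou they are
  bounded along a random subsequence of levels \<open>m\<close>, along which the normalised \<open>V\<close>-masses have a weak
  limit, carried by the zero set.
\<close>

section \<open>Energy, capacity and coverings\<close>

text \<open>The constants must not depend on the kernel, so a single random constant has to serve
  every scale. First moments do not provide it: the normalised number of level-\<open>n\<close>
  intervals near zero has mean of order one, and such bounds do not sum over \<open>n\<close>. Hence
  the split into \<open>V\<close>, which is the same variable for all scales, and an error whose
  normalised second moment decays like \<open>2^-n\<close>.

  The error is a martingale transform because of one identity, \<open>H_S_Suc\<close>: with
  \<open>H q x\<close> the expected local time in the next \<open>q\<close> steps from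
  \<open>x\<close>, every step turns expected local time into collected local time up to a centred
  innovation. Summing this identity with flags that are known in time and stay up once raised does
  the work of stopping times and of the strong Markov property.

  Sampling makes the local time an explicit finite sum, and the walk estimates use only the first
  four moments of a step.\<close>

lemma sum_lessThan_add: "(\<Sum>i<a + b. f i) = (\<Sum>i<a. f i) + (\<Sum>j<b. f (a + j))"
  for f :: "nat \<Rightarrow> 'b :: comm_monoid_add"
  by (induction b) (simp_all add: add.assoc)

lemma sum_blocks: "(\<Sum>i<K * l. f i) = (\<Sum>k<K. \<Sum>j<l. f (k * l + j))"
  for f :: "nat \<Rightarrow> 'b :: comm_monoid_add"
  by (induction K) (simp_all add: sum_lessThan_add add.commute[of l])

lemma antimono_abs_measurable:
  fixes f :: "real \<Rightarrow> ennreal"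
  assumes "antimono_on {0..} f"
  shows "(\<lambda>z. f \<bar>z\<bar>) \<in> borel_measurable borel"
proof (rule borel_measurableI_greater)
  fix y
  \<comment> \<open>A point between \<open>a\<close> and \<open>b\<close> has modulus at most that
    of one of them, so the superlevel sets of the symmetrised function are intervals.\<close>
  have "is_interval {z. y < f \<bar>z\<bar>}"
    unfolding is_interval_1
  proof (intro allI ballI impI)
    fix a b c assume ab: "a \<in> {z. y < f \<bar>z\<bar>}" "b \<in> {z. y < f \<bar>z\<bar>}" and c: "a \<le> c \<and> c \<le> b"
    then have "\<bar>c\<bar> \<le> \<bar>a\<bar> \<or> \<bar>c\<bar> \<le> \<bar>b\<bar>"
      by linarith
    then have "f \<bar>a\<bar> \<le> f \<bar>c\<bar> \<or> f \<bar>b\<bar> \<le> f \<bar>c\<bar>"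
      using assms by (auto simp: monotone_on_def)
    then show "c \<in> {z. y < f \<bar>z\<bar>}"
      using ab by auto
  qed
  then show "{z \<in> space borel. y < f \<bar>z\<bar>} \<in> sets borel"
    by (simp add: real_interval_borel_measurable)
qed

lemma emeasure_lborel_below:
  "emeasure lborel {t. 0 \<le> t \<and> ennreal t < a} = a"
proof (cases a)
  case (real r)
  then have "{t. 0 \<le> t \<and> ennreal t < a} = {0..<r}"
    by (auto simp: ennreal_less_iff)
  then show ?thesis
    using real by simp
next
  case top
  have "of_nat n \<le> emeasure lborel {0::real..}" for n
    using emeasure_mono[of "{0..real n}" "{0..}" lborel] by (simp add: ennreal_of_nat_eq_real_of_nat)
  then have "emeasure lborel {0::real..} = top"
    using ennreal_Ex_less_of_nat[of "emeasure lborel {0::real..}"]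
    by (metis less_top not_less)
  moreover have "{t. 0 \<le> t \<and> ennreal t < a} = {0..}"
    using top by (auto simp: less_top)
  ultimately show ?thesis
    using top by simp
qed

text \<open>Tonelli for the region below the graph of \<open>h\<close>; the inner integral is
  \<open>emeasure_lborel_below\<close>, which also covers infinite values of \<open>h\<close>. The
  measurability claim later allows a constant to be pulled out of the integral over
  \<open>t\<close>.\<close>

lemma nn_integral_layer_cake:
  assumes "sigma_finite_measure N" and h [measurable]: "h \<in> borel_measurable N"
  shows "(\<integral>\<^sup>+p. h p \<partial>N)
    = (\<integral>\<^sup>+t. emeasure N {p \<in> space N. 0 \<le> t \<and> ennreal t < h p} \<partial>lborel)"
    and "(\<lambda>t. emeasure N {p \<in> space N. 0 \<le> t \<and> ennreal t < h p}) \<in> borel_measurable lborel"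
proof -
  interpret N: sigma_finite_measure N by fact
  interpret P: pair_sigma_finite N lborel ..
  define g where "g = (\<lambda>q. indicator {q \<in> space (N \<Otimes>\<^sub>M lborel). 0 \<le> snd q \<and> ennreal (snd q) < h (fst q)} q :: ennreal)"
  have g [measurable]: "g \<in> borel_measurable (N \<Otimes>\<^sub>M lborel)"
    unfolding g_def by measurable
  have em: "(\<integral>\<^sup>+p. g (p, t) \<partial>N) = emeasure N {p \<in> space N. 0 \<le> t \<and> ennreal t < h p}" for t
  proof -
    have "(\<integral>\<^sup>+p. g (p, t) \<partial>N) = (\<integral>\<^sup>+p. indicator {p \<in> space N. 0 \<le> t \<and> ennreal t < h p} p \<partial>N)"
      by (intro nn_integral_cong) (auto simp: g_def space_pair_measure indicator_def)
    then show ?thesis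
      by simp
  qed
  have "(\<integral>\<^sup>+p. h p \<partial>N) = (\<integral>\<^sup>+p. (\<integral>\<^sup>+t. g (p, t) \<partial>lborel) \<partial>N)"
  proof (intro nn_integral_cong)
    fix p assume p: "p \<in> space N"
    have "(\<integral>\<^sup>+t. g (p, t) \<partial>lborel) = (\<integral>\<^sup>+t. indicator {t. 0 \<le> t \<and> ennreal t < h p} t \<partial>lborel)"
      using p by (intro nn_integral_cong) (auto simp: g_def space_pair_measure indicator_def)
    also have "\<dots> = h p"
      by (simp add: emeasure_lborel_below)
    finally show "h p = (\<integral>\<^sup>+t. g (p, t) \<partial>lborel)" ..
  qed
  also have "\<dots> = (\<integral>\<^sup>+t. (\<integral>\<^sup>+p. g (p, t) \<partial>N) \<partial>lborel)"
    using P.Fubini[OF g] ..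
  also have "\<dots> = (\<integral>\<^sup>+t. emeasure N {p \<in> space N. 0 \<le> t \<and> ennreal t < h p} \<partial>lborel)"
    by (simp add: em)
  finally show "(\<integral>\<^sup>+p. h p \<partial>N)
    = (\<integral>\<^sup>+t. emeasure N {p \<in> space N. 0 \<le> t \<and> ennreal t < h p} \<partial>lborel)" .
  show "(\<lambda>t. emeasure N {p \<in> space N. 0 \<le> t \<and> ennreal t < h p}) \<in> borel_measurable lborel"
    unfolding em[symmetric] by measurable
qed

definition near_pairs :: "real measure \<Rightarrow> nat \<Rightarrow> real" where
  "near_pairs \<nu> n = measure (\<nu> \<Otimes>\<^sub>M \<nu>) {p. \<bar>snd p - fst p\<bar> \<le> (1 / 4) ^ n}"

lemma energy_pair:
  assumes \<nu>: "prob_space \<nu>" "sets \<nu> = sets borel" and f: "antimono_on {0..} f"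
  shows "energy f \<nu> = (\<integral>\<^sup>+p. f \<bar>snd p - fst p\<bar> \<partial>(\<nu> \<Otimes>\<^sub>M \<nu>))"
proof -
  interpret prob_space \<nu> by fact
  note [measurable_cong] = \<nu>(2)
  have [measurable]: "(\<lambda>z. f \<bar>z\<bar>) \<in> borel_measurable borel"
    using f by (rule antimono_abs_measurable)
  have "(\<lambda>p. f \<bar>snd p - fst p\<bar>) \<in> borel_measurable (\<nu> \<Otimes>\<^sub>M \<nu>)"
    by measurable
  from nn_integral_fst[OF this] show ?thesis
    by (simp add: energy_def)
qed

text \<open>Each superlevel set of \<open>f |x - y|\<close> is a band around the diagonal, so it
  suffices to compare the masses of bands. If the width lies between \<open>4^-m\<close> and
  \<open>4^-(m-1)\<close>, the hypotheses at these two levels lose a factor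
  \<open>2 * A / b\<close>; a band containing all pairs at distance at most 1 costs
  \<open>1 / b\<close>, and the sum of both is the constant. A band inside all scales is contained
  in the diagonal, which has mass 0 under the product of \<open>\<nu>\<close> with itself since
  \<open>A / 2^n\<close> tends to 0.\<close>

lemma energy_comparison:
  assumes \<nu>: "prob_space \<nu>" "sets \<nu> = sets borel" and \<mu>: "prob_space \<mu>" "sets \<mu> = sets borel"
    and upper: "\<And>n. near_pairs \<nu> n \<le> A / 2 ^ n"
    and lower: "\<And>n. b / 2 ^ n \<le> near_pairs \<mu> n" and b: "b > 0" and A: "A \<ge> 0"
    and f: "antimono_on {0..} f"
  shows "energy f \<nu> \<le> ennreal ((1 + 2 * A) / b) * energy f \<mu>"
proof -
  note [measurable_cong] = \<nu>(2) \<mu>(2)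
  interpret N: prob_space \<nu> by fact
  interpret M: prob_space \<mu> by fact
  interpret NN: pair_prob_space \<nu> \<nu> ..
  interpret MM: pair_prob_space \<mu> \<mu> ..
  have [simp]: "space (\<nu> \<Otimes>\<^sub>M \<nu>) = UNIV" "space (\<mu> \<Otimes>\<^sub>M \<mu>) = UNIV"
    using sets_eq_imp_space_eq[OF \<nu>(2)] sets_eq_imp_space_eq[OF \<mu>(2)]
    by (auto simp: space_pair_measure)
  have [measurable]: "(\<lambda>z. f \<bar>z\<bar>) \<in> borel_measurable borel"
    using f by (rule antimono_abs_measurable)
  have le: "f y \<le> f x" if "0 \<le> x" "x \<le> y" for x y
    using f that by (auto simp: monotone_on_def)
  define C where "C = (1 + 2 * A) / b"
  have C: "C > 0"
    using A b by (auto simp: C_def)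
  have meas: "measure (\<nu> \<Otimes>\<^sub>M \<nu>) {p. t < f \<bar>snd p - fst p\<bar>}
      \<le> C * measure (\<mu> \<Otimes>\<^sub>M \<mu>) {p. t < f \<bar>snd p - fst p\<bar>}" for t
  proof -
    define I where "I = {p :: real \<times> real. t < f \<bar>snd p - fst p\<bar>}"
    have "{p \<in> space (\<nu> \<Otimes>\<^sub>M \<nu>). t < f \<bar>snd p - fst p\<bar>} \<in> sets (\<nu> \<Otimes>\<^sub>M \<nu>)"
      "{p \<in> space (\<mu> \<Otimes>\<^sub>M \<mu>). t < f \<bar>snd p - fst p\<bar>} \<in> sets (\<mu> \<Otimes>\<^sub>M \<mu>)"
      by measurable
    then have I [measurable]: "I \<in> sets (\<nu> \<Otimes>\<^sub>M \<nu>)" "I \<in> sets (\<mu> \<Otimes>\<^sub>M \<mu>)"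
      by (simp_all add: I_def)
    have "{p \<in> space (\<nu> \<Otimes>\<^sub>M \<nu>). \<bar>snd p - fst p\<bar> \<le> c} \<in> sets (\<nu> \<Otimes>\<^sub>M \<nu>)" for c
      by measurable
    then have K: "{p. \<bar>snd p - fst p\<bar> \<le> (c::real)} \<in> sets (\<nu> \<Otimes>\<^sub>M \<nu>)" for c
      by simp
    consider (one) "t < f 1" | (mid) n where "\<not> t < f 1" "t < f ((1 / 4) ^ n)" | (none) "\<And>n. \<not> t < f ((1 / 4) ^ n)"
      by blast
    then have "measure (\<nu> \<Otimes>\<^sub>M \<nu>) I \<le> C * measure (\<mu> \<Otimes>\<^sub>M \<mu>) I"
    proof cases
      case one
      have "b \<le> near_pairs \<mu> 0"
        using lower[of 0] by simp
      also have "\<dots> \<le> measure (\<mu> \<Otimes>\<^sub>M \<mu>) I"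
        unfolding near_pairs_def I_def[symmetric]
        using one le by (intro MM.P.finite_measure_mono I) (auto simp: I_def intro: less_le_trans)
      finally have "1 \<le> C * measure (\<mu> \<Otimes>\<^sub>M \<mu>) I"
        using b A mult_mono[of 1 "1 + 2 * A" b "measure (\<mu> \<Otimes>\<^sub>M \<mu>) I"] by (simp add: C_def field_simps)
      then show ?thesis
        using NN.P.prob_le_1[of I] by linarith
    next
      case mid
      define m where "m = (LEAST n. t < f ((1 / 4) ^ n))"
      have m: "t < f ((1 / 4) ^ m)"
        unfolding m_def by (rule LeastI) (rule mid(2))
      then obtain l where l: "m = Suc l"
        using mid(1) by (cases m) auto
      have "\<not> t < f ((1 / 4) ^ l)"
        using not_less_Least[of l "\<lambda>n. t < f ((1 / 4) ^ n)"] l by (simp add: m_def)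
      then have "\<bar>snd p - fst p\<bar> \<le> (1 / 4) ^ l" if "p \<in> I" for p
        using le[of "(1 / 4) ^ l" "\<bar>snd p - fst p\<bar>"] that
        by (auto simp: I_def not_less intro: less_le_trans ccontr)
      then have "measure (\<nu> \<Otimes>\<^sub>M \<nu>) I \<le> near_pairs \<nu> l"
        unfolding near_pairs_def by (intro NN.P.finite_measure_mono K) auto
      also have "\<dots> \<le> 2 * A / 2 ^ m"
        using upper[of l] by (simp add: l)
      also have "\<dots> \<le> C * (b / 2 ^ m)"
        using b by (simp add: C_def divide_right_mono)
      also have "b / 2 ^ m \<le> measure (\<mu> \<Otimes>\<^sub>M \<mu>) I"
        using m le
        by (intro order_trans[OF lower[of m]], unfold near_pairs_def, intro MM.P.finite_measure_mono I)
          (auto simp: I_def intro: less_le_trans)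
      finally show ?thesis
        using C by simp
    next
      case none
      have sub: "\<bar>snd p - fst p\<bar> \<le> (1 / 4) ^ n" if "p \<in> I" for p n
        using le[of "(1 / 4) ^ n" "\<bar>snd p - fst p\<bar>"] none[of n] that
        by (auto simp: I_def not_less)
          (meson le_cases less_le_trans not_less order.trans zero_le_divide_1_iff zero_le_numeral zero_le_power)
      have "measure (\<nu> \<Otimes>\<^sub>M \<nu>) I \<le> A * (1 / 2) ^ n" for n
      proof -
        have "measure (\<nu> \<Otimes>\<^sub>M \<nu>) I \<le> near_pairs \<nu> n"
          unfolding near_pairs_def using sub by (intro NN.P.finite_measure_mono K) auto
        then show ?thesis
          using upper[of n] by (simp add: power_divide)
      qed
      moreover have "(\<lambda>n. A * (1 / 2) ^ n) \<longlonglongrightarrow> A * 0"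
        by (intro tendsto_mult LIMSEQ_realpow_zero tendsto_const) auto
      ultimately have "measure (\<nu> \<Otimes>\<^sub>M \<nu>) I \<le> 0"
        by (intro LIMSEQ_le_const[of _ "A * 0", simplified]) auto
      then show ?thesis
        using C by (smt (verit) measure_nonneg mult_nonneg_nonneg)
    qed
    then show ?thesis
      by (simp add: I_def)
  qed
  have em: "emeasure (\<nu> \<Otimes>\<^sub>M \<nu>) {p. 0 \<le> t \<and> ennreal t < f \<bar>snd p - fst p\<bar>}
      \<le> ennreal C * emeasure (\<mu> \<Otimes>\<^sub>M \<mu>) {p. 0 \<le> t \<and> ennreal t < f \<bar>snd p - fst p\<bar>}" for t
    using meas[of "ennreal t"] C
    by (cases "0 \<le> t")
      (auto simp: NN.P.emeasure_eq_measure MM.P.emeasure_eq_measure ennreal_mult[symmetric] ennreal_leI)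
  have "energy f \<nu> = (\<integral>\<^sup>+t. emeasure (\<nu> \<Otimes>\<^sub>M \<nu>) {p. 0 \<le> t \<and> ennreal t < f \<bar>snd p - fst p\<bar>} \<partial>lborel)"
    using nn_integral_layer_cake(1)[OF NN.P.sigma_finite_measure_axioms, of "\<lambda>p. f \<bar>snd p - fst p\<bar>"]
    by (simp add: energy_pair \<nu> f)
  also have "\<dots> \<le> (\<integral>\<^sup>+t. ennreal C * emeasure (\<mu> \<Otimes>\<^sub>M \<mu>) {p. 0 \<le> t \<and> ennreal t < f \<bar>snd p - fst p\<bar>} \<partial>lborel)"
    by (intro nn_integral_mono em)
  also have "\<dots> = ennreal C * (\<integral>\<^sup>+t. emeasure (\<mu> \<Otimes>\<^sub>M \<mu>) {p. 0 \<le> t \<and> ennreal t < f \<bar>snd p - fst p\<bar>} \<partial>lborel)"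
    using nn_integral_layer_cake(2)[OF MM.P.sigma_finite_measure_axioms, of "\<lambda>p. f \<bar>snd p - fst p\<bar>"]
    by (intro nn_integral_cmult) simp
  also have "\<dots> = ennreal C * energy f \<mu>"
    using nn_integral_layer_cake(1)[OF MM.P.sigma_finite_measure_axioms, of "\<lambda>p. f \<bar>snd p - fst p\<bar>"]
    by (simp add: energy_pair \<mu> f)
  finally show ?thesis
    by (simp add: C_def)
qed

section \<open>Coverings by 4-adic cells\<close>

definition cells :: "nat \<Rightarrow> real set \<Rightarrow> int set" where
  "cells n \<Lambda> = (\<lambda>x. \<lfloor>x * 4 ^ n\<rfloor>) ` \<Lambda>"

text \<open>Finiteness is a clause of its own because \<open>card\<close> of an infinite set is 0.
  One \<open>C\<close> serves both the covering and the measure.\<close>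

definition half_dimensional :: "real \<Rightarrow> real set \<Rightarrow> bool" where
  "half_dimensional C \<Lambda> \<longleftrightarrow> C > 0 \<and>
     (\<forall>n. finite (cells n \<Lambda>) \<and> real (card (cells n \<Lambda>)) \<le> C * 2 ^ n) \<and>
     (\<exists>\<nu>. prob_space \<nu> \<and> sets \<nu> = sets borel \<and> emeasure \<nu> \<Lambda> = 1 \<and> (\<forall>n. near_pairs \<nu> n \<le> C / 2 ^ n))"

lemma near_pairs_ge:
  assumes \<nu>: "prob_space \<nu>" "sets \<nu> = sets borel" "emeasure \<nu> \<Lambda> = 1"
    and cells: "finite (cells n \<Lambda>)" "real (card (cells n \<Lambda>)) \<le> C * 2 ^ n"
  shows "1 / C / 2 ^ n \<le> near_pairs \<nu> n"
proof -
  note [measurable_cong] = \<nu>(2)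
  interpret N: prob_space \<nu> by fact
  interpret NN: pair_prob_space \<nu> \<nu> ..
  have sp: "space \<nu> = UNIV"
    using sets_eq_imp_space_eq[OF \<nu>(2)] by simp
  define c where "c k = {x :: real. \<lfloor>x * 4 ^ n\<rfloor> = k}" for k
  have "c k = {x. of_int k \<le> x * 4 ^ n \<and> x * 4 ^ n < of_int k + 1}" for k
    by (auto simp: c_def floor_eq_iff)
  moreover have "{x :: real \<in> space borel. of_int k \<le> x * 4 ^ n \<and> x * 4 ^ n < of_int k + 1} \<in> sets borel" for k
    by measurable
  ultimately have cm [measurable]: "c k \<in> sets \<nu>" for k
    using \<nu>(2) by simp
  define J where "J = cells n \<Lambda>"
  have "1 = emeasure \<nu> \<Lambda>"
    using \<nu> by simp
  also have "\<dots> \<le> emeasure \<nu> (\<Union>k\<in>J. c k)"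
    using cells(1) by (intro emeasure_mono sets.finite_UN cm) (auto simp: J_def cells_def c_def)
  also have "\<dots> = ennreal (\<Sum>k\<in>J. measure \<nu> (c k))"
    using cells(1)
    by (subst N.emeasure_eq_measure, subst N.finite_measure_finite_Union)
      (auto simp: disjoint_family_on_def J_def cm, auto simp: c_def)
  finally have sum1: "1 \<le> (\<Sum>k\<in>J. measure \<nu> (c k))"
    by simp
  have disj: "disjoint_family_on (\<lambda>k. c k \<times> c k) J"
    by (auto simp: disjoint_family_on_def c_def)
  have near: "\<bar>y - x\<bar> \<le> (1 / 4) ^ n" if "x \<in> c k" "y \<in> c k" for x y k
  proof -
    have "\<bar>y * 4 ^ n - x * 4 ^ n\<bar> \<le> 1"
      using that unfolding c_def by (simp add: floor_eq_iff) linarith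
    then have "\<bar>y - x\<bar> * 4 ^ n \<le> 1"
      by (simp add: left_diff_distrib[symmetric] abs_mult)
    then show ?thesis
      by (simp add: field_simps power_divide)
  qed
  have times: "measure (\<nu> \<Otimes>\<^sub>M \<nu>) (c k \<times> c k) = measure \<nu> (c k) * measure \<nu> (c k)" for k
    by (simp add: measure_def N.emeasure_pair_measure_Times enn2real_mult)
  \<comment> \<open>Cauchy-Schwarz over the cells. The squares \<open>c k \<times> c k\<close> are
    disjoint and consist of near pairs, so the sum of the squared cell masses is at most the mass of
    the near pairs.\<close>
  have "1 \<le> (\<Sum>k\<in>J. measure \<nu> (c k))\<^sup>2"
    using sum1 by simp
  also have "\<dots> \<le> (\<Sum>k\<in>J. (measure \<nu> (c k))\<^sup>2) * card J"
    by (rule sum_squared_le_sum_of_squares)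
  also have "(\<Sum>k\<in>J. (measure \<nu> (c k))\<^sup>2) = measure (\<nu> \<Otimes>\<^sub>M \<nu>) (\<Union>k\<in>J. c k \<times> c k)"
    using cells(1) disj
    by (subst NN.P.finite_measure_finite_Union) (auto simp: J_def power2_eq_square times)
  also have "\<dots> \<le> near_pairs \<nu> n"
    unfolding near_pairs_def
  proof (intro NN.P.finite_measure_mono)
    have "{p \<in> space (\<nu> \<Otimes>\<^sub>M \<nu>). \<bar>snd p - fst p\<bar> \<le> (1 / 4) ^ n} \<in> sets (\<nu> \<Otimes>\<^sub>M \<nu>)"
      by measurable
    then show "{p. \<bar>snd p - fst p\<bar> \<le> (1 / 4) ^ n} \<in> sets (\<nu> \<Otimes>\<^sub>M \<nu>)"
      by (simp add: space_pair_measure sp)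
  qed (use near in auto)
  finally have "1 \<le> near_pairs \<nu> n * card J"
    by (simp add: mult_right_mono)
  also have "\<dots> \<le> near_pairs \<nu> n * (C * 2 ^ n)"
    using cells(2) by (intro mult_left_mono) (auto simp: J_def near_pairs_def)
  finally have 1: "1 \<le> near_pairs \<nu> n * (C * 2 ^ n)" .
  then have "C * 2 ^ n > 0"
    by (smt (verit) near_pairs_def measure_nonneg mult_nonneg_nonpos)
  then show ?thesis
    using 1 by (simp add: field_simps)
qed

section \<open>From energies to capacities\<close>

lemma inverse_ennreal_antimono:
  fixes x y :: ennreal
  assumes "x \<le> y"
  shows "inverse y \<le> inverse x"
proof (cases "x = 0 \<or> y = top")
  case False
  then have "x \<noteq> 0" "x \<noteq> top" "y \<noteq> top" "y \<noteq> 0"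
    using assms by (auto simp: top_unique)
  then obtain r s where "x = ennreal r" "y = ennreal s" "r > 0" "s > 0"
    by (cases x; cases y) (auto simp: less_le)
  then show ?thesis
    using assms by (simp add: inverse_ennreal le_imp_inverse_le)
qed auto

lemma capacity_le:
  assumes "C > 0"
    and "\<And>\<mu>. prob_space \<mu> \<Longrightarrow> sets \<mu> = sets borel \<Longrightarrow> emeasure \<mu> \<Lambda>' = 1 \<Longrightarrow>
      \<exists>\<nu>. prob_space \<nu> \<and> sets \<nu> = sets borel \<and> emeasure \<nu> \<Lambda> = 1 \<and> energy f \<nu> \<le> ennreal C * energy f \<mu>"
  shows "capacity f \<Lambda>' \<le> ennreal C * capacity f \<Lambda>"
proof -
  define I where "I \<Lambda> = (INF \<nu> \<in> {\<nu>. prob_space \<nu> \<and> sets \<nu> = sets borel \<and> emeasure \<nu> \<Lambda> = 1}. energy f \<nu>)" for \<Lambda>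
  have C: "ennreal C \<noteq> 0" "ennreal C \<noteq> top"
    using assms(1) by auto
  have "I \<Lambda> / ennreal C \<le> I \<Lambda>'"
    unfolding I_def[of \<Lambda>']
  proof (rule INF_greatest)
    fix \<mu> :: "real measure" assume "\<mu> \<in> {\<nu>. prob_space \<nu> \<and> sets \<nu> = sets borel \<and> emeasure \<nu> \<Lambda>' = 1}"
    with assms(2)[of \<mu>] obtain \<nu> where \<nu>: "prob_space \<nu>" "sets \<nu> = sets borel" "emeasure \<nu> \<Lambda> = 1"
      "energy f \<nu> \<le> ennreal C * energy f \<mu>" by auto
    then have "I \<Lambda> \<le> energy f \<nu>"
      unfolding I_def by (intro INF_lower) auto
    also note \<nu>(4)
    finally show "I \<Lambda> / ennreal C \<le> energy f \<mu>"
      using C by (simp add: divide_le_posI_ennreal mult.commute zero_less_iff_neq_zero)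
  qed
  then have "inverse (I \<Lambda>') \<le> inverse (I \<Lambda> / ennreal C)"
    by (rule inverse_ennreal_antimono)
  also have "\<dots> = ennreal C * inverse (I \<Lambda>)"
  proof (cases "I \<Lambda> = top \<or> I \<Lambda> = 0")
    case True
    then show ?thesis
      using C by (auto simp: ennreal_mult_top ennreal_top_divide)
  next
    case False
    then obtain r where r: "I \<Lambda> = ennreal r" "r > 0"
      by (cases "I \<Lambda>") (auto simp: less_le)
    then show ?thesis
      using assms(1)
      by (simp add: divide_ennreal inverse_ennreal ennreal_mult[symmetric] divide_inverse)
  qed
  finally show ?thesis
    by (simp add: capacity_def I_def divide_ennreal_def)
qed

text \<open>One fixed measure on \<open>\<Lambda>\<close> competes, up to a constant, with every
  measure on \<open>\<Lambda>'\<close>: its near pairs are bounded above by \<open>C\<close>, and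
  the covering of \<open>\<Lambda>'\<close> bounds those of \<open>\<mu>\<close> below with
  \<open>b = 1 / C'\<close>.\<close>

lemma half_dimensional_capacity_le:
  assumes \<Lambda>: "half_dimensional C \<Lambda>" and \<Lambda>': "half_dimensional C' \<Lambda>'" and f: "antimono_on {0..} f"
  shows "capacity f \<Lambda>' \<le> ennreal ((1 + 2 * C) * C') * capacity f \<Lambda>"
proof (rule capacity_le)
  fix \<mu> assume \<mu>: "prob_space \<mu>" "sets \<mu> = sets borel" "emeasure \<mu> \<Lambda>' = 1"
  obtain \<nu> where \<nu>: "prob_space \<nu>" "sets \<nu> = sets borel" "emeasure \<nu> \<Lambda> = 1" "\<And>n. near_pairs \<nu> n \<le> C / 2 ^ n"
    using \<Lambda> by (auto simp: half_dimensional_def)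
  have "energy f \<nu> \<le> ennreal ((1 + 2 * C) / (1 / C')) * energy f \<mu>"
    using \<Lambda> \<Lambda>' \<nu> \<mu> f
    by (intro energy_comparison near_pairs_ge[of \<mu> \<Lambda>']) (auto simp: half_dimensional_def)
  with \<nu> show "\<exists>\<nu>. prob_space \<nu> \<and> sets \<nu> = sets borel \<and> emeasure \<nu> \<Lambda> = 1 \<and>
      energy f \<nu> \<le> ennreal ((1 + 2 * C) * C') * energy f \<mu>"
    by auto
qed (use assms in \<open>auto simp: half_dimensional_def\<close>)

lemma half_dimensional_capacity_equivalent:
  assumes \<Lambda>: "half_dimensional C \<Lambda>" and \<Lambda>': "half_dimensional C' \<Lambda>'"
  shows "capacity_equivalent \<Lambda> \<Lambda>'"
proof -
  define c where "c = (1 + 2 * C) * C'"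
  have c: "c > 0" "(1 + 2 * C') * C > 0"
    using assms by (auto simp: half_dimensional_def c_def)
  have "ennreal (1 / c) * capacity f \<Lambda>' \<le> capacity f \<Lambda> \<and>
      capacity f \<Lambda> \<le> ennreal ((1 + 2 * C') * C) * capacity f \<Lambda>'" if "kernel f" for f
  proof
    have f: "antimono_on {0..} f"
      using that by (simp add: kernel_def)
    show "capacity f \<Lambda> \<le> ennreal ((1 + 2 * C') * C) * capacity f \<Lambda>'"
      by (rule half_dimensional_capacity_le[OF \<Lambda>' \<Lambda> f])
    have "ennreal (1 / c) * capacity f \<Lambda>' \<le> ennreal (1 / c) * (ennreal c * capacity f \<Lambda>)"
      using half_dimensional_capacity_le[OF \<Lambda> \<Lambda>' f] by (intro mult_left_mono) (auto simp: c_def)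
    also have "\<dots> = capacity f \<Lambda>"
      using c by (simp add: mult.assoc[symmetric] ennreal_mult[symmetric])
    finally show "ennreal (1 / c) * capacity f \<Lambda>' \<le> capacity f \<Lambda>" .
  qed
  then show ?thesis
    unfolding capacity_equivalent_def using c
    by (intro exI[of _ "1 / c"] exI[of _ "(1 + 2 * C') * C"]) auto
qed

section \<open>The Cantor set\<close>

definition digits03 :: "(nat \<Rightarrow> real) \<Rightarrow> bool" where
  "digits03 b \<longleftrightarrow> (\<forall>n. b n \<in> {0, 3})"

definition value4 :: "(nat \<Rightarrow> real) \<Rightarrow> real" where
  "value4 b = (\<Sum>n. b n / 4 ^ Suc n)"

lemma sums_quarter: "(\<lambda>n. 3 / 4 ^ Suc n :: real) sums 1"
  using sums_mult[OF geometric_sums[of "1 / 4 :: real"], of "3 / 4"] by (simp add: power_divide)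

lemma value4_sums:
  assumes "digits03 b"
  shows "(\<lambda>n. b n / 4 ^ Suc n) sums value4 b"
  unfolding value4_def
proof (rule summable_sums, rule summable_comparison_test'[OF sums_summable[OF sums_quarter]])
  fix n
  have "b n \<in> {0, 3}"
    using assms by (simp add: digits03_def)
  then show "norm (b n / 4 ^ Suc n) \<le> 3 / 4 ^ Suc n"
    by auto
qed

lemma value4_bounds:
  assumes "digits03 b"
  shows "0 \<le> value4 b" "value4 b \<le> 1"
proof -
  have b: "b n / 4 ^ Suc n \<le> 3 / 4 ^ Suc n" "0 \<le> b n / 4 ^ Suc n" for n
  proof -
    have "b n \<in> {0, 3}"
      using assms by (simp add: digits03_def)
    then show "b n / 4 ^ Suc n \<le> 3 / 4 ^ Suc n" "0 \<le> b n / 4 ^ Suc n"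
      by auto
  qed
  show "0 \<le> value4 b"
    using sums_le[OF _ sums_zero value4_sums[OF assms]] b(2) by blast
  show "value4 b \<le> 1"
    using sums_le[OF _ value4_sums[OF assms] sums_quarter] b(1) by blast
qed

lemma digits03_Suc: "digits03 b \<Longrightarrow> digits03 (\<lambda>n. b (Suc n))"
  by (simp add: digits03_def)

lemma value4_Suc:
  assumes "digits03 b"
  shows "value4 b = (b 0 + value4 (\<lambda>n. b (Suc n))) / 4"
proof -
  have "(\<lambda>n. b (Suc n) / 4 ^ Suc (Suc n)) sums (value4 b - b 0 / 4)"
    using value4_sums[OF assms] by (subst sums_Suc_iff) simp
  moreover have "(\<lambda>n. b (Suc n) / 4 ^ Suc n / 4) sums (value4 (\<lambda>n. b (Suc n)) / 4)"
    by (intro sums_divide value4_sums digits03_Suc assms)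
  ultimately have "value4 b - b 0 / 4 = value4 (\<lambda>n. b (Suc n)) / 4"
    by (intro sums_unique2) (simp_all add: mult.commute)
  then show ?thesis
    by simp
qed

text \<open>Tails lie in \<open>[0, 1]\<close>, so two expansions with different first digits are at
  least \<open>(3 - 1) / 4 = 1 / 2\<close> apart, more than \<open>1 / 4\<close>. Equal first digits
  cancel, and multiplying by 4 leads to the next level.\<close>

lemma value4_near:
  assumes "digits03 b" "digits03 b'" "\<bar>value4 b - value4 b'\<bar> \<le> (1 / 4) ^ n" "i < n"
  shows "b i = b' i"
  using assms
proof (induction n arbitrary: b b' i)
  case (Suc n)
  have diff: "\<bar>(b 0 - b' 0) + (value4 (\<lambda>n. b (Suc n)) - value4 (\<lambda>n. b' (Suc n)))\<bar> \<le> (1 / 4) ^ n"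
  proof -
    have "value4 b - value4 b'
        = ((b 0 - b' 0) + (value4 (\<lambda>n. b (Suc n)) - value4 (\<lambda>n. b' (Suc n)))) / 4"
      by (subst value4_Suc[OF Suc.prems(1)], subst value4_Suc[OF Suc.prems(2)]) (simp add: field_simps)
    from Suc.prems(3)[unfolded this] show ?thesis
      by simp
  qed
  have "(1 / 4 :: real) ^ n \<le> 1"
    by (simp add: power_le_one)
  moreover have "b 0 \<in> {0, 3}" "b' 0 \<in> {0, 3}"
    using Suc.prems by (simp_all add: digits03_def)
  ultimately have eq: "b 0 = b' 0"
    using diff value4_bounds[OF digits03_Suc[OF Suc.prems(1)]] value4_bounds[OF digits03_Suc[OF Suc.prems(2)]]
    by auto
  show ?case
  proof (cases i)
    case 0
    then show ?thesis using eq by simp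
  next
    case (Suc j)
    then show ?thesis
      using Suc.IH[OF digits03_Suc[OF Suc.prems(1)] digits03_Suc[OF Suc.prems(2)], of j] diff eq Suc.prems(4)
      by simp
  qed
qed simp

lemma middle_half_cantor_eq: "middle_half_cantor = value4 ` {b. digits03 b}"
proof (intro set_eqI iffI)
  fix x assume "x \<in> middle_half_cantor"
  then obtain b where b: "\<forall>n. b n \<in> {0, 3}" "(\<lambda>n. b n / 4 ^ Suc n) sums x"
    unfolding middle_half_cantor_def by blast
  then have "digits03 b"
    by (simp add: digits03_def)
  moreover have "x = value4 b"
    using b(2) by (simp add: value4_def sums_iff)
  ultimately show "x \<in> value4 ` {b. digits03 b}"
    by blast
next
  fix x assume "x \<in> value4 ` {b. digits03 b}"
  then obtain b where b: "digits03 b" "x = value4 b"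
    by blast
  show "x \<in> middle_half_cantor"
    unfolding middle_half_cantor_def mem_Collect_eq
    by (rule exI[of _ b]) (use b value4_sums[OF b(1)] in \<open>simp add: digits03_def\<close>)
qed

text \<open>On the Cantor set this is the digit shift. The cut at \<open>1 / 2\<close> lies in the
  middle gap, so the branch reads off the leading digit and the map is Borel on the whole
  line.\<close>

definition expand4 :: "real \<Rightarrow> real" where
  "expand4 x = (if x \<le> 1 / 2 then 4 * x else 4 * x - 3)"

lemma measurable_expand4 [measurable]: "expand4 \<in> borel_measurable borel"
  unfolding expand4_def[abs_def] by measurable

lemma expand4_value4:
  assumes "digits03 b"
  shows "(expand4 ^^ n) (value4 b) = value4 (\<lambda>i. b (n + i)) \<and> digits03 (\<lambda>i. b (n + i))"
proof (induction n)
  case (Suc n)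
  let ?c = "\<lambda>i. b (n + i)"
  have c: "digits03 ?c"
    using Suc by simp
  have "?c 0 \<in> {0, 3}"
    using c unfolding digits03_def by blast
  then have "expand4 (value4 ?c) = value4 (\<lambda>i. ?c (Suc i))"
    using value4_Suc[OF c] value4_bounds[OF digits03_Suc[OF c]] by (auto simp: expand4_def)
  then show ?case
    using Suc digits03_Suc[OF c] by simp
qed (use assms in simp)

text \<open>Membership by digits quantifies over sequences; the orbit form is a countable
  intersection of Borel conditions, which yields measurability.\<close>

lemma middle_half_cantor_expand4:
  "middle_half_cantor = {x. \<forall>n. (expand4 ^^ n) x \<in> {0..1 / 4} \<union> {3 / 4..1}}"
proof (intro set_eqI iffI)
  fix x assume "x \<in> middle_half_cantor"
  then obtain b where b: "digits03 b" "x = value4 b"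
    by (auto simp: middle_half_cantor_eq)
  have "(expand4 ^^ n) x \<in> {0..1 / 4} \<union> {3 / 4..1}" for n
  proof -
    let ?c = "\<lambda>i. b (n + i)"
    have c: "digits03 ?c" "(expand4 ^^ n) x = value4 ?c"
      using expand4_value4[OF b(1), of n] b(2) by auto
    have "?c 0 \<in> {0, 3}"
      using c(1) unfolding digits03_def by blast
    then show ?thesis
      unfolding c(2) using value4_Suc[OF c(1)] value4_bounds[OF digits03_Suc[OF c(1)]] by auto
  qed
  then show "x \<in> {x. \<forall>n. (expand4 ^^ n) x \<in> {0..1 / 4} \<union> {3 / 4..1}}"
    by blast
next
  fix x assume "x \<in> {x. \<forall>n. (expand4 ^^ n) x \<in> {0..1 / 4} \<union> {3 / 4..1}}"
  then have x: "(expand4 ^^ n) x \<in> {0..1 / 4} \<union> {3 / 4..1}" for n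
    by blast
  define b :: "nat \<Rightarrow> real" where "b n = (if (expand4 ^^ n) x \<le> 1 / 2 then 0 else 3)" for n
  \<comment> \<open>Iterating \<open>x = (b 0 + expand4 x) / 4\<close>: the remainder is
    \<open>4^-n\<close> times a point of the orbit, which stays in \<open>[0, 1]\<close>.\<close>
  have partial: "(\<Sum>i<n. b i / 4 ^ Suc i) = x - (1 / 4) ^ n * (expand4 ^^ n) x" for n
  proof (induction n)
    case (Suc n)
    have "(expand4 ^^ Suc n) x = 4 * (expand4 ^^ n) x - b n"
      by (simp add: expand4_def b_def)
    then show ?case
      using Suc by (simp add: field_simps power_divide)
  qed simp
  have "(\<lambda>n. x - (1 / 4) ^ n * (expand4 ^^ n) x) \<longlonglongrightarrow> x - 0"
  proof (intro tendsto_diff tendsto_const)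
    show "(\<lambda>n. (1 / 4) ^ n * (expand4 ^^ n) x) \<longlonglongrightarrow> 0"
    proof (rule Lim_null_comparison)
      show "\<forall>\<^sub>F n in sequentially. norm ((1 / 4) ^ n * (expand4 ^^ n) x) \<le> (1 / 4) ^ n"
      proof (rule always_eventually, rule allI)
        fix n
        have "\<bar>(expand4 ^^ n) x\<bar> \<le> 1"
          using x[of n] by auto
        then show "norm ((1 / 4) ^ n * (expand4 ^^ n) x) \<le> (1 / 4) ^ n"
          using mult_left_mono[of "\<bar>(expand4 ^^ n) x\<bar>" 1 "(1 / 4) ^ n"] by (simp add: abs_mult)
      qed
    qed (intro LIMSEQ_realpow_zero; simp)
  qed
  then have "(\<lambda>n. b n / 4 ^ Suc n) sums x"
    unfolding sums_def partial by simp
  moreover have "\<forall>n. b n \<in> {0, 3}"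
    by (simp add: b_def)
  ultimately show "x \<in> middle_half_cantor"
    unfolding middle_half_cantor_def by blast
qed

lemma measurable_middle_half_cantor [measurable]: "middle_half_cantor \<in> sets borel"
proof -
  have [measurable]: "(expand4 ^^ n) \<in> borel_measurable borel" for n
    by (induction n) simp_all
  have "{x \<in> space borel. \<forall>n. (expand4 ^^ n) x \<in> {0..1 / 4} \<union> {3 / 4..1}} \<in> sets borel"
    by measurable
  then show ?thesis
    by (simp add: middle_half_cantor_expand4)
qed

text \<open>Self-similarity: if \<open>x = (b 0 + y) / 4\<close> with \<open>y\<close> in the set,
  the level-\<open>n+1\<close> index of \<open>x\<close> is the level-\<open>n\<close> index of
  \<open>y\<close> plus 0 or \<open>3 * 4^n\<close>, so each level at most doubles the count. The
  initial 2 is due to the point 1, which lies in a cell of its own.\<close>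

lemma cells_cantor: "finite (cells n middle_half_cantor) \<and> card (cells n middle_half_cantor) \<le> 2 * 2 ^ n"
proof (induction n)
  case 0
  have "cells 0 middle_half_cantor \<subseteq> {0, 1}"
  proof
    fix k assume "k \<in> cells 0 middle_half_cantor"
    then obtain b where b: "digits03 b" "k = \<lfloor>value4 b\<rfloor>"
      by (auto simp: cells_def middle_half_cantor_eq)
    have "0 \<le> k" "k \<le> 1"
      using value4_bounds[OF b(1)] unfolding b(2) by (simp_all add: floor_le_iff)
    then show "k \<in> {0, 1}"
      by auto
  qed
  then show ?case
    using finite_subset[of "cells 0 middle_half_cantor" "{0, 1}"]
      card_mono[of "{0, 1}" "cells 0 middle_half_cantor"] by simp
next
  case (Suc n)
  let ?C = "cells n middle_half_cantor"
  have "cells (Suc n) middle_half_cantor \<subseteq> ?C \<union> (\<lambda>k. 3 * 4 ^ n + k) ` ?C"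
  proof
    fix k assume "k \<in> cells (Suc n) middle_half_cantor"
    then obtain b where b: "digits03 b" "k = \<lfloor>value4 b * 4 ^ Suc n\<rfloor>"
      by (auto simp: cells_def middle_half_cantor_eq)
    define y where "y = value4 (\<lambda>n. b (Suc n))"
    have y: "\<lfloor>y * 4 ^ n\<rfloor> \<in> ?C"
      using digits03_Suc[OF b(1)] by (auto simp: cells_def middle_half_cantor_eq y_def)
    have k: "k = \<lfloor>b 0 * 4 ^ n + y * 4 ^ n\<rfloor>"
      unfolding b(2) value4_Suc[OF b(1)] y_def by (simp add: distrib_right add_divide_distrib)
    have "b 0 = 0 \<or> b 0 = 3"
      using b(1) by (auto simp: digits03_def)
    then have "k = \<lfloor>y * 4 ^ n\<rfloor> \<or> k = 3 * 4 ^ n + \<lfloor>y * 4 ^ n\<rfloor>"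
    proof
      assume "b 0 = 3"
      then have "k = \<lfloor>of_int (3 * 4 ^ n) + y * 4 ^ n\<rfloor>"
        using k by simp
      then show ?thesis
        by (simp only: floor_add_int[symmetric] add.commute) simp
    qed (simp add: k)
    then show "k \<in> ?C \<union> (\<lambda>k. 3 * 4 ^ n + k) ` ?C"
      using y by auto
  qed
  moreover have "card (?C \<union> (\<lambda>k. 3 * 4 ^ n + k) ` ?C) \<le> card ?C + card ?C"
    using card_Un_le[of ?C "(\<lambda>k. 3 * 4 ^ n + k) ` ?C"] card_image_le[of ?C "\<lambda>k. 3 * 4 ^ n + k"] Suc
    by linarith
  moreover have "finite (?C \<union> (\<lambda>k. 3 * 4 ^ n + k) ` ?C)"
    using Suc by simp
  ultimately have "finite (cells (Suc n) middle_half_cantor)"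
    "card (cells (Suc n) middle_half_cantor) \<le> card ?C + card ?C"
    by (meson finite_subset, meson card_mono order_trans)
  then show ?case
    using Suc by simp
qed

text \<open>Replacing the binary digits \<open>0, 1\<close> of a number in \<open>[0, 1)\<close> by the digits \<open>0, 3\<close> in base 4
  transports Lebesgue measure to the natural measure on the Cantor set.\<close>

definition cantor_digit :: "real \<Rightarrow> nat \<Rightarrow> real" where
  "cantor_digit u n = 3 * of_int (\<lfloor>u * 2 ^ Suc n\<rfloor> mod 2)"

definition cantor_map :: "real \<Rightarrow> real" where
  "cantor_map u = value4 (cantor_digit u)"

lemma digits03_cantor_digit: "digits03 (cantor_digit u)"
  unfolding digits03_def cantor_digit_def
proof
  fix n
  have "\<lfloor>u * 2 ^ Suc n\<rfloor> mod 2 = 0 \<or> \<lfloor>u * 2 ^ Suc n\<rfloor> mod 2 = 1"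
    by auto
  then show "3 * real_of_int (\<lfloor>u * 2 ^ Suc n\<rfloor> mod 2) \<in> {0, 3}"
    by auto
qed

lemma measurable_cantor_map [measurable]: "cantor_map \<in> borel_measurable borel"
  unfolding cantor_map_def[abs_def] value4_def cantor_digit_def by measurable

lemma floor_double:
  fixes u :: real
  shows "\<lfloor>u * 2 ^ Suc n\<rfloor> = 2 * \<lfloor>u * 2 ^ n\<rfloor> + \<lfloor>u * 2 ^ Suc n\<rfloor> mod 2"
proof -
  have "\<lfloor>u * 2 ^ Suc n\<rfloor> div 2 = \<lfloor>u * 2 ^ Suc n / 2\<rfloor>"
    using floor_divide_real_eq_div[of 2 "u * 2 ^ Suc n"] by simp
  then have "\<lfloor>u * 2 ^ Suc n\<rfloor> div 2 = \<lfloor>u * 2 ^ n\<rfloor>"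
    by simp
  then show ?thesis
    by presburger
qed

lemma cantor_digit_floor:
  assumes "u \<in> {0..<1}" "v \<in> {0..<1}" "\<And>i. i < n \<Longrightarrow> cantor_digit u i = cantor_digit v i"
  shows "\<lfloor>u * 2 ^ n\<rfloor> = \<lfloor>v * 2 ^ n\<rfloor>"
  using assms(3)
proof (induction n)
  case 0
  have "\<lfloor>u\<rfloor> = 0" "\<lfloor>v\<rfloor> = 0"
    using assms(1,2) by (simp_all add: floor_eq_iff)
  then show ?case
    by simp
next
  case (Suc n)
  then have "\<lfloor>u * 2 ^ n\<rfloor> = \<lfloor>v * 2 ^ n\<rfloor>" "\<lfloor>u * 2 ^ Suc n\<rfloor> mod 2 = \<lfloor>v * 2 ^ Suc n\<rfloor> mod 2"
    by (auto simp: cantor_digit_def simp del: power_Suc)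
  then show ?case
    by (subst (1 2) floor_double) (simp del: power_Suc)
qed

text \<open>If the images of \<open>u\<close> and \<open>v\<close> are within \<open>4^-n\<close>,
  their first \<open>n\<close> digits agree by \<open>value4_near\<close>, so \<open>u\<close> and
  \<open>v\<close> lie in the same dyadic interval of length \<open>2^-n\<close>. Hence every ball
  of radius \<open>4^-n\<close> around a point of the image has mass at most \<open>2^-n\<close>.
  The constant 2 is dictated by the cell count.\<close>

lemma half_dimensional_cantor: "half_dimensional 2 middle_half_cantor"
proof -
  define U where "U = uniform_measure lborel {0..<1 :: real}"
  define \<kappa> where "\<kappa> = distr U borel cantor_map"
  interpret U: prob_space U
    unfolding U_def by (rule prob_space_uniform_measure) auto
  have [measurable_cong]: "sets U = sets borel"
    by (simp add: U_def)
  have spU: "space U = UNIV"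
    by (simp add: U_def)
  interpret \<kappa>: prob_space \<kappa>
    unfolding \<kappa>_def by (rule U.prob_space_distr) measurable
  have sets: "sets \<kappa> = sets borel"
    by (simp add: \<kappa>_def)
  note [measurable_cong] = sets
  have sp: "space \<kappa> = UNIV"
    by (simp add: \<kappa>_def)
  have AEU: "AE u in U. u \<in> {0..<1}"
    unfolding U_def by (rule AE_uniform_measureI) auto
  have near: "near_pairs \<kappa> n \<le> 2 / 2 ^ n" for n
  proof -
    define A where "A = {p :: real \<times> real. \<bar>snd p - fst p\<bar> \<le> (1 / 4) ^ n}"
    have "{p \<in> space (\<kappa> \<Otimes>\<^sub>M \<kappa>). \<bar>snd p - fst p\<bar> \<le> (1 / 4) ^ n} \<in> sets (\<kappa> \<Otimes>\<^sub>M \<kappa>)"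
      by measurable
    then have A [measurable]: "A \<in> sets (\<kappa> \<Otimes>\<^sub>M \<kappa>)"
      by (simp add: A_def space_pair_measure sp)
    have inner: "emeasure \<kappa> (Pair (cantor_map u) -` A) \<le> ennreal (1 / 2 ^ n)" if u: "u \<in> {0..<1}" for u
    proof -
      have P: "Pair (cantor_map u) -` A \<in> sets borel"
        using sets_Pair1[OF A] sets by simp
      define k where "k = \<lfloor>u * 2 ^ n\<rfloor>"
      have "emeasure \<kappa> (Pair (cantor_map u) -` A) = emeasure U (cantor_map -` (Pair (cantor_map u) -` A))"
        unfolding \<kappa>_def using P by (subst emeasure_distr) (auto simp: spU)
      also have "\<dots> = emeasure lborel ({0..<1} \<inter> cantor_map -` (Pair (cantor_map u) -` A))"
        unfolding U_def using measurable_sets[OF measurable_cantor_map P]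
        by (subst emeasure_uniform_measure) (auto simp: divide_ennreal_def)
      also have "\<dots> \<le> emeasure lborel {of_int k / 2 ^ n..of_int (k + 1) / (2 :: real) ^ n}"
      proof (intro emeasure_mono subsetI)
        fix v assume v: "v \<in> {0..<1} \<inter> cantor_map -` (Pair (cantor_map u) -` A)"
        then have "cantor_digit u i = cantor_digit v i" if "i < n" for i
          using that value4_near[OF digits03_cantor_digit digits03_cantor_digit, of u v n i]
          by (simp add: A_def cantor_map_def abs_minus_commute)
        then have "\<lfloor>v * 2 ^ n\<rfloor> = k"
          using cantor_digit_floor[OF u, of v n] v by (simp add: k_def)
        then have "of_int k \<le> v * 2 ^ n" "v * 2 ^ n \<le> of_int (k + 1)"
          by (simp_all add: floor_eq_iff)
        then show "v \<in> {of_int k / 2 ^ n..of_int (k + 1) / 2 ^ n}"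
          by (simp add: field_simps)
      qed auto
      also have "\<dots> = ennreal (1 / 2 ^ n)"
        by (simp add: diff_divide_distrib[symmetric] divide_right_mono)
      finally show ?thesis .
    qed
    have "emeasure (\<kappa> \<Otimes>\<^sub>M \<kappa>) A = (\<integral>\<^sup>+x. emeasure \<kappa> (Pair x -` A) \<partial>\<kappa>)"
      by (rule \<kappa>.emeasure_pair_measure_alt[OF A])
    also have "\<dots> = (\<integral>\<^sup>+u. emeasure \<kappa> (Pair (cantor_map u) -` A) \<partial>U)"
      using \<kappa>.measurable_emeasure_Pair[OF A] unfolding \<kappa>_def
      by (subst nn_integral_distr) (auto simp: \<kappa>_def[symmetric] cong: measurable_cong_sets)
    also have "\<dots> \<le> (\<integral>\<^sup>+u. ennreal (1 / 2 ^ n) \<partial>U)"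
    proof (rule nn_integral_mono_AE)
      show "AE u in U. emeasure \<kappa> (Pair (cantor_map u) -` A) \<le> ennreal (1 / 2 ^ n)"
        using AEU by eventually_elim (rule inner)
    qed
    also have "\<dots> = ennreal (1 / 2 ^ n)"
      by (simp add: U.emeasure_space_1)
    finally have "measure (\<kappa> \<Otimes>\<^sub>M \<kappa>) A \<le> 1 / 2 ^ n"
      by (simp add: measure_def enn2real_leI)
    also have "\<dots> \<le> 2 / 2 ^ n"
      by (simp add: divide_right_mono)
    finally show ?thesis
      by (simp add: near_pairs_def A_def)
  qed
  have "emeasure \<kappa> middle_half_cantor = 1"
  proof -
    have 1: "cantor_map u \<in> middle_half_cantor" for u
      using digits03_cantor_digit by (auto simp: cantor_map_def middle_half_cantor_eq)
    have "emeasure \<kappa> middle_half_cantor = emeasure U (cantor_map -` middle_half_cantor \<inter> space U)"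
      unfolding \<kappa>_def by (rule emeasure_distr) measurable
    also have "cantor_map -` middle_half_cantor \<inter> space U = space U"
      using 1 by auto
    finally show ?thesis
      by (simp add: U.emeasure_space_1)
  qed
  moreover have "real (card (cells n middle_half_cantor)) \<le> 2 * 2 ^ n" for n
    using cells_cantor[of n]
    by (metis of_nat_le_iff of_nat_mult of_nat_power of_nat_numeral)
  ultimately show ?thesis
    unfolding half_dimensional_def using cells_cantor near \<kappa>.prob_space_axioms sets
    by (intro conjI allI exI[of _ \<kappa>]) auto
qed

section \<open>Spreading measures as weak limits of weighted grids\<close>

text \<open>Prokhorov's theorem for discrete measures with atoms in \<open>[0, 1]\<close>, where
  tightness is automatic.\<close>

lemma weak_limit_of_weights:
  fixes p x :: "nat \<Rightarrow> nat \<Rightarrow> real"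
  assumes p: "\<And>r i. 0 \<le> p r i" "\<And>r. (\<Sum>i<N r. p r i) = 1" and x: "\<And>r i. x r i \<in> {0..1}"
  obtains t \<nu> where "strict_mono t" "real_distribution \<nu>"
    "\<And>f B. (\<And>x. isCont f x) \<Longrightarrow> (\<And>x. \<bar>f x :: real\<bar> \<le> B) \<Longrightarrow>
      (\<lambda>r. \<Sum>i<N (t r). p (t r) i * f (x (t r) i)) \<longlonglongrightarrow> (\<integral>x. f x \<partial>\<nu>)"
proof -
  define \<mu> where "\<mu> r = distr (point_measure {..<N r} (\<lambda>i. ennreal (p r i))) borel (x r)" for r
  have ps: "prob_space (point_measure {..<N r} (\<lambda>i. ennreal (p r i)))" for r
    by (rule prob_spaceI) (simp add: space_point_measure emeasure_point_measure_finite p)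
  have rd: "real_distribution (\<mu> r)" for r
  proof -
    interpret P: prob_space "point_measure {..<N r} (\<lambda>i. ennreal (p r i))"
      by (rule ps)
    show ?thesis
      unfolding \<mu>_def by (rule P.real_distribution_distr) simp
  qed
  have int: "(\<integral>y. f y \<partial>\<mu> r) = (\<Sum>i<N r. p r i * f (x r i))" if "f \<in> borel_measurable borel" for f :: "real \<Rightarrow> real" and r
    unfolding \<mu>_def using that p by (simp add: integral_distr lebesgue_integral_point_measure_finite)
  have "tight \<mu>"
    unfolding tight_def
  proof (intro conjI allI impI rd)
    fix \<epsilon> :: real assume "\<epsilon> > 0"
    \<comment> \<open>The left end is -1 because tightness is stated with left-open intervals and
      there may be an atom at 0.\<close>
    have "measure (\<mu> r) {-1<..1} = 1" for r
    proof -
      interpret real_distribution "\<mu> r" by (rule rd)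
      have "measure (\<mu> r) {-1<..1} = (\<integral>y. indicator {-1<..1} y \<partial>\<mu> r)"
        by simp
      also have "\<dots> = (\<Sum>i<N r. p r i * indicator {-1<..1} (x r i))"
        by (rule int) measurable
      also have "\<dots> = (\<Sum>i<N r. p r i)"
      proof (intro sum.cong refl)
        fix i
        have "x r i \<in> {-1<..1}"
          using x[of r i] by simp
        then show "p r i * indicator {-1<..1} (x r i) = p r i"
          by simp
      qed
      finally show ?thesis
        using p by simp
    qed
    then show "\<exists>a b. a < b \<and> (\<forall>n. 1 - \<epsilon> < measure (\<mu> n) {a<..b})"
      using \<open>\<epsilon> > 0\<close> by (intro exI[of _ "-1"] exI[of _ 1]) simp
  qed
  from tight_imp_convergent_subsubsequence[OF this, of id]
  obtain t \<nu> where t: "strict_mono t" "real_distribution \<nu>" "weak_conv_m (\<mu> \<circ> t) \<nu>"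
    by (auto simp: strict_mono_id)
  show thesis
  proof (rule that[OF t(1,2)])
    fix f :: "real \<Rightarrow> real" and B assume f: "\<And>x. isCont f x" "\<And>x. \<bar>f x\<bar> \<le> B"
    have m: "f \<in> borel_measurable borel"
      using f(1) by (intro borel_measurable_continuous_onI continuous_at_imp_continuous_on) auto
    have "(\<lambda>r. \<integral>y. f y \<partial>(\<mu> \<circ> t) r) \<longlonglongrightarrow> (\<integral>y. f y \<partial>\<nu>)"
      by (rule weak_conv_imp_integral_bdd_continuous_conv[OF _ t(2,3), of _ B]) (use rd f in auto)
    then show "(\<lambda>r. \<Sum>i<N (t r). p (t r) i * f (x (t r) i)) \<longlonglongrightarrow> (\<integral>x. f x \<partial>\<nu>)"
      using int[OF m] by simp
  qed
qed

text \<open>A trapezoid centred at cell \<open>k\<close>: 1 on the cell and its two neighbours, 0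
  outside five cells. Two points within \<open>4^-n\<close> may lie in adjacent cells, hence the
  plateau of three cells; the slopes are there because weak convergence tests only continuous
  functions.\<close>

definition tent :: "nat \<Rightarrow> nat \<Rightarrow> real \<Rightarrow> real" where
  "tent n k x = max 0 (min 1 (5 / 2 - \<bar>x * 4 ^ n - (real k + 1 / 2)\<bar>))"

lemma tent_bounds: "0 \<le> tent n k x" "tent n k x \<le> 1" "\<bar>tent n k x\<bar> \<le> 1"
  by (auto simp: tent_def)

lemma isCont_tent: "isCont (tent n k) x"
  unfolding tent_def by (intro continuous_intros)

lemma measurable_tent [measurable]: "tent n k \<in> borel_measurable borel"
  unfolding tent_def[abs_def] by measurable

lemma tent_le_cells: "tent n k x \<le> (\<Sum>a\<in>{-2..2}. of_bool (\<lfloor>x * 4 ^ n\<rfloor> = int k + a))"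
proof (cases "tent n k x = 0")
  case False
  then have "\<bar>x * 4 ^ n - (real k + 1 / 2)\<bar> < 5 / 2"
    by (simp add: tent_def max_def min_def split: if_splits)
  then have "real k - 2 < x * 4 ^ n" "x * 4 ^ n < real k + 3"
    by linarith+
  then have "\<lfloor>x * 4 ^ n\<rfloor> - int k \<in> {-2..2}"
    by (simp add: le_floor_iff floor_le_iff) linarith
  then have "(\<Sum>a\<in>{\<lfloor>x * 4 ^ n\<rfloor> - int k}. of_bool (\<lfloor>x * 4 ^ n\<rfloor> = int k + a) :: real)
      \<le> (\<Sum>a\<in>{-2..2}. of_bool (\<lfloor>x * 4 ^ n\<rfloor> = int k + a))"
    by (intro sum_mono2) auto
  then show ?thesis
    using tent_bounds(2)[of n k x] by simp
qed (auto intro: sum_nonneg)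

text \<open>A shift drops indices at one end and brings in only zeros at the other. \<open>P\<close>
  lives on the integers since \<open>k + a\<close> may be negative.\<close>

lemma sum_shift_le:
  fixes P :: "int \<Rightarrow> real"
  assumes "\<And>z. z \<notin> int ` {..<K} \<Longrightarrow> P z = 0"
  shows "(\<Sum>k<K. (P (int k + a))\<^sup>2) \<le> (\<Sum>k<K. (P (int k))\<^sup>2)"
proof -
  have "(\<Sum>k<K. (P (int k + a))\<^sup>2) = (\<Sum>z\<in>(\<lambda>k. int k + a) ` {..<K}. (P z)\<^sup>2)"
    by (subst sum.reindex) (auto simp: inj_on_def)
  also have "\<dots> = (\<Sum>z\<in>(\<lambda>k. int k + a) ` {..<K} \<inter> int ` {..<K}. (P z)\<^sup>2)"
    using assms by (intro sum.mono_neutral_right) auto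
  also have "\<dots> \<le> (\<Sum>z\<in>int ` {..<K}. (P z)\<^sup>2)"
    by (intro sum_mono2) auto
  also have "\<dots> = (\<Sum>k<K. (P (int k))\<^sup>2)"
    by (subst sum.reindex) auto
  finally show ?thesis .
qed

text \<open>If the first point of a near pair is in cell \<open>k\<close>, both points are in the
  threefold cell \<open>J k\<close>, whose indicator is below the tent. The restriction to
  \<open>[0, 1)\<close> ensures \<open>k < 4^n\<close>.\<close>

lemma near_pairs_le_tent:
  assumes \<nu>: "real_distribution \<nu>" and AE: "AE x in \<nu>. x \<in> {0..<1}"
  shows "near_pairs \<nu> n \<le> (\<Sum>k<4 ^ n. (\<integral>x. tent n k x \<partial>\<nu>)\<^sup>2)"
proof -
  interpret N: real_distribution \<nu> by fact
  interpret NN: pair_prob_space \<nu> \<nu> ..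
  define J where "J k = {x :: real. \<bar>x * 4 ^ n - (real k + 1 / 2)\<bar> \<le> 3 / 2}" for k
  have J [measurable]: "J k \<in> sets \<nu>" for k
  proof -
    have "{x \<in> space borel. \<bar>x * 4 ^ n - (real k + 1 / 2)\<bar> \<le> 3 / 2} \<in> sets (borel :: real measure)"
      by measurable
    then show ?thesis
      by (simp add: J_def)
  qed
  have int: "integrable \<nu> (tent n k)" for k
    using tent_bounds(3) by (intro N.integrable_const_bound[where B = 1]) auto
  have times: "measure (\<nu> \<Otimes>\<^sub>M \<nu>) (J k \<times> J k) = (measure \<nu> (J k))\<^sup>2" for k
    by (simp add: measure_def N.emeasure_pair_measure_Times[OF J J] enn2real_mult power2_eq_square)
  have "near_pairs \<nu> n \<le> measure (\<nu> \<Otimes>\<^sub>M \<nu>) (\<Union>k<4 ^ n. J k \<times> J k)"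
    unfolding near_pairs_def
  proof (rule NN.P.finite_measure_mono_AE)
    have "AE p in \<nu> \<Otimes>\<^sub>M \<nu>. fst p \<in> {0..<1}"
    proof (rule NN.AE_pair_measure)
      show "AE x in \<nu>. AE y in \<nu>. fst (x, y) \<in> {0..<1}"
        using AE by eventually_elim simp
      show "{p \<in> space (\<nu> \<Otimes>\<^sub>M \<nu>). fst p \<in> {0..<1}} \<in> sets (\<nu> \<Otimes>\<^sub>M \<nu>)"
        by measurable
    qed
    then show "AE p in \<nu> \<Otimes>\<^sub>M \<nu>. p \<in> {p. \<bar>snd p - fst p\<bar> \<le> (1 / 4) ^ n} \<longrightarrow> p \<in> (\<Union>k<4 ^ n. J k \<times> J k)"
    proof eventually_elim
      case (elim p)
      show ?case
      proof
        assume "p \<in> {p. \<bar>snd p - fst p\<bar> \<le> (1 / 4) ^ n}"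
        then have "\<bar>snd p - fst p\<bar> * 4 ^ n \<le> 1"
          by (simp add: field_simps power_divide)
        then have near: "\<bar>snd p * 4 ^ n - fst p * 4 ^ n\<bar> \<le> 1"
          by (simp add: left_diff_distrib[symmetric] abs_mult)
        define k where "k = nat \<lfloor>fst p * 4 ^ n\<rfloor>"
        have fp: "0 \<le> fst p * 4 ^ n" "fst p * 4 ^ n < 4 ^ n"
          using elim by auto
        then have k: "real k \<le> fst p * 4 ^ n" "fst p * 4 ^ n < real k + 1"
          unfolding k_def by (auto simp: of_nat_nat)
        have "real k < 4 ^ n"
          using k(1) fp(2) by linarith
        then have "k < 4 ^ n"
          by (metis of_nat_less_iff of_nat_numeral of_nat_power)
        moreover have "p \<in> J k \<times> J k"
          using k near unfolding J_def mem_Times_iff mem_Collect_eq by linarith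
        ultimately show "p \<in> (\<Union>k<4 ^ n. J k \<times> J k)"
          by blast
      qed
    qed
  qed measurable
  also have "\<dots> \<le> (\<Sum>k<4 ^ n. measure (\<nu> \<Otimes>\<^sub>M \<nu>) (J k \<times> J k))"
    using J by (intro NN.P.finite_measure_subadditive_finite image_subsetI pair_measureI) auto
  also have "\<dots> \<le> (\<Sum>k<4 ^ n. (\<integral>x. tent n k x \<partial>\<nu>)\<^sup>2)"
    unfolding times
  proof (intro sum_mono power_mono)
    fix k
    have "measure \<nu> (J k) = (\<integral>x. indicator (J k) x \<partial>\<nu>)"
      by simp
    also have "\<dots> \<le> (\<integral>x. tent n k x \<partial>\<nu>)"
    proof (intro integral_mono int)
      show "integrable \<nu> (indicator (J k) :: real \<Rightarrow> real)"
        by (intro N.integrable_const_bound[where B = 1]) auto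
      show "indicator (J k) x \<le> tent n k x" for x
        using tent_bounds(1)[of n k x] by (auto simp: J_def tent_def indicator_def)
    qed
    finally show "measure \<nu> (J k) \<le> (\<integral>x. tent n k x \<partial>\<nu>)" .
  qed simp
  finally show ?thesis .
qed

text \<open>By continuity, rounding a zero \<open>t\<close> down to a fine grid gives a point with
  \<open>|g|\<close> below the threshold, and rounding down does not leave the
  level-\<open>n\<close> cell of \<open>t\<close>. Only finitely many cells are possible, so one
  \<open>r\<close> detects all of them together. A zero at 1 would occupy the extra cell
  \<open>4^n\<close>, which \<open>g1\<close> excludes.\<close>

lemma cells_zero_set:
  fixes g :: "real \<Rightarrow> real" and s :: "nat \<Rightarrow> nat" and C :: real
  assumes cont: "continuous_on {0..1} g" and g1: "g 1 \<noteq> 0" and s: "strict_mono s"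
    and hits: "\<And>r. n \<le> s r \<Longrightarrow>
      card {k. k < 4 ^ n \<and> (\<exists>j<4 ^ (s r - n). \<bar>g (real (k * 4 ^ (s r - n) + j) / 4 ^ s r)\<bar> \<le> (1 / 2) ^ n / 4)}
        \<le> C * 2 ^ n"
  shows "finite (cells n {t \<in> {0..1}. g t = 0}) \<and> card (cells n {t \<in> {0..1}. g t = 0}) \<le> C * 2 ^ n"
proof -
  define Z where "Z = {t \<in> {0..1}. g t = 0}"
  define A where "A r = {k. k < 4 ^ n \<and>
    (\<exists>j<4 ^ (s r - n). \<bar>g (real (k * 4 ^ (s r - n) + j) / 4 ^ s r)\<bar> \<le> (1 / 2) ^ n / 4)}" for r
  have Z1: "0 \<le> t" "t < 1" if "t \<in> Z" for t
  proof -
    show "0 \<le> t"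
      using that by (simp add: Z_def)
    have "t \<noteq> 1" "t \<le> 1"
      using that g1 by (auto simp: Z_def)
    then show "t < 1"
      by simp
  qed
  have "cells n Z \<subseteq> {0..<4 ^ n}"
    using Z1 by (auto simp: cells_def floor_less_iff)
  then have fin: "finite (cells n Z)"
    using finite_subset by blast
  have ev: "\<forall>\<^sub>F r in sequentially. k \<in> int ` A r" if k: "k \<in> cells n Z" for k
  proof -
    obtain t where t: "t \<in> Z" "k = \<lfloor>t * 4 ^ n\<rfloor>"
      using k unfolding cells_def by blast
    have "t \<in> {0..1}" "g t = 0"
      using t(1) by (auto simp: Z_def)
    moreover have "0 < (1 / 2 :: real) ^ n / 4"
      by simp
    ultimately obtain \<delta> where \<delta>: "\<delta> > 0" "\<And>u. u \<in> {0..1} \<Longrightarrow> dist u t < \<delta> \<Longrightarrow> dist (g u) (g t) < (1 / 2) ^ n / 4"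
      using cont unfolding continuous_on_iff by metis
    have "(\<lambda>r. (1 / 4 :: real) ^ r) \<longlonglongrightarrow> 0"
      by (intro LIMSEQ_realpow_zero) auto
    then have "\<forall>\<^sub>F r in sequentially. (1 / 4 :: real) ^ r < \<delta>"
      using \<delta>(1) by (auto simp: order_tendsto_iff)
    moreover have "\<forall>\<^sub>F r in sequentially. n \<le> r"
      by (rule eventually_ge_at_top)
    ultimately show ?thesis
    proof eventually_elim
      case (elim r)
      define m where "m = s r"
      have rm: "r \<le> m"
        using s unfolding m_def by (simp add: strict_mono_imp_increasing)
      then have nm: "n \<le> m"
        using elim by simp
      define l :: nat where "l = 4 ^ (m - n)"
      have l: "l > 0" "real l * 4 ^ n = 4 ^ m"
        using nm by (simp_all add: l_def power_add[symmetric])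
      define i where "i = nat \<lfloor>t * 4 ^ m\<rfloor>"
      have i: "real i \<le> t * 4 ^ m" "t * 4 ^ m < real i + 1"
        using Z1(1)[OF t(1)] unfolding i_def by auto
      have dist: "dist (real i / 4 ^ m) t < \<delta>"
      proof -
        have "t < (real i + 1) / 4 ^ m" "real i / 4 ^ m \<le> t"
          using i by (simp_all add: pos_less_divide_eq pos_divide_le_eq)
        then have "t - real i / 4 ^ m < 1 / 4 ^ m" "real i / 4 ^ m \<le> t"
          by (simp_all add: add_divide_distrib)
        moreover have "1 / 4 ^ m = (1 / 4 :: real) ^ m"
          by (simp add: power_divide)
        moreover have "(1 / 4 :: real) ^ m \<le> (1 / 4) ^ r"
          using rm by (intro power_decreasing) auto
        ultimately show ?thesis
          using elim(1) unfolding dist_real_def by linarith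
      qed
      have "real i / 4 ^ m \<le> t"
        using i by (simp add: pos_divide_le_eq)
      then have "real i / 4 ^ m \<in> {0..1}"
        using Z1(2)[OF t(1)] unfolding atLeastAtMost_iff by (intro conjI divide_nonneg_pos) (linarith | simp)+
      from \<delta>(2)[OF this dist] have small: "\<bar>g (real i / 4 ^ m)\<bar> \<le> (1 / 2) ^ n / 4"
        using \<open>g t = 0\<close> by simp
      have "int (i div l) = \<lfloor>real i / real l\<rfloor>"
        by (simp add: floor_divide_of_nat_eq)
      also have "\<dots> = k"
      proof -
        have kt: "of_int k \<le> t * 4 ^ n" "t * 4 ^ n < of_int k + 1"
          using t(2) by linarith+
        have "of_int k * real l \<le> t * 4 ^ n * real l"
          using kt(1) l(1) by (intro mult_right_mono) auto
        then have "of_int (k * int l) \<le> t * 4 ^ m"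
          using l(2) by (simp add: mult_ac)
        then have "k * int l \<le> \<lfloor>t * 4 ^ m\<rfloor>"
          by (simp only: le_floor_iff)
        then have "k * int l \<le> int i"
          using Z1(1)[OF t(1)] by (simp add: i_def)
        then have "of_int k * real l \<le> real i"
          by (metis of_int_le_iff of_int_mult of_int_of_nat_eq)
        then have 1: "of_int k \<le> real i / real l"
          using l(1) by (simp add: field_simps)
        have "real i / real l \<le> t * 4 ^ m / real l"
          using i(1) by (intro divide_right_mono) auto
        also have "\<dots> = t * 4 ^ n"
          using l(1) unfolding l(2)[symmetric] by simp
        finally have "real i / real l < of_int k + 1"
          using kt(2) by linarith
        with 1 show ?thesis
          by (simp add: floor_eq_iff)
      qed
      finally have ik: "int (i div l) = k" .
      have "real i < 4 ^ m"
      proof -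
        have "t * 4 ^ m < 1 * 4 ^ m"
          by (rule mult_strict_right_mono[OF Z1(2)[OF t(1)]]) simp
        then show ?thesis
          using i(1) by linarith
      qed
      then have "real i < real (4 ^ n * l)"
        by (simp add: l(2)[symmetric] mult.commute)
      then have "i < 4 ^ n * l"
        by (simp only: of_nat_less_iff)
      then have "i div l < 4 ^ n"
        by (simp add: less_mult_imp_div_less)
      moreover have "i mod l < l"
        using l(1) by simp
      moreover have "\<bar>g (real (i div l * l + i mod l) / 4 ^ m)\<bar> \<le> (1 / 2) ^ n / 4"
        using small by (simp only: div_mult_mod_eq)
      ultimately have "i div l \<in> A r"
        unfolding A_def m_def[symmetric] l_def[symmetric] by blast
      then show ?case
        using ik by blast
    qed
  qed
  have "\<forall>\<^sub>F r in sequentially. \<forall>k\<in>cells n Z. k \<in> int ` A r"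
    using fin ev by (intro eventually_ball_finite) auto
  moreover have "\<forall>\<^sub>F r in sequentially. n \<le> r"
    by (rule eventually_ge_at_top)
  ultimately have "\<forall>\<^sub>F r in sequentially. cells n Z \<subseteq> int ` A r \<and> n \<le> s r"
  proof eventually_elim
    case (elim r)
    then show ?case
      using strict_mono_imp_increasing[OF s, of r] by auto
  qed
  then obtain r where r: "cells n Z \<subseteq> int ` A r" "n \<le> s r"
    using eventually_happens'[OF sequentially_bot] by blast
  have "finite (A r)"
    unfolding A_def by simp
  then have "card (cells n Z) \<le> card (A r)"
    using card_mono[OF _ r(1)] card_image_le[of "A r" int] by simp
  also have "real (card (A r)) \<le> C * 2 ^ n"
    unfolding A_def by (rule hits[OF r(2)])
  finally have "card (cells n Z) \<le> C * 2 ^ n"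
    by simp
  with fin show ?thesis
    by (simp add: Z_def)
qed

text \<open>The tent is at most the indicator of five cells. Cauchy-Schwarz over the five shifts
  costs a factor 5, and each shifted sum of squares is at most the unshifted one:
  \<open>25 = 5 * 5\<close>.\<close>

lemma tent_sum_bound:
  fixes w :: "nat \<Rightarrow> real"
  assumes nm: "n \<le> m" and w: "\<And>i. 0 \<le> w i"
  shows "(\<Sum>k<4 ^ n. (\<Sum>i<4 ^ m. w i * tent n k (real i / 4 ^ m))\<^sup>2)
    \<le> 25 * (\<Sum>k<4 ^ n. (\<Sum>j<4 ^ (m - n). w (k * 4 ^ (m - n) + j))\<^sup>2)"
proof -
  define l :: nat where "l = 4 ^ (m - n)"
  have l: "l > 0" "4 ^ n * l = 4 ^ m"
    using nm by (simp_all add: l_def power_add[symmetric])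
  have l': "4 ^ n * real l = 4 ^ m"
    using l(2) by (metis of_nat_mult of_nat_numeral of_nat_power)
  have dm: "(k * l + j) div l = k" if "j < l" for k j
    using that l by simp
  have fl: "\<lfloor>real i / 4 ^ m * 4 ^ n\<rfloor> = int (i div l)" for i
  proof -
    have "real i / 4 ^ m * 4 ^ n = real i / real l"
      unfolding l'[symmetric] by simp
    then show ?thesis
      by (simp add: floor_divide_of_nat_eq)
  qed
  define P where "P z = (\<Sum>i<4 ^ m. w i * of_bool (int (i div l) = z))" for z
  have P0: "P z = 0" if "z \<notin> int ` {..<4 ^ n}" for z
    unfolding P_def
  proof (intro sum.neutral ballI)
    fix i :: nat assume "i \<in> {..<4 ^ m}"
    then have "i div l < 4 ^ n"
      using l(2) by (simp add: less_mult_imp_div_less)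
    then show "w i * of_bool (int (i div l) = z) = 0"
      using that by auto
  qed
  have P: "P (int k) = (\<Sum>j<l. w (k * l + j))" if "k < 4 ^ n" for k
  proof -
    have "P (int k) = (\<Sum>k'<4 ^ n. \<Sum>j<l. w (k' * l + j) * of_bool ((k' * l + j) div l = k))"
      unfolding P_def l(2)[symmetric] sum_blocks by simp
    also have "\<dots> = (\<Sum>k'<4 ^ n. if k' = k then (\<Sum>j<l. w (k' * l + j)) else 0)"
      by (intro sum.cong refl) (auto simp: dm)
    also have "\<dots> = (\<Sum>j<l. w (k * l + j))"
      using that by simp
    finally show ?thesis .
  qed
  have tent: "(\<Sum>i<4 ^ m. w i * tent n k (real i / 4 ^ m)) \<le> (\<Sum>a\<in>{-2..2}. P (int k + a))" for k
  proof -
    have "(\<Sum>i<4 ^ m. w i * tent n k (real i / 4 ^ m))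
        \<le> (\<Sum>i<4 ^ m. w i * (\<Sum>a\<in>{-2..2}. of_bool (int (i div l) = int k + a)))"
      using tent_le_cells[of n k "real i / 4 ^ m" for i] w by (intro sum_mono mult_left_mono) (simp_all only: fl)
    also have "\<dots> = (\<Sum>a\<in>{-2..2}. P (int k + a))"
      unfolding P_def sum_distrib_left by (rule sum.swap)
    finally show ?thesis .
  qed
  have "(\<Sum>k<4 ^ n. (\<Sum>i<4 ^ m. w i * tent n k (real i / 4 ^ m))\<^sup>2)
      \<le> (\<Sum>k<4 ^ n. (\<Sum>a\<in>{-2..2}. P (int k + a))\<^sup>2)"
    using w tent_bounds(1) by (intro sum_mono power_mono tent sum_nonneg) auto
  also have "\<dots> \<le> (\<Sum>k<4 ^ n. (\<Sum>a\<in>{-2..2}. (P (int k + a))\<^sup>2) * 5)"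
    using sum_squared_le_sum_of_squares[of "\<lambda>a. P (int k + a)" "{-2..2}" for k] by (intro sum_mono) simp
  also have "\<dots> = 5 * (\<Sum>a\<in>{-2..2}. \<Sum>k<4 ^ n. (P (int k + a))\<^sup>2)"
    unfolding sum_distrib_right[symmetric] by (subst sum.swap) simp
  also have "\<dots> \<le> 5 * (\<Sum>a\<in>{-2..2 :: int}. \<Sum>k<4 ^ n. (P (int k))\<^sup>2)"
    using P0 by (intro mult_left_mono sum_mono sum_shift_le) auto
  also have "\<dots> = 25 * (\<Sum>k<4 ^ n. (\<Sum>j<l. w (k * l + j))\<^sup>2)"
    using P by simp
  finally show ?thesis
    by (simp add: l_def)
qed

text \<open>The deterministic half of the argument: \<open>g\<close> is a path and
  \<open>w r\<close> are weights on the grid of level \<open>s r\<close>. By \<open>decay\<close>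
  the normalised weights integrate \<open>|g|^3\<close> to at most \<open>6 / (c * 4^(s r))\<close>,
  so their weak limit is carried by the zeros. The lower bound \<open>c\<close> on the mass prevents
  the normalisation from destroying \<open>blocks\<close>.\<close>

lemma half_dimensional_zero_set:
  fixes g :: "real \<Rightarrow> real" and w :: "nat \<Rightarrow> nat \<Rightarrow> real" and s :: "nat \<Rightarrow> nat" and C :: real
  assumes cont: "continuous_on {0..1} g" and g1: "g 1 \<noteq> 0" and s: "strict_mono s"
    and hits: "\<And>r n. n \<le> s r \<Longrightarrow>
      card {k. k < 4 ^ n \<and> (\<exists>j<4 ^ (s r - n). \<bar>g (real (k * 4 ^ (s r - n) + j) / 4 ^ s r)\<bar> \<le> (1 / 2) ^ n / 4)}
        \<le> C * 2 ^ n"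
    and w: "\<And>r i. 0 \<le> w r i"
    and blocks: "\<And>r n. n \<le> s r \<Longrightarrow>
      (\<Sum>k<4 ^ n. (\<Sum>j<4 ^ (s r - n). w r (k * 4 ^ (s r - n) + j))\<^sup>2) \<le> C / 2 ^ n"
    and c: "c > 0" and mass: "\<And>r. c \<le> (\<Sum>i<4 ^ s r. w r i)"
    and decay: "\<And>r. (\<Sum>i<4 ^ s r. w r i * \<bar>g (real i / 4 ^ s r)\<bar> ^ 3) \<le> 6 / 4 ^ s r"
  shows "\<exists>C'. half_dimensional C' {t \<in> {0..1}. g t = 0}"
proof -
  define Z where "Z = {t \<in> {0..1}. g t = 0}"
  define W where "W r = (\<Sum>i<4 ^ s r. w r i)" for r
  have W: "W r \<ge> c" "W r > 0" for r
    using mass[of r] c by (simp_all add: W_def)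
  define p where "p r i = w r i / W r" for r i
  \<comment> \<open>Only indices below \<open>4^(s r)\<close> enter the sums, where the minimum has
    no effect; it puts all \<open>x r i\<close> into \<open>[0, 1]\<close>, as
    \<open>weak_limit_of_weights\<close> demands.\<close>
  define x where "x r i = min 1 (real i / 4 ^ s r)" for r and i :: nat
  have p: "0 \<le> p r i" "(\<Sum>i<4 ^ s r. p r i) = 1" for r i
    using w W(2)[of r] by (simp_all add: p_def sum_divide_distrib[symmetric] flip: W_def)
  have x01: "x r i \<in> {0..1}" for r i
    by (simp add: x_def)
  have x: "x r i = real i / 4 ^ s r" if "i < 4 ^ s r" for r i
  proof -
    have "real i < 4 ^ s r"
      using that by (metis of_nat_less_iff of_nat_numeral of_nat_power)
    then show ?thesis
      by (simp add: x_def)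
  qed
  obtain t \<nu> where t: "strict_mono t" and \<nu>: "real_distribution \<nu>"
    and lim: "\<And>f B. (\<And>x. isCont f x) \<Longrightarrow> (\<And>x. \<bar>f x :: real\<bar> \<le> B) \<Longrightarrow>
      (\<lambda>r. \<Sum>i<4 ^ s (t r). p (t r) i * f (x (t r) i)) \<longlonglongrightarrow> (\<integral>x. f x \<partial>\<nu>)"
    by (rule weak_limit_of_weights[of p "\<lambda>r. 4 ^ s r" x]) (use p x01 in auto)
  interpret N: real_distribution \<nu> by fact
  have st: "r \<le> s (t r)" for r
    using strict_mono_imp_increasing[OF t, of r] strict_mono_imp_increasing[OF s, of "t r"] by simp
  define clamp where "clamp y = max 0 (min 1 y)" for y :: real
  \<comment> \<open>A bounded continuous test function on the whole line that vanishes exactly on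
    \<open>Z\<close>: \<open>clamp\<close> extends \<open>g\<close> by constants, and the second
    summand is positive outside \<open>[0, 1]\<close>.\<close>
  define G where "G y = min 1 (\<bar>g (clamp y)\<bar> ^ 3) + min 1 \<bar>y - clamp y\<bar>" for y
  have contG: "isCont G y" for y
  proof -
    have "continuous_on UNIV clamp"
      unfolding clamp_def by (intro continuous_intros)
    moreover have "clamp ` UNIV \<subseteq> {0..1}"
      by (auto simp: clamp_def)
    ultimately have "continuous_on UNIV (\<lambda>y. g (clamp y))"
      using continuous_on_compose2[OF cont] by blast
    then have "continuous_on UNIV G"
      unfolding G_def clamp_def by (intro continuous_intros)
    then show ?thesis
      by (simp add: continuous_on_eq_continuous_at)
  qed
  have G: "0 \<le> G y" "\<bar>G y\<bar> \<le> 2" for y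
    by (auto simp: G_def abs_le_iff)
  have [measurable]: "G \<in> borel_measurable borel"
    using contG by (intro borel_measurable_continuous_onI continuous_at_imp_continuous_on) auto
  have intG: "integrable \<nu> G"
    using G by (intro N.integrable_const_bound[where B = 2]) auto
  have "(\<integral>y. G y \<partial>\<nu>) \<le> 0"
  proof (rule LIMSEQ_le)
    show "(\<lambda>r. \<Sum>i<4 ^ s (t r). p (t r) i * G (x (t r) i)) \<longlonglongrightarrow> (\<integral>y. G y \<partial>\<nu>)"
      using contG G(2) by (rule lim)
    have "(\<lambda>r. 6 / c * (1 / 4) ^ r) \<longlonglongrightarrow> 6 / c * 0"
      by (intro tendsto_mult tendsto_const LIMSEQ_realpow_zero) auto
    then show "(\<lambda>r. 6 / c * (1 / 4) ^ r) \<longlonglongrightarrow> 0"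
      by simp
    have "(\<Sum>i<4 ^ s (t r). p (t r) i * G (x (t r) i)) \<le> 6 / c * (1 / 4) ^ r" for r
    proof -
      define q where "q = t r"
      have "(\<Sum>i<4 ^ s q. p q i * G (x q i)) \<le> (\<Sum>i<4 ^ s q. w q i * \<bar>g (real i / 4 ^ s q)\<bar> ^ 3 / W q)"
      proof (rule sum_mono)
        fix i :: nat assume i: "i \<in> {..<4 ^ s q}"
        have "clamp (x q i) = x q i"
          using x01[of q i] by (simp add: clamp_def)
        then have "G (x q i) \<le> \<bar>g (real i / 4 ^ s q)\<bar> ^ 3"
          using i x[of i q] by (simp add: G_def)
        then have "p q i * G (x q i) \<le> p q i * \<bar>g (real i / 4 ^ s q)\<bar> ^ 3"
          using p by (intro mult_left_mono)
        then show "p q i * G (x q i) \<le> w q i * \<bar>g (real i / 4 ^ s q)\<bar> ^ 3 / W q"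
          by (simp add: p_def)
      qed
      also have "\<dots> \<le> 6 / 4 ^ s q / W q"
        unfolding sum_divide_distrib[symmetric] using decay[of q] W(2)[of q] by (intro divide_right_mono) auto
      also have "\<dots> \<le> 6 / 4 ^ s q / c"
        using W[of q] c by (intro divide_left_mono) auto
      also have "\<dots> = 6 / c * (1 / 4) ^ s q"
        by (simp add: power_divide)
      also have "\<dots> \<le> 6 / c * (1 / 4) ^ r"
        using c st[of r] unfolding q_def by (intro mult_left_mono power_decreasing) auto
      finally show ?thesis
        by (simp add: q_def)
    qed
    then show "\<exists>N. \<forall>r\<ge>N. (\<Sum>i<4 ^ s (t r). p (t r) i * G (x (t r) i)) \<le> 6 / c * (1 / 4) ^ r"
      by blast
  qed
  then have "(\<integral>y. G y \<partial>\<nu>) = 0"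
    using G(1) by (intro antisym integral_nonneg_AE) auto
  then have "AE y in \<nu>. G y = 0"
    using integral_nonneg_eq_0_iff_AE[OF intG] G(1) by auto
  moreover have ZG: "G y = 0 \<longleftrightarrow> y \<in> Z" for y
  proof -
    have "G y = 0 \<longleftrightarrow> g (clamp y) = 0 \<and> y = clamp y"
      unfolding G_def by (subst add_nonneg_eq_0_iff) (auto simp: min_def)
    also have "\<dots> \<longleftrightarrow> y \<in> Z"
      by (auto simp: Z_def clamp_def max_def min_def split: if_splits)
    finally show ?thesis .
  qed
  ultimately have AEZ: "AE y in \<nu>. y \<in> Z"
    by simp
  have "{y \<in> space borel. G y = 0} \<in> sets borel"
    by measurable
  then have [measurable]: "Z \<in> sets borel"
    by (simp add: ZG)
  have Z1: "emeasure \<nu> Z = 1"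
    using AEZ by (intro N.emeasure_eq_1_AE) auto
  have "AE y in \<nu>. y \<in> {0..<1}"
    using AEZ
  proof eventually_elim
    case (elim y)
    then have "0 \<le> y" "y \<le> 1" "y \<noteq> 1"
      using g1 by (auto simp: Z_def)
    then show ?case
      by simp
  qed
  note near1 = near_pairs_le_tent[OF \<nu> this]
  have near: "near_pairs \<nu> n \<le> (25 * C / c\<^sup>2) / 2 ^ n" for n
  proof (rule order_trans[OF near1])
    have lim': "(\<lambda>r. \<Sum>k<4 ^ n. (\<Sum>i<4 ^ s (t r). p (t r) i * tent n k (x (t r) i))\<^sup>2)
        \<longlonglongrightarrow> (\<Sum>k<4 ^ n. (\<integral>y. tent n k y \<partial>\<nu>)\<^sup>2)"
      by (intro tendsto_sum tendsto_power lim[of _ 1] isCont_tent tent_bounds(3))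
    show "(\<Sum>k<4 ^ n. (\<integral>y. tent n k y \<partial>\<nu>)\<^sup>2) \<le> (25 * C / c\<^sup>2) / 2 ^ n"
    \<comment> \<open>For fixed \<open>n\<close> the block bound holds as soon as the grid is at
      least as fine as level \<open>n\<close>, which is certain for
      \<open>r \<ge> n\<close>.\<close>
    proof (rule LIMSEQ_le_const2[OF lim'], intro exI[of _ n] allI impI)
      fix r assume "n \<le> r"
      define q where "q = t r"
      have nq: "n \<le> s q"
        using st[of r] \<open>n \<le> r\<close> by (simp add: q_def)
      have "(\<Sum>k<4 ^ n. (\<Sum>i<4 ^ s q. p q i * tent n k (x q i))\<^sup>2)
          = (\<Sum>k<4 ^ n. (\<Sum>i<4 ^ s q. p q i * tent n k (real i / 4 ^ s q))\<^sup>2)"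
        using x by simp
      also have "\<dots> \<le> 25 * (\<Sum>k<4 ^ n. (\<Sum>j<4 ^ (s q - n). p q (k * 4 ^ (s q - n) + j))\<^sup>2)"
        by (rule tent_sum_bound[OF nq p(1)])
      also have "\<dots> = 25 * ((\<Sum>k<4 ^ n. (\<Sum>j<4 ^ (s q - n). w q (k * 4 ^ (s q - n) + j))\<^sup>2) / (W q)\<^sup>2)"
        by (simp add: p_def sum_divide_distrib[symmetric] power_divide)
      also have "\<dots> \<le> 25 * (C / 2 ^ n / (W q)\<^sup>2)"
        using blocks[OF nq] by (intro mult_left_mono divide_right_mono) auto
      also have "\<dots> \<le> 25 * (C / 2 ^ n / c\<^sup>2)"
      proof (intro mult_left_mono divide_left_mono)
        show "c\<^sup>2 \<le> (W q)\<^sup>2"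
          using W[of q] c by (intro power_mono) auto
        have "0 \<le> (\<Sum>k<4 ^ n. (\<Sum>j<4 ^ (s q - n). w q (k * 4 ^ (s q - n) + j))\<^sup>2)"
          by (intro sum_nonneg) simp
        then show "0 \<le> C / 2 ^ n"
          using blocks[OF nq] by linarith
        show "0 < (W q)\<^sup>2 * c\<^sup>2"
          using W[of q] c by simp
      qed simp
      finally show "(\<Sum>k<4 ^ n. (\<Sum>i<4 ^ s (t r). p (t r) i * tent n k (x (t r) i))\<^sup>2) \<le> (25 * C / c\<^sup>2) / 2 ^ n"
        by (simp add: q_def mult.commute)
    qed
  qed
  define C' where "C' = max 1 (max C (25 * C / c\<^sup>2))"
  have "half_dimensional C' Z"
    unfolding half_dimensional_def
  proof (intro conjI allI exI[of _ \<nu>])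
    show "C' > 0"
      by (simp add: C'_def)
    fix n
    have cells: "finite (cells n Z) \<and> card (cells n Z) \<le> C * 2 ^ n"
      unfolding Z_def by (rule cells_zero_set[OF cont g1 s hits])
    then show "finite (cells n Z)" ..
    show "card (cells n Z) \<le> C' * 2 ^ n"
      by (rule order_trans[OF conjunct2[OF cells]]) (simp add: C'_def mult_right_mono)
    show "near_pairs \<nu> n \<le> C' / 2 ^ n"
      by (rule order_trans[OF near], rule divide_right_mono) (simp_all add: C'_def)
  qed (use Z1 N.prob_space_axioms in simp_all)
  then show ?thesis
    by (auto simp: Z_def)
qed

section \<open>Random walks and their discrete local time\<close>

text \<open>The pathwise substitute for stopping: a flag that stays up once raised selects the
  increments after the first time at which it is up.\<close>

lemma telescope_from_first:
  fixes U :: "nat \<Rightarrow> real"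
  assumes P: "P m" "m < n" and mono: "\<And>i j. i \<le> j \<Longrightarrow> P i \<Longrightarrow> P j"
  shows "\<exists>i\<le>m. P i \<and> (\<forall>j<i. \<not> P j) \<and>
    (\<Sum>j<n. of_bool (P j) * (U j - U (Suc j))) = U i - U n"
proof -
  define i where "i = (LEAST j. P j)"
  have i: "P i" "i \<le> m" "\<And>j. j < i \<Longrightarrow> \<not> P j"
    unfolding i_def using LeastI[of P, OF P(1)] Least_le[of P, OF P(1)] not_less_Least by auto
  have "(\<Sum>j<n. of_bool (P j) * (U j - U (Suc j))) = (\<Sum>j=i..<n. U j - U (Suc j))"
  proof (rule sum.mono_neutral_cong_right)
    show "\<forall>j\<in>{..<n} - {i..<n}. of_bool (P j) * (U j - U (Suc j)) = 0"
      using i(3) by auto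
    show "\<And>j. j \<in> {i..<n} \<Longrightarrow> of_bool (P j) * (U j - U (Suc j)) = U j - U (Suc j)"
      using mono[of i] i(1) by auto
  qed auto
  also have "\<dots> = U i - U n"
    using i(2) P(2) sum_Suc_diff'[of i n "\<lambda>j. - U j"] by simp
  finally show ?thesis
    using i by auto
qed

text \<open>The first four moments of the normal law with variance \<open>d\<close>. Orders three
  and four enter the lower bound \<open>G_ge_poly\<close>, and order four the decay of
  \<open>H 1\<close>.\<close>

locale step_distribution = real_distribution \<gamma> for \<gamma> :: "real measure" +
  fixes d :: real
  assumes d_pos: "0 < d"
    and integrable_power4: "integrable \<gamma> (\<lambda>x. x ^ 4)"
    and mean_zero: "(\<integral>x. x \<partial>\<gamma>) = 0"
    and second_moment: "(\<integral>x. x\<^sup>2 \<partial>\<gamma>) = d"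
    and third_moment: "(\<integral>x. x ^ 3 \<partial>\<gamma>) = 0"
    and fourth_moment: "(\<integral>x. x ^ 4 \<partial>\<gamma>) = 3 * d\<^sup>2"
begin

lemma integrable_power: "k \<le> 4 \<Longrightarrow> integrable \<gamma> (\<lambda>x. x ^ k)"
proof (rule Bochner_Integration.integrable_bound[where f = "\<lambda>x. 1 + x ^ 4"])
  assume k: "k \<le> 4"
  have "\<bar>x\<bar> ^ k \<le> 1 + \<bar>x\<bar> ^ 4" for x :: real
  proof (cases "\<bar>x\<bar> \<le> 1")
    case True
    have "\<bar>x\<bar> ^ k \<le> 1"
      using True by (simp add: power_le_one)
    moreover have "0 \<le> \<bar>x\<bar> ^ 4"
      by simp
    ultimately show ?thesis by linarith
  next
    case False
    then have "\<bar>x\<bar> ^ k \<le> \<bar>x\<bar> ^ 4"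
      using k by (intro power_increasing) auto
    then show ?thesis by simp
  qed
  then show "AE x in \<gamma>. norm (x ^ k) \<le> norm (1 + x ^ 4)"
    by (intro AE_I2) (simp add: power_abs)
qed (use integrable_power4 in auto)

lemma integrable_moments [simp]:
  "integrable \<gamma> (\<lambda>x. x)" "integrable \<gamma> (\<lambda>x. x\<^sup>2)" "integrable \<gamma> (\<lambda>x. x ^ 3)"
  "integrable \<gamma> (\<lambda>x. x ^ 4)" "integrable \<gamma> (\<lambda>x. \<bar>x\<bar>)"
  using integrable_power[of 1] integrable_power[of 2] integrable_power[of 3] integrable_power4
  by auto

lemma prob_UNIV [simp]: "prob UNIV = 1"
  using prob_space by simp

lemma integrable_lipschitz:
  fixes f :: "real \<Rightarrow> real"
  assumes "\<And>x y. \<bar>f x - f y\<bar> \<le> L * \<bar>x - y\<bar>"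
  shows "f \<in> borel_measurable borel" "integrable \<gamma> (\<lambda>y. f (x + y))"
proof -
  have L: "L \<ge> 0"
    using assms[of 1 0] by (auto intro: order_trans[rotated])
  have "L-lipschitz_on UNIV f"
    using assms L by (auto simp: lipschitz_on_def dist_real_def)
  then have "continuous_on UNIV f"
    by (rule lipschitz_on_continuous_on)
  then show m: "f \<in> borel_measurable borel"
    by (rule borel_measurable_continuous_onI)
  show "integrable \<gamma> (\<lambda>y. f (x + y))"
  proof (rule Bochner_Integration.integrable_bound[where f = "\<lambda>y. \<bar>f x\<bar> + L * \<bar>y\<bar>"])
    show "(\<lambda>y. f (x + y)) \<in> borel_measurable \<gamma>"
      using m by measurable
    show "AE y in \<gamma>. norm (f (x + y)) \<le> norm (\<bar>f x\<bar> + L * \<bar>y\<bar>)"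
      using assms[of "x + y" x for y] L
      by (intro AE_I2) (smt (verit, best) add_diff_cancel_left' real_norm_def mult_nonneg_nonneg)
  qed auto
qed

section \<open>Expected modulus and expected local time after \<open>k\<close> steps\<close>

text \<open>\<open>G k x\<close> is the expected modulus of the walk started from \<open>x\<close> after \<open>k\<close> steps; with \<open>H\<close> it
  plays the role of the expected local time at \<open>0\<close> collected during these steps.\<close>

primrec G :: "nat \<Rightarrow> real \<Rightarrow> real" where
  "G 0 x = \<bar>x\<bar>"
| "G (Suc k) x = (\<integral>y. G k (x + y) \<partial>\<gamma>)"

definition H :: "nat \<Rightarrow> real \<Rightarrow> real" where
  "H k x = G k x - \<bar>x\<bar>"

lemma G_lipschitz: "\<bar>G k x - G k y\<bar> \<le> \<bar>x - y\<bar>"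
proof (induction k arbitrary: x y)
  case (Suc k)
  have int: "integrable \<gamma> (\<lambda>z. G k (x + z))" for x
    using integrable_lipschitz(2)[of "G k" 1] Suc by simp
  have "\<bar>G (Suc k) x - G (Suc k) y\<bar> = \<bar>\<integral>z. G k (x + z) - G k (y + z) \<partial>\<gamma>\<bar>"
    using int by simp
  also have "\<dots> \<le> (\<integral>z. \<bar>G k (x + z) - G k (y + z)\<bar> \<partial>\<gamma>)"
    by (rule integral_abs_bound)
  also have "\<dots> \<le> (\<integral>z. \<bar>x - y\<bar> \<partial>\<gamma>)"
    using int Suc[of "x + z" "y + z" for z] by (intro integral_mono integrable_abs) auto
  finally show ?case by simp
qed simp

lemma measurable_G [measurable]: "G k \<in> borel_measurable borel"
  using integrable_lipschitz(1)[of "G k" 1] G_lipschitz by simp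

lemma integrable_G [simp]: "integrable \<gamma> (\<lambda>y. G k (x + y))"
  using integrable_lipschitz(2)[of "G k" 1] G_lipschitz by simp

lemma measurable_H [measurable]: "H k \<in> borel_measurable borel"
  unfolding H_def by measurable

lemma integrable_abs_add [simp]: "integrable \<gamma> (\<lambda>y. \<bar>x + y\<bar>)"
  using integrable_G[of 0 x] by simp

lemma integrable_H [simp]: "integrable \<gamma> (\<lambda>y. H k (x + y))"
  unfolding H_def by simp

lemma G_Suc_mono: "G k x \<le> G (Suc k) x"
proof (induction k arbitrary: x)
  case 0
  have "\<bar>x\<bar> = \<bar>\<integral>y. x + y \<partial>\<gamma>\<bar>"
    by (simp add: mean_zero)
  also have "\<dots> \<le> (\<integral>y. \<bar>x + y\<bar> \<partial>\<gamma>)"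
    by (rule integral_abs_bound)
  finally show ?case by simp
next
  case (Suc k)
  have "(\<integral>y. G k (x + y) \<partial>\<gamma>) \<le> (\<integral>y. G (Suc k) (x + y) \<partial>\<gamma>)"
    by (intro integral_mono Suc integrable_G)
  then show ?case by (simp only: G.simps)
qed

lemma H_mono: "j \<le> k \<Longrightarrow> H j x \<le> H k x"
  using lift_Suc_mono_le[of "\<lambda>k. G k x" j k] G_Suc_mono by (simp add: H_def)

lemma H_0 [simp]: "H 0 x = 0"
  by (simp add: H_def)

lemma H_nonneg [simp]: "0 \<le> H k x"
  using H_mono[of 0 k x] by simp

text \<open>Jensen for the square root in tangent form:
  \<open>sqrt z \<le> (z + c^2) / (2 * c)\<close>, with \<open>c\<close> the bound to be proved, so
  that averaging the right-hand side over one step returns exactly \<open>c\<close>.\<close>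

lemma G_le: "G k x \<le> sqrt (x\<^sup>2 + real k * d)"
proof (induction k arbitrary: x)
  case (Suc k)
  define c where "c = sqrt (x\<^sup>2 + real (Suc k) * d)"
  have c: "c > 0" "c\<^sup>2 = x\<^sup>2 + real (Suc k) * d"
    using d_pos by (auto simp: c_def add_nonneg_pos)
  have le: "G k (x + y) \<le> (1 / (2 * c)) * (x\<^sup>2 + 2 * x * y + y\<^sup>2 + real k * d + c\<^sup>2)" for y
  proof -
    define z where "z = (x + y)\<^sup>2 + real k * d"
    have z: "z \<ge> 0"
      using d_pos by (simp add: z_def)
    have "0 \<le> (sqrt z - c)\<^sup>2"
      by simp
    then have "sqrt z * (2 * c) \<le> z + c\<^sup>2"
      using z by (simp add: power2_diff algebra_simps)
    then have "sqrt z \<le> (z + c\<^sup>2) / (2 * c)"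
      using c by (simp add: pos_le_divide_eq)
    moreover have "(z + c\<^sup>2) / (2 * c)
        = (1 / (2 * c)) * (x\<^sup>2 + 2 * x * y + y\<^sup>2 + real k * d + c\<^sup>2)"
      by (simp add: z_def power2_sum add_divide_distrib)
    ultimately show ?thesis
      using Suc[of "x + y"] unfolding z_def by simp
  qed
  have "G (Suc k) x \<le> (\<integral>y. (1 / (2 * c)) * (x\<^sup>2 + 2 * x * y + y\<^sup>2 + real k * d + c\<^sup>2) \<partial>\<gamma>)"
    unfolding G.simps using le by (intro integral_mono integrable_G) auto
  also have "\<dots> = (1 / (2 * c)) * (x\<^sup>2 + d + real k * d + c\<^sup>2)"
    by (simp add: mean_zero second_moment)
  also have "\<dots> = c"
    using c by (simp add: field_simps power2_eq_square)
  finally show ?case by (simp add: c_def)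
qed simp

lemma H_le: "H k x \<le> sqrt (real k * d)"
  using G_le[of k x] sqrt_add_le_add_sqrt[of "x\<^sup>2" "real k * d"] d_pos by (simp add: H_def)

text \<open>The polynomial minorant comes from \<open>u \<ge> 3 u\<^sup>2 - 4 u\<^sup>4\<close> for \<open>u \<ge> 0\<close>, i.e. from
  \<open>1 - 3 u + 4 u\<^sup>3 = (u + 1) (2 u - 1)\<^sup>2\<close>.\<close>

lemma G_ge_poly:
  assumes "r > 0"
  shows "3 / r * (x\<^sup>2 + real k * d)
    - 4 / r ^ 3 * (x ^ 4 + 6 * x\<^sup>2 * (real k * d) + 3 * (real k * d)\<^sup>2) \<le> G k x"
proof (induction k arbitrary: x)
  case 0
  define u where "u = \<bar>x\<bar> / r"
  have u: "u \<ge> 0" "\<bar>x\<bar> = r * u"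
    using assms by (auto simp: u_def)
  have "0 \<le> u * (u + 1) * (2 * u - 1)\<^sup>2"
    using u by simp
  then have "3 * u\<^sup>2 - 4 * u ^ 4 \<le> u"
    by (simp add: power2_eq_square power_numeral_reduce algebra_simps)
  then have "r * (3 * u\<^sup>2 - 4 * u ^ 4) \<le> r * u"
    using assms by simp
  moreover have "x\<^sup>2 = r\<^sup>2 * u\<^sup>2" "x ^ 4 = r ^ 4 * u ^ 4"
    using u(2) by (metis power2_abs power_mult_distrib, metis power_even_abs_numeral even_numeral power_mult_distrib)
  ultimately show ?case
    using assms u by (simp add: field_simps power2_eq_square power_numeral_reduce)
next
  case (Suc k)
  define p where "p y = 3 / r * (x\<^sup>2 + 2 * x * y + y\<^sup>2 + real k * d)
    - 4 / r ^ 3 * (x ^ 4 + 4 * x ^ 3 * y + 6 * x\<^sup>2 * y\<^sup>2 + 4 * x * y ^ 3 + y ^ 4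
        + 6 * (real k * d) * (x\<^sup>2 + 2 * x * y + y\<^sup>2) + 3 * (real k * d)\<^sup>2)" for y
  have "p y = 3 / r * ((x + y)\<^sup>2 + real k * d)
    - 4 / r ^ 3 * ((x + y) ^ 4 + 6 * (x + y)\<^sup>2 * (real k * d) + 3 * (real k * d)\<^sup>2)" for y
    unfolding p_def by (simp add: power2_eq_square power_numeral_reduce algebra_simps)
  then have "p y \<le> G k (x + y)" for y
    using Suc by simp
  moreover have "integrable \<gamma> p"
    unfolding p_def by simp
  ultimately have "(\<integral>y. p y \<partial>\<gamma>) \<le> (\<integral>y. G k (x + y) \<partial>\<gamma>)"
    by (intro integral_mono integrable_G)
  \<comment> \<open>The second bracket is the fourth moment of a normal variable with mean
    \<open>x\<close> and variance \<open>k * d\<close>. Since a step has normal moments up to order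
    four, averaging only raises the variance by \<open>d\<close>.\<close>
  moreover have "(\<integral>y. p y \<partial>\<gamma>) = 3 / r * (x\<^sup>2 + real (Suc k) * d)
    - 4 / r ^ 3 * (x ^ 4 + 6 * x\<^sup>2 * (real (Suc k) * d) + 3 * (real (Suc k) * d)\<^sup>2)"
    unfolding p_def
    by (simp add: mean_zero second_moment third_moment fourth_moment)
      (simp add: power2_eq_square algebra_simps)
  ultimately show ?case by simp
qed

text \<open>A visit within a quarter of the standard deviation \<open>t\<close> of the next
  \<open>k\<close> steps earns expected local time of order \<open>t\<close>. This is
  \<open>G_ge_poly\<close> with \<open>r = 3 * t\<close>; with \<open>u = |x| / t\<close> it becomes
  a numerical inequality on \<open>[0, 1 / 4]\<close>.\<close>

lemma H_ge:
  assumes x: "\<bar>x\<bar> \<le> sqrt (real k * d) / 4"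
  shows "sqrt (real k * d) / 4 \<le> H k x"
proof (cases "k = 0")
  case False
  define t where "t = sqrt (real k * d)"
  have t: "t > 0" "real k * d = t\<^sup>2"
    using False d_pos by (auto simp: t_def)
  define u where "u = \<bar>x\<bar> / t"
  have u: "0 \<le> u" "u \<le> 1 / 4" "\<bar>x\<bar> = t * u"
    using t x by (auto simp: u_def t_def field_simps)
  have xx: "x\<^sup>2 = t\<^sup>2 * u\<^sup>2" "x ^ 4 = t ^ 4 * u ^ 4"
    using u(3) by (metis power2_abs power_mult_distrib, metis power_even_abs_numeral even_numeral power_mult_distrib)
  have "u\<^sup>2 \<le> 1 / 16" "u ^ 4 \<le> 1 / 256" "0 \<le> u\<^sup>2"
    using power_mono[OF u(2,1), of 2] power_mono[OF u(2,1), of 4] by (simp_all add: power_divide)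
  then have "1 / 4 + u \<le> 1 + u\<^sup>2 - 4 / 27 * (u ^ 4 + 6 * u\<^sup>2 + 3)"
    using u(2) by argo
  then have "t * (1 / 4 + u) \<le> t * (1 + u\<^sup>2 - 4 / 27 * (u ^ 4 + 6 * u\<^sup>2 + 3))"
    using t by simp
  also have "\<dots> = 3 / (3 * t) * (x\<^sup>2 + real k * d)
    - 4 / (3 * t) ^ 3 * (x ^ 4 + 6 * x\<^sup>2 * (real k * d) + 3 * (real k * d)\<^sup>2)"
    unfolding xx t(2) using t(1) by (simp add: field_simps power2_eq_square power_numeral_reduce)
  also have "\<dots> \<le> G k x"
    using t by (intro G_ge_poly) auto
  finally show ?thesis
    using u(3) by (simp add: H_def t_def algebra_simps)
qed (use x in \<open>simp add: H_def\<close>)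

text \<open>As the mean is zero, \<open>H 1 x\<close> is also the mean of
  \<open>|x + y| - |x| - sgn x * y\<close>. For nonzero \<open>x\<close> this vanishes unless the
  step crosses zero, which forces \<open>|y| \<ge> |x|\<close>, and it is at most
  \<open>2 * |y|\<close>. So \<open>|x|^3\<close> can be traded for \<open>|y|^3\<close>, and the
  fourth moment remains.\<close>

lemma H1_decay: "\<bar>x\<bar> ^ 3 * H 1 x \<le> 6 * d\<^sup>2"
proof -
  have "\<bar>x\<bar> ^ 3 * (\<bar>x + y\<bar> - \<bar>x\<bar> - sgn x * y) \<le> 2 * y ^ 4" for y
  proof (cases "sgn x * (x + y) < 0")
    case True
    then have xy: "\<bar>x\<bar> \<le> \<bar>y\<bar>"
      by (auto simp: sgn_if split: if_splits)
    have "\<bar>x\<bar> ^ 3 * (\<bar>x + y\<bar> - \<bar>x\<bar> - sgn x * y) \<le> \<bar>y\<bar> ^ 3 * (2 * \<bar>y\<bar>)"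
      using xy True by (intro mult_mono power_mono) (auto simp: sgn_if split: if_splits)
    also have "\<dots> = 2 * \<bar>y\<bar> ^ 4"
      by (simp add: power_numeral_reduce)
    finally show ?thesis by simp
  next
    case False
    then have "x = 0 \<or> \<bar>x + y\<bar> - \<bar>x\<bar> - sgn x * y = 0"
      by (auto simp: sgn_if split: if_splits)
    then have "\<bar>x\<bar> ^ 3 * (\<bar>x + y\<bar> - \<bar>x\<bar> - sgn x * y) = 0"
      by (metis mult_zero_left mult_zero_right abs_zero zero_power zero_less_numeral)
    moreover have "0 \<le> 2 * y ^ 4"
      by simp
    ultimately show ?thesis by linarith
  qed
  then have "(\<integral>y. \<bar>x\<bar> ^ 3 * (\<bar>x + y\<bar> - \<bar>x\<bar> - sgn x * y) \<partial>\<gamma>) \<le> (\<integral>y. 2 * y ^ 4 \<partial>\<gamma>)"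
    by (intro integral_mono) auto
  then show ?thesis
    by (simp add: mean_zero fourth_moment H_def)
qed

text \<open>The innovation of \<open>H q\<close> in one step: by \<open>integral_H\<close> the last
  two terms subtract the mean of \<open>H q (s + x)\<close> over \<open>x\<close>.\<close>

definition eps :: "nat \<Rightarrow> real \<Rightarrow> real \<Rightarrow> real" where
  "eps q s x = H q (s + x) - H (Suc q) s + H 1 s"

lemma integral_H: "(\<integral>x. H q (s + x) \<partial>\<gamma>) = H (Suc q) s - H 1 s"
  by (simp add: H_def)

lemma eps_mean: "(\<integral>x. eps q s x \<partial>\<gamma>) = 0"
  unfolding eps_def by (simp add: integral_H)

lemma H_lipschitz: "\<bar>H q (s + x) - H q s\<bar> \<le> 2 * \<bar>x\<bar>"
  using G_lipschitz[of q "s + x" s] by (simp add: H_def)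

lemma eps_bound: "\<bar>eps q s x\<bar> \<le> 2 * \<bar>x\<bar> + 2 * (\<integral>y. \<bar>y\<bar> \<partial>\<gamma>)"
proof -
  have "\<bar>\<integral>y. H q (s + y) - H q s \<partial>\<gamma>\<bar> \<le> (\<integral>y. \<bar>H q (s + y) - H q s\<bar> \<partial>\<gamma>)"
    by (rule integral_abs_bound)
  also have "\<dots> \<le> (\<integral>y. 2 * \<bar>y\<bar> \<partial>\<gamma>)"
    using H_lipschitz by (intro integral_mono integrable_abs) auto
  finally have "\<bar>(H (Suc q) s - H 1 s) - H q s\<bar> \<le> 2 * (\<integral>y. \<bar>y\<bar> \<partial>\<gamma>)"
    by (simp add: integral_H)
  then show ?thesis
    using H_lipschitz[of q s x] by (simp add: eps_def)
qed

lemma integrable_eps_square: "integrable \<gamma> (\<lambda>x. (eps q s x)\<^sup>2)"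
proof (rule Bochner_Integration.integrable_bound[where f = "\<lambda>x. 8 * x\<^sup>2 + 8 * (\<integral>y. \<bar>y\<bar> \<partial>\<gamma>)\<^sup>2"])
  have "(eps q s x)\<^sup>2 \<le> 8 * x\<^sup>2 + 8 * (\<integral>y. \<bar>y\<bar> \<partial>\<gamma>)\<^sup>2" for x
  proof -
    have "(eps q s x)\<^sup>2 \<le> (2 * \<bar>x\<bar> + 2 * (\<integral>y. \<bar>y\<bar> \<partial>\<gamma>))\<^sup>2"
      using eps_bound[of q s x] by (intro abs_le_square_iff[THEN iffD1]) linarith
    also have "\<dots> \<le> 2 * (2 * \<bar>x\<bar>)\<^sup>2 + 2 * (2 * (\<integral>y. \<bar>y\<bar> \<partial>\<gamma>))\<^sup>2"
      using sum_squares_bound[of "2 * \<bar>x\<bar>" "2 * (\<integral>y. \<bar>y\<bar> \<partial>\<gamma>)"] by (simp add: power2_sum)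
    finally show ?thesis by simp
  qed
  then show "AE x in \<gamma>. norm ((eps q s x)\<^sup>2) \<le> norm (8 * x\<^sup>2 + 8 * (\<integral>y. \<bar>y\<bar> \<partial>\<gamma>)\<^sup>2)"
    by (intro AE_I2) simp
  show "(\<lambda>x. (eps q s x)\<^sup>2) \<in> borel_measurable \<gamma>"
    unfolding eps_def by measurable
qed auto

text \<open>The variance is at most the mean square deviation from any constant; the constant
  \<open>H q s\<close> and the Lipschitz bound 2 give \<open>4 * d\<close>, independently of the
  horizon \<open>q\<close>.\<close>

lemma eps_variance: "(\<integral>x. (eps q s x)\<^sup>2 \<partial>\<gamma>) \<le> 4 * d"
proof -
  define c where "c = H q s - H (Suc q) s + H 1 s"
  have ie: "integrable \<gamma> (\<lambda>x. eps q s x)"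
    unfolding eps_def by simp
  have "(\<integral>x. (eps q s x)\<^sup>2 \<partial>\<gamma>) \<le> (\<integral>x. (eps q s x)\<^sup>2 - 2 * c * eps q s x + c\<^sup>2 \<partial>\<gamma>)"
    using integrable_eps_square ie by (simp add: eps_mean)
  also have "\<dots> \<le> (\<integral>x. 4 * x\<^sup>2 \<partial>\<gamma>)"
  proof (intro integral_mono)
    fix x
    have "(H q (s + x) - H q s)\<^sup>2 \<le> (2 * \<bar>x\<bar>)\<^sup>2"
      using H_lipschitz[of q s x] by (intro abs_le_square_iff[THEN iffD1]) simp
    then show "(eps q s x)\<^sup>2 - 2 * c * eps q s x + c\<^sup>2 \<le> 4 * x\<^sup>2"
      by (simp add: eps_def c_def power2_eq_square algebra_simps)
  qed (use integrable_eps_square ie in auto)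
  finally show ?thesis
    by (simp add: second_moment)
qed

end

section \<open>The walk, its filtration and its local time\<close>

locale iid_walk = step_distribution \<gamma> d + M: prob_space M
  for \<gamma> :: "real measure" and d :: real and M :: "'a measure" +
  fixes D :: "nat \<Rightarrow> 'a \<Rightarrow> real"
  assumes indep_D: "M.indep_vars (\<lambda>_. borel) D UNIV"
    and distr_D: "distr M borel (D i) = \<gamma>"
begin

lemma measurable_D [measurable]: "D i \<in> borel_measurable M"
  using indep_D by (auto simp: M.indep_vars_def)

text \<open>Generated by the steps before time \<open>i\<close>: \<open>S i\<close> is known,
  \<open>D i\<close> is independent. Writing it as preimages under the restricted family is what
  fits \<open>indep_var_restrict\<close>.\<close>

definition F :: "nat \<Rightarrow> 'a measure" where
  "F i = vimage_algebra (space M) (\<lambda>\<omega>. \<lambda>j\<in>{..<i}. D j \<omega>) (Pi\<^sub>M {..<i} (\<lambda>_. borel))"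

lemma space_F [simp]: "space (F i) = space M"
  by (simp add: F_def)

lemma sets_F_subset: "sets (F i) \<subseteq> sets M"
  unfolding F_def by (rule sets_image_in_sets) auto

lemma measurable_F_M: "f \<in> measurable (F i) N \<Longrightarrow> f \<in> measurable M N"
  using sets_F_subset[of i] by (auto simp: measurable_def)

lemma measurable_D_F [measurable (raw)]: "j < i \<Longrightarrow> D j \<in> borel_measurable (F i)"
proof -
  assume "j < i"
  then have "(\<lambda>f. f j) \<circ> (\<lambda>\<omega>. \<lambda>j\<in>{..<i}. D j \<omega>) \<in> borel_measurable (F i)"
    unfolding F_def
    by (intro measurable_comp[OF measurable_vimage_algebra1 measurable_component_singleton])
      (auto simp: space_PiM)
  then show ?thesis
    using \<open>j < i\<close> by (simp add: comp_def)
qed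

lemma indep_F:
  assumes A: "A \<in> sets (F i)" and B: "B \<in> sets borel"
  shows "M.prob (A \<inter> (D i -` B \<inter> space M)) = M.prob A * M.prob (D i -` B \<inter> space M)"
proof -
  define W where "W I = (\<lambda>\<omega>. \<lambda>j\<in>I. D j \<omega>)" for I
  have W [measurable]: "W I \<in> measurable M (Pi\<^sub>M I (\<lambda>_. borel))" for I
    unfolding W_def by measurable
  have "M.indep_var (Pi\<^sub>M {..<i} (\<lambda>_. borel)) (W {..<i}) (Pi\<^sub>M {i} (\<lambda>_. borel)) (W {i})"
    unfolding W_def using indep_D by (rule M.indep_var_restrict) auto
  then have ind: "M.indep_set (sets (F i))
      (sigma_sets (space M) {W {i} -` A \<inter> space M | A. A \<in> sets (Pi\<^sub>M {i} (\<lambda>_. borel))})"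
    by (simp add: M.indep_var_eq F_def W_def sets_vimage_algebra)
  have "D i -` B \<inter> space M = W {i} -` ((\<lambda>f. f i) -` B \<inter> space (Pi\<^sub>M {i} (\<lambda>_. borel))) \<inter> space M"
    by (auto simp: W_def space_PiM)
  moreover have "(\<lambda>f. f i) -` B \<inter> space (Pi\<^sub>M {i} (\<lambda>_. borel)) \<in> sets (Pi\<^sub>M {i} (\<lambda>_. borel :: real measure))"
    using B by (intro measurable_sets[OF measurable_component_singleton]) auto
  ultimately have "D i -` B \<inter> space M
      \<in> sigma_sets (space M) {W {i} -` A \<inter> space M | A. A \<in> sets (Pi\<^sub>M {i} (\<lambda>_. borel))}"
    by (intro sigma_sets.Basic) blast
  then show ?thesis
    using ind A by (simp add: M.indep_sets2_eq)
qed

lemma distr_step: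
  assumes X: "X \<in> measurable (F i) N"
  shows "distr M (N \<Otimes>\<^sub>M borel) (\<lambda>\<omega>. (X \<omega>, D i \<omega>)) = distr M N X \<Otimes>\<^sub>M \<gamma>"
proof (rule pair_measure_eqI[symmetric])
  note XM [measurable] = measurable_F_M[OF X]
  interpret X: prob_space "distr M N X"
    using XM by (rule M.prob_space_distr)
  show "sigma_finite_measure (distr M N X)" "sigma_finite_measure \<gamma>"
    by unfold_locales
  show "sets (distr M N X \<Otimes>\<^sub>M \<gamma>) = sets (distr M (N \<Otimes>\<^sub>M borel) (\<lambda>\<omega>. (X \<omega>, D i \<omega>)))"
    by (simp cong: sets_pair_measure_cong)
  fix A B assume "A \<in> sets (distr M N X)" "B \<in> sets \<gamma>"
  then have A [measurable]: "A \<in> sets N" and B [measurable]: "B \<in> sets borel"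
    by auto
  have "X -` A \<inter> space M \<in> sets (F i)"
    using measurable_sets[OF X A] by simp
  from indep_F[OF this B]
  have "M.prob ((X -` A \<inter> space M) \<inter> (D i -` B \<inter> space M))
      = M.prob (X -` A \<inter> space M) * M.prob (D i -` B \<inter> space M)" .
  moreover have "(\<lambda>\<omega>. (X \<omega>, D i \<omega>)) -` (A \<times> B) \<inter> space M = (X -` A \<inter> space M) \<inter> (D i -` B \<inter> space M)"
    by auto
  moreover have "emeasure \<gamma> B = emeasure M (D i -` B \<inter> space M)"
    using B by (subst distr_D[of i, symmetric]) (simp add: emeasure_distr)
  ultimately show "emeasure (distr M N X) A * emeasure \<gamma> B
      = emeasure (distr M (N \<Otimes>\<^sub>M borel) (\<lambda>\<omega>. (X \<omega>, D i \<omega>))) (A \<times> B)"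
    by (simp add: emeasure_distr M.emeasure_eq_measure ennreal_mult)
qed

text \<open>Conditioning on the past in Fubini form: whatever is known at time \<open>i\<close> is
  frozen, and the next step is integrated against \<open>\<gamma>\<close>.\<close>

lemma integral_step:
  fixes g :: "'b \<times> real \<Rightarrow> real"
  assumes X: "X \<in> measurable (F i) N" and g: "g \<in> borel_measurable (N \<Otimes>\<^sub>M borel)"
    and int: "integrable M (\<lambda>\<omega>. g (X \<omega>, D i \<omega>))"
  shows "(\<integral>\<omega>. g (X \<omega>, D i \<omega>) \<partial>M) = (\<integral>\<omega>. (\<integral>x. g (X \<omega>, x) \<partial>\<gamma>) \<partial>M)"
    and "integrable M (\<lambda>\<omega>. \<integral>x. g (X \<omega>, x) \<partial>\<gamma>)"
proof -
  note XM [measurable] = measurable_F_M[OF X]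
  have g' [measurable]: "g \<in> borel_measurable (N \<Otimes>\<^sub>M \<gamma>)"
    using g by (simp cong: measurable_cong_sets sets_pair_measure_cong)
  interpret X: prob_space "distr M N X"
    using XM by (rule M.prob_space_distr)
  interpret P: pair_sigma_finite "distr M N X" \<gamma> ..
  note eq = distr_step[OF X]
  have int': "integrable (distr M N X \<Otimes>\<^sub>M \<gamma>) g"
    unfolding eq[symmetric] using int g by (subst integrable_distr_eq) auto
  have "(\<integral>\<omega>. g (X \<omega>, D i \<omega>) \<partial>M) = integral\<^sup>L (distr M N X \<Otimes>\<^sub>M \<gamma>) g"
    unfolding eq[symmetric] using g by (subst integral_distr) auto
  also have "\<dots> = (\<integral>x. (\<integral>y. g (x, y) \<partial>\<gamma>) \<partial>distr M N X)"
    using P.integral_fst'[OF int'] by simp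
  also have "\<dots> = (\<integral>\<omega>. (\<integral>x. g (X \<omega>, x) \<partial>\<gamma>) \<partial>M)"
    by (subst integral_distr) auto
  finally show "(\<integral>\<omega>. g (X \<omega>, D i \<omega>) \<partial>M) = (\<integral>\<omega>. (\<integral>x. g (X \<omega>, x) \<partial>\<gamma>) \<partial>M)" .
  show "integrable M (\<lambda>\<omega>. \<integral>x. g (X \<omega>, x) \<partial>\<gamma>)"
    using P.integrable_fst'[OF int'] by (subst (asm) integrable_distr_eq) auto
qed

definition S :: "nat \<Rightarrow> 'a \<Rightarrow> real" where
  "S i \<omega> = (\<Sum>j<i. D j \<omega>)"

definition V :: "nat \<Rightarrow> 'a \<Rightarrow> real" where
  "V i \<omega> = (\<Sum>j<i. H 1 (S j \<omega>))"

lemma S_0 [simp]: "S 0 \<omega> = 0" and S_Suc: "S (Suc i) \<omega> = S i \<omega> + D i \<omega>"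
  by (simp_all add: S_def)

lemma V_0 [simp]: "V 0 \<omega> = 0" and V_Suc: "V (Suc i) \<omega> = V i \<omega> + H 1 (S i \<omega>)"
  by (simp_all add: V_def)

lemma V_nonneg [simp]: "0 \<le> V i \<omega>"
  by (simp add: V_def sum_nonneg)

lemma measurable_S_F: "i \<le> j \<Longrightarrow> S i \<in> borel_measurable (F j)"
  unfolding S_def by (intro borel_measurable_sum measurable_D_F) auto

text \<open>\<open>V\<close> is predictable: \<open>V (Suc j)\<close> involves only
  \<open>S 0\<close> to \<open>S j\<close>, so it can be frozen together with
  \<open>S j\<close>.\<close>

lemma measurable_V_F: "i \<le> Suc j \<Longrightarrow> V i \<in> borel_measurable (F j)"
  unfolding V_def by (intro borel_measurable_sum measurable_compose[OF measurable_S_F measurable_H]) auto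

lemma measurable_S [measurable]: "S i \<in> borel_measurable M"
  unfolding S_def by measurable

lemma measurable_V [measurable]: "V i \<in> borel_measurable M"
  unfolding V_def by measurable

lemma integrable_D: "integrable \<gamma> f \<Longrightarrow> integrable M (\<lambda>\<omega>. f (D i \<omega>))"
  for f :: "real \<Rightarrow> real"
  using integrable_distr[OF measurable_D[of i], of f] by (simp add: distr_D)

lemma integrable_S [simp]: "integrable M (S i)"
  unfolding S_def using integrable_D[of "\<lambda>x. x"] by (intro Bochner_Integration.integrable_sum) simp

lemma integrable_G_S [simp]: "integrable M (\<lambda>\<omega>. G k (S i \<omega>))"
proof (rule Bochner_Integration.integrable_bound[where f = "\<lambda>\<omega>. \<bar>S i \<omega>\<bar> + \<bar>G k 0\<bar>"])
  show "AE \<omega> in M. norm (G k (S i \<omega>)) \<le> norm (\<bar>S i \<omega>\<bar> + \<bar>G k 0\<bar>)"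
  proof (intro AE_I2)
    fix \<omega>
    show "norm (G k (S i \<omega>)) \<le> norm (\<bar>S i \<omega>\<bar> + \<bar>G k 0\<bar>)"
      using G_lipschitz[of k "S i \<omega>" 0] by simp
  qed
qed auto

text \<open>The Markov property. General \<open>k\<close> lets the induction move one step from the
  walk into \<open>G\<close>.\<close>

lemma expectation_G_S: "(\<integral>\<omega>. G k (S n \<omega>) \<partial>M) = G (n + k) 0"
proof (induction n arbitrary: k)
  case (Suc n)
  have "(\<integral>\<omega>. G k (S n \<omega> + D n \<omega>) \<partial>M) = (\<integral>\<omega>. (\<integral>x. G k (S n \<omega> + x) \<partial>\<gamma>) \<partial>M)"
    using integral_step(1)[OF measurable_S_F[of n n], of "\<lambda>p. G k (fst p + snd p)"]
      integrable_G_S[of k "Suc n"] by (simp add: S_Suc)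
  then show ?case
    using Suc[of "Suc k"] by (simp add: S_Suc)
qed (simp add: M.prob_space)

lemma expectation_abs_S: "(\<integral>\<omega>. \<bar>S n \<omega>\<bar> \<partial>M) \<le> sqrt (real n * d)"
  using expectation_G_S[of 0 n] G_le[of n 0] by simp

lemma integrable_H_S [simp]: "integrable M (\<lambda>\<omega>. H k (S i \<omega>))"
  using integrable_G_S[of k i] by (simp add: H_def)

lemma integrable_V [simp]: "integrable M (V n)"
  unfolding V_def by simp

lemma expectation_V: "(\<integral>\<omega>. V n \<omega> \<partial>M) = (\<integral>\<omega>. \<bar>S n \<omega>\<bar> \<partial>M)"
proof (induction n)
  case (Suc n)
  have "(\<integral>\<omega>. H 1 (S n \<omega>) \<partial>M) = (\<integral>\<omega>. \<bar>S (Suc n) \<omega>\<bar> \<partial>M) - (\<integral>\<omega>. \<bar>S n \<omega>\<bar> \<partial>M)"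
    using expectation_G_S[of 1 n] expectation_G_S[of 0 "Suc n"] integrable_G_S[of 1 n]
    unfolding H_def by simp
  then show ?case
    using Suc by (simp add: V_Suc)
qed simp

lemma expectation_V_le: "(\<integral>\<omega>. V n \<omega> \<partial>M) \<le> sqrt (real n * d)"
  using expectation_V expectation_abs_S by simp

section \<open>Martingale transforms of the innovations\<close>

definition eps_sum :: "(nat \<Rightarrow> 'a \<Rightarrow> real) \<Rightarrow> (nat \<Rightarrow> nat) \<Rightarrow> nat \<Rightarrow> 'a \<Rightarrow> real" where
  "eps_sum a q n \<omega> = (\<Sum>i<n. a i \<omega> * eps (q i) (S i \<omega>) (D i \<omega>))"

text \<open>Orthogonality of martingale differences: the cross term vanishes because the earlier sum
  and \<open>a n\<close> are known before the centred step, and each square contributes at most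
  \<open>4 * d\<close> times the mean of \<open>(a n)^2\<close>. The bound \<open>C\<close> secures
  integrability.\<close>

lemma eps_sum_square:
  assumes a: "\<And>i. i < n \<Longrightarrow> a i \<in> borel_measurable (F i)"
    and bound: "\<And>i \<omega>. i < n \<Longrightarrow> \<bar>a i \<omega>\<bar> \<le> C"
  shows "integrable M (\<lambda>\<omega>. (eps_sum a q n \<omega>)\<^sup>2)"
    and "(\<integral>\<omega>. (eps_sum a q n \<omega>)\<^sup>2 \<partial>M) \<le> 4 * d * (\<Sum>i<n. \<integral>\<omega>. (a i \<omega>)\<^sup>2 \<partial>M)"
proof -
  \<comment> \<open>Measurability in \<open>F n\<close> is carried through the induction since the
    cross term freezes the partial sum.\<close>
  have "integrable M (\<lambda>\<omega>. (eps_sum a q n \<omega>)\<^sup>2) \<and> eps_sum a q n \<in> borel_measurable (F n) \<and>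
    (\<integral>\<omega>. (eps_sum a q n \<omega>)\<^sup>2 \<partial>M) \<le> 4 * d * (\<Sum>i<n. \<integral>\<omega>. (a i \<omega>)\<^sup>2 \<partial>M)"
    using assms
  proof (induction n)
    case 0
    have "eps_sum a q 0 = (\<lambda>_. 0)"
      by (simp add: eps_sum_def fun_eq_iff)
    then show ?case by simp
  next
    case (Suc n)
    define T where "T = eps_sum a q n"
    define e where "e \<omega> = eps (q n) (S n \<omega>) (D n \<omega>)" for \<omega>
    have IH: "integrable M (\<lambda>\<omega>. (T \<omega>)\<^sup>2)" "T \<in> borel_measurable (F n)"
      "(\<integral>\<omega>. (T \<omega>)\<^sup>2 \<partial>M) \<le> 4 * d * (\<Sum>i<n. \<integral>\<omega>. (a i \<omega>)\<^sup>2 \<partial>M)"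
      using Suc.IH Suc.prems by (auto simp: T_def)
    have an: "a n \<in> borel_measurable (F n)"
      using Suc.prems by auto
    note Sn = measurable_S_F[of n n, OF order_refl]
    note [measurable] = measurable_F_M[OF an] measurable_F_M[OF IH(2)]
    have C: "C \<ge> 0"
      using Suc.prems(2)[of n undefined] abs_ge_zero order_trans by blast
    have e_meas [measurable]: "e \<in> borel_measurable M"
      unfolding e_def eps_def by measurable
    have step: "eps_sum a q (Suc n) \<omega> = T \<omega> + a n \<omega> * e \<omega>" for \<omega>
      by (simp add: eps_sum_def T_def e_def)
    define c where "c = (\<integral>y. \<bar>y\<bar> \<partial>\<gamma>)"
    have int_ae2: "integrable M (\<lambda>\<omega>. (a n \<omega> * e \<omega>)\<^sup>2)"
    proof (rule Bochner_Integration.integrable_bound[where f = "\<lambda>\<omega>. C\<^sup>2 * (8 * (D n \<omega>)\<^sup>2 + 8 * c\<^sup>2)"])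
      show "integrable M (\<lambda>\<omega>. C\<^sup>2 * (8 * (D n \<omega>)\<^sup>2 + 8 * c\<^sup>2))"
        using integrable_D[of "\<lambda>x. x\<^sup>2" n] by auto
      have "(a n \<omega> * e \<omega>)\<^sup>2 \<le> C\<^sup>2 * (8 * (D n \<omega>)\<^sup>2 + 8 * c\<^sup>2)" for \<omega>
      proof -
        have "(e \<omega>)\<^sup>2 \<le> (2 * \<bar>D n \<omega>\<bar> + 2 * c)\<^sup>2"
          using eps_bound[of "q n" "S n \<omega>" "D n \<omega>"]
          by (intro abs_le_square_iff[THEN iffD1]) (simp add: e_def c_def)
        also have "\<dots> \<le> 8 * (D n \<omega>)\<^sup>2 + 8 * c\<^sup>2"
          using sum_squares_bound[of "2 * \<bar>D n \<omega>\<bar>" "2 * c"] by (simp add: power2_sum)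
        finally have "(e \<omega>)\<^sup>2 \<le> 8 * (D n \<omega>)\<^sup>2 + 8 * c\<^sup>2" .
        moreover have "(a n \<omega>)\<^sup>2 \<le> C\<^sup>2"
          using Suc.prems(2)[of n \<omega>] C by (intro abs_le_square_iff[THEN iffD1]) simp
        ultimately show ?thesis
          unfolding power_mult_distrib by (intro mult_mono) auto
      qed
      then show "AE \<omega> in M. norm ((a n \<omega> * e \<omega>)\<^sup>2) \<le> norm (C\<^sup>2 * (8 * (D n \<omega>)\<^sup>2 + 8 * c\<^sup>2))"
        by (intro AE_I2) (simp add: power_mult_distrib)
    qed measurable
    have int_cross: "integrable M (\<lambda>\<omega>. T \<omega> * a n \<omega> * e \<omega>)"
    proof (rule Bochner_Integration.integrable_bound[where f = "\<lambda>\<omega>. (T \<omega>)\<^sup>2 + (a n \<omega> * e \<omega>)\<^sup>2"])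
      have "\<bar>x * y\<bar> \<le> x\<^sup>2 + y\<^sup>2" for x y :: real
      proof -
        have "2 * (\<bar>x\<bar> * \<bar>y\<bar>) \<le> x\<^sup>2 + y\<^sup>2"
          using sum_squares_bound[of "\<bar>x\<bar>" "\<bar>y\<bar>"] by (simp add: mult.assoc)
        moreover have "0 \<le> \<bar>x\<bar> * \<bar>y\<bar>"
          by simp
        ultimately show ?thesis
          unfolding abs_mult by linarith
      qed
      from this[of "T \<omega>" "a n \<omega> * e \<omega>" for \<omega>]
      show "AE \<omega> in M. norm (T \<omega> * a n \<omega> * e \<omega>) \<le> norm ((T \<omega>)\<^sup>2 + (a n \<omega> * e \<omega>)\<^sup>2)"
        by (intro AE_I2) (simp add: mult.assoc)
    qed (use IH int_ae2 in auto)
    have cross: "(\<integral>\<omega>. T \<omega> * a n \<omega> * e \<omega> \<partial>M) = 0"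
    proof -
      have "(\<lambda>\<omega>. (T \<omega> * a n \<omega>, S n \<omega>)) \<in> measurable (F n) (borel \<Otimes>\<^sub>M borel)"
        using an IH(2) Sn by measurable
      moreover have "(\<lambda>p. fst (fst p) * eps (q n) (snd (fst p)) (snd p))
          \<in> borel_measurable ((borel \<Otimes>\<^sub>M borel) \<Otimes>\<^sub>M borel)"
        unfolding eps_def by measurable
      ultimately show ?thesis
        using integral_step(1)[of _ n "borel \<Otimes>\<^sub>M borel"
          "\<lambda>p. fst (fst p) * eps (q n) (snd (fst p)) (snd p)"] int_cross
        by (fastforce simp: e_def eps_mean)
    qed
    have sq: "(\<integral>\<omega>. (a n \<omega> * e \<omega>)\<^sup>2 \<partial>M) \<le> 4 * d * (\<integral>\<omega>. (a n \<omega>)\<^sup>2 \<partial>M)"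
    proof -
      have Xm: "(\<lambda>\<omega>. (a n \<omega>, S n \<omega>)) \<in> measurable (F n) (borel \<Otimes>\<^sub>M borel)"
        using an Sn by measurable
      have gm: "(\<lambda>p. (fst (fst p) * eps (q n) (snd (fst p)) (snd p))\<^sup>2)
          \<in> borel_measurable ((borel \<Otimes>\<^sub>M borel) \<Otimes>\<^sub>M borel)"
        unfolding eps_def by measurable
      note st = integral_step[OF Xm gm]
      have "(\<integral>\<omega>. (a n \<omega> * e \<omega>)\<^sup>2 \<partial>M) = (\<integral>\<omega>. (\<integral>x. (a n \<omega> * eps (q n) (S n \<omega>) x)\<^sup>2 \<partial>\<gamma>) \<partial>M)"
        using st(1) int_ae2 by (simp add: e_def)
      also have "\<dots> \<le> (\<integral>\<omega>. 4 * d * (a n \<omega>)\<^sup>2 \<partial>M)"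
      proof (intro integral_mono)
        show "integrable M (\<lambda>\<omega>. \<integral>x. (a n \<omega> * eps (q n) (S n \<omega>) x)\<^sup>2 \<partial>\<gamma>)"
          using st(2) int_ae2 by (simp add: e_def)
        show "integrable M (\<lambda>\<omega>. 4 * d * (a n \<omega>)\<^sup>2)"
        proof (rule Bochner_Integration.integrable_bound[where f = "\<lambda>\<omega>. 4 * d * C\<^sup>2"])
          show "AE \<omega> in M. norm (4 * d * (a n \<omega>)\<^sup>2) \<le> norm (4 * d * C\<^sup>2)"
            using Suc.prems(2)[of n] C d_pos
            by (intro AE_I2) (auto simp: abs_mult intro!: mult_left_mono abs_le_square_iff[THEN iffD1])
        qed auto
        show "(\<integral>x. (a n \<omega> * eps (q n) (S n \<omega>) x)\<^sup>2 \<partial>\<gamma>) \<le> 4 * d * (a n \<omega>)\<^sup>2" for \<omega>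
          using mult_left_mono[OF eps_variance[of "q n" "S n \<omega>"], of "(a n \<omega>)\<^sup>2"]
          by (simp add: power_mult_distrib mult.commute)
      qed
      finally show ?thesis by simp
    qed
    have expand: "(eps_sum a q (Suc n) \<omega>)\<^sup>2
        = (T \<omega>)\<^sup>2 + 2 * (T \<omega> * a n \<omega> * e \<omega>) + (a n \<omega> * e \<omega>)\<^sup>2" for \<omega>
      by (simp add: step power2_eq_square algebra_simps)
    have "integrable M (\<lambda>\<omega>. (eps_sum a q (Suc n) \<omega>)\<^sup>2)"
      unfolding expand using IH(1) int_cross int_ae2 by auto
    moreover have "(\<integral>\<omega>. (eps_sum a q (Suc n) \<omega>)\<^sup>2 \<partial>M) \<le> 4 * d * (\<Sum>i<Suc n. \<integral>\<omega>. (a i \<omega>)\<^sup>2 \<partial>M)"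
    proof -
      have "(\<integral>\<omega>. (eps_sum a q (Suc n) \<omega>)\<^sup>2 \<partial>M)
          = (\<integral>\<omega>. (T \<omega>)\<^sup>2 \<partial>M) + 2 * (\<integral>\<omega>. T \<omega> * a n \<omega> * e \<omega> \<partial>M) + (\<integral>\<omega>. (a n \<omega> * e \<omega>)\<^sup>2 \<partial>M)"
        unfolding expand using IH(1) int_cross int_ae2 by simp
      then show ?thesis
        using IH(3) cross sq by (simp add: distrib_left)
    qed
    moreover have "eps_sum a q (Suc n) \<in> borel_measurable (F (Suc n))"
    proof -
      have "a i \<in> borel_measurable (F (Suc n))" if "i \<le> n" for i
      proof -
        have "sets (F i) \<subseteq> sets (F (Suc n))"
          unfolding F_def[of i]
          by (rule sets_image_in_sets) (use that in \<open>auto intro!: measurable_restrict measurable_D_F\<close>)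
        then show ?thesis
          using Suc.prems(1)[of i] that by (auto simp: measurable_def)
      qed
      moreover have "S i \<in> borel_measurable (F (Suc n))" "D i \<in> borel_measurable (F (Suc n))" if "i \<le> n" for i
        using that by (auto intro: measurable_S_F measurable_D_F)
      ultimately show ?thesis
        unfolding eps_sum_def[abs_def] eps_def
        by (intro borel_measurable_sum borel_measurable_times borel_measurable_add borel_measurable_diff
            measurable_compose[OF _ measurable_H]) auto
    qed
    ultimately show ?case by blast
  qed
  then show "integrable M (\<lambda>\<omega>. (eps_sum a q n \<omega>)\<^sup>2)"
    "(\<integral>\<omega>. (eps_sum a q n \<omega>)\<^sup>2 \<partial>M) \<le> 4 * d * (\<Sum>i<n. \<integral>\<omega>. (a i \<omega>)\<^sup>2 \<partial>M)"
    by blast+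
qed

text \<open>For continuous local martingales \<open>|B| / sqrt L - 2 sqrt L\<close> would be a local martingale, because
  the local time \<open>L\<close> compensates \<open>|B|\<close> and only grows when \<open>B = 0\<close>. Here it is a
  supermartingale, which prevents \<open>V\<close> from being small when \<open>S\<close> is not.\<close>

lemma expectation_abs_S_over_sqrt_V:
  assumes "e > 0"
  shows "integrable M (\<lambda>\<omega>. \<bar>S n \<omega>\<bar> / sqrt (V n \<omega> + e))"
    and "(\<integral>\<omega>. \<bar>S n \<omega>\<bar> / sqrt (V n \<omega> + e) \<partial>M) \<le> 2 * (1 + e + (\<integral>\<omega>. V n \<omega> \<partial>M))"
proof -
  have sq: "sqrt (V n \<omega> + e) > 0" for n \<omega>
    using assms by (simp add: add_nonneg_pos)
  have sq_le: "1 / sqrt (V n \<omega> + e) \<le> 1 / sqrt e" for n \<omega>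
    using assms by (simp add: frac_le)
  have int1: "integrable M (\<lambda>\<omega>. \<bar>S j \<omega>\<bar> / sqrt (V n \<omega> + e))" for n j
  proof (rule Bochner_Integration.integrable_bound[where f = "\<lambda>\<omega>. \<bar>S j \<omega>\<bar> * (1 / sqrt e)"])
    show "AE \<omega> in M. norm (\<bar>S j \<omega>\<bar> / sqrt (V n \<omega> + e)) \<le> norm (\<bar>S j \<omega>\<bar> * (1 / sqrt e))"
      using mult_left_mono[OF sq_le, of "\<bar>S j \<omega>\<bar>" for \<omega>] assms
      by (intro AE_I2) (simp add: abs_mult)
  qed auto
  have sqrt_le: "sqrt x \<le> 1 + x" if "x \<ge> 0" for x
    using that by (intro real_le_lsqrt) (simp_all add: power2_sum)
  have int2: "integrable M (\<lambda>\<omega>. sqrt (V n \<omega> + e))" for n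
  proof (rule Bochner_Integration.integrable_bound[where f = "\<lambda>\<omega>. 1 + (V n \<omega> + e)"])
    show "AE \<omega> in M. norm (sqrt (V n \<omega> + e)) \<le> norm (1 + (V n \<omega> + e))"
      using sqrt_le[of "V n \<omega> + e" for \<omega>] assms by (intro AE_I2) simp
  qed auto
  have int3: "integrable M (\<lambda>\<omega>. H 1 (S n \<omega>) / sqrt (V (Suc n) \<omega> + e))" for n
  proof (rule Bochner_Integration.integrable_bound[where f = "\<lambda>\<omega>. H 1 (S n \<omega>) * (1 / sqrt e)"])
    show "AE \<omega> in M. norm (H 1 (S n \<omega>) / sqrt (V (Suc n) \<omega> + e)) \<le> norm (H 1 (S n \<omega>) * (1 / sqrt e))"
      using mult_left_mono[OF sq_le, of "H 1 (S n \<omega>)" for \<omega>] assms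
      by (intro AE_I2) (simp add: abs_mult)
  qed auto
  have main: "(\<integral>\<omega>. \<bar>S n \<omega>\<bar> / sqrt (V n \<omega> + e) - 2 * sqrt (V n \<omega> + e) \<partial>M) \<le> 0" for n
  proof (induction n)
    case (Suc n)
    have "(\<integral>\<omega>. \<bar>S (Suc n) \<omega>\<bar> / sqrt (V (Suc n) \<omega> + e) \<partial>M)
        = (\<integral>\<omega>. (\<integral>x. \<bar>S n \<omega> + x\<bar> / sqrt (V (Suc n) \<omega> + e) \<partial>\<gamma>) \<partial>M)"
      using integral_step(1)[OF measurable_Pair[OF measurable_S_F[of n n] measurable_V_F[of "Suc n" n]],
          of "\<lambda>p. \<bar>fst (fst p) + snd p\<bar> / sqrt (snd (fst p) + e)"] int1[of "Suc n" "Suc n"]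
      by (simp add: S_Suc)
    also have "\<dots> = (\<integral>\<omega>. \<bar>S n \<omega>\<bar> / sqrt (V (Suc n) \<omega> + e) + H 1 (S n \<omega>) / sqrt (V (Suc n) \<omega> + e) \<partial>M)"
      by (simp add: H_def add_divide_distrib[symmetric])
    finally have "(\<integral>\<omega>. \<bar>S (Suc n) \<omega>\<bar> / sqrt (V (Suc n) \<omega> + e) - 2 * sqrt (V (Suc n) \<omega> + e) \<partial>M)
       = (\<integral>\<omega>. \<bar>S n \<omega>\<bar> / sqrt (V (Suc n) \<omega> + e) + H 1 (S n \<omega>) / sqrt (V (Suc n) \<omega> + e)
            - 2 * sqrt (V (Suc n) \<omega> + e) \<partial>M)"
      using int1 int2 int3 by simp
    also have "\<dots> \<le> (\<integral>\<omega>. \<bar>S n \<omega>\<bar> / sqrt (V n \<omega> + e) - 2 * sqrt (V n \<omega> + e) \<partial>M)"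
    proof (intro integral_mono Bochner_Integration.integrable_add Bochner_Integration.integrable_diff
        integrable_mult_right int1 int2 int3)
      fix \<omega>
      define x where "x = sqrt (V n \<omega> + e)"
      define y where "y = sqrt (V (Suc n) \<omega> + e)"
      have xy: "0 < x" "x \<le> y" "H 1 (S n \<omega>) = y\<^sup>2 - x\<^sup>2"
        using sq assms by (auto simp: x_def y_def V_Suc add_nonneg_nonneg)
      \<comment> \<open>The discrete replacement for Ito's formula:
        \<open>(y^2 - x^2) / y \<le> 2 * (y - x)\<close>, so the drift of the first term is paid by
        the second.\<close>
      then have "0 \<le> (y - x)\<^sup>2 / y"
        by simp
      then have "H 1 (S n \<omega>) / y \<le> 2 * y - 2 * x"
        using xy by (simp add: field_simps power2_eq_square)
      moreover have "\<bar>S n \<omega>\<bar> / y \<le> \<bar>S n \<omega>\<bar> / x"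
        using xy by (intro divide_left_mono) auto
      ultimately show "\<bar>S n \<omega>\<bar> / sqrt (V (Suc n) \<omega> + e) + H 1 (S n \<omega>) / sqrt (V (Suc n) \<omega> + e)
          - 2 * sqrt (V (Suc n) \<omega> + e) \<le> \<bar>S n \<omega>\<bar> / sqrt (V n \<omega> + e) - 2 * sqrt (V n \<omega> + e)"
        unfolding x_def y_def by linarith
    qed
    finally show ?case
      using Suc by simp
  qed (use assms in simp)
  show "integrable M (\<lambda>\<omega>. \<bar>S n \<omega>\<bar> / sqrt (V n \<omega> + e))"
    by (rule int1)
  have "(\<integral>\<omega>. \<bar>S n \<omega>\<bar> / sqrt (V n \<omega> + e) \<partial>M) \<le> (\<integral>\<omega>. 2 * sqrt (V n \<omega> + e) \<partial>M)"
    using main[of n] int1 int2 by simp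
  also have "\<dots> \<le> (\<integral>\<omega>. 2 * (1 + (V n \<omega> + e)) \<partial>M)"
  proof (intro integral_mono)
    show "2 * sqrt (V n \<omega> + e) \<le> 2 * (1 + (V n \<omega> + e))" for \<omega>
      using sqrt_le[of "V n \<omega> + e"] assms by simp
  qed (use int2 in auto)
  also have "\<dots> = 2 * (1 + e + (\<integral>\<omega>. V n \<omega> \<partial>M))"
    by (simp add: M.prob_space)
  finally show "(\<integral>\<omega>. \<bar>S n \<omega>\<bar> / sqrt (V n \<omega> + e) \<partial>M) \<le> 2 * (1 + e + (\<integral>\<omega>. V n \<omega> \<partial>M))" .
qed

text \<open>With the horizon counted down along the walk, expected future local time drops by the
  local time just collected, up to an innovation. Both block estimates sum this identity.\<close>

lemma H_S_Suc: "H (Suc q) (S i \<omega>) - H q (S (Suc i) \<omega>) = H 1 (S i \<omega>) - eps q (S i \<omega>) (D i \<omega>)"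
  by (simp add: eps_def S_Suc)

lemma V_mono: "m \<le> n \<Longrightarrow> V m \<omega> \<le> V n \<omega>"
  unfolding V_def by (intro sum_mono2) auto

section \<open>Counting the blocks that come near zero\<close>

definition near_zero :: "nat \<Rightarrow> nat \<Rightarrow> nat \<Rightarrow> 'a \<Rightarrow> bool" where
  "near_zero l k j \<omega> \<longleftrightarrow> (\<exists>i\<in>{k * l..<k * l + l} \<inter> {..j}. \<bar>S i \<omega>\<bar> \<le> sqrt (real l * d) / 4)"

definition hits :: "nat \<Rightarrow> nat \<Rightarrow> 'a \<Rightarrow> real" where
  "hits l K \<omega> = (\<Sum>k<K. of_bool (near_zero l k (k * l + l) \<omega>))"

lemma near_zero_imp: "near_zero l k j \<omega> \<Longrightarrow> near_zero l k (k * l + l) \<omega>"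
  by (auto simp: near_zero_def)

text \<open>The cut at \<open>j\<close> in \<open>near_zero\<close> is made for this: the flag is
  known at time \<open>j\<close>, and it stays up once raised. Its threshold is that of
  \<open>H_ge\<close> for \<open>l\<close> steps.\<close>

lemma measurable_near_zero: "j \<le> i \<Longrightarrow> (\<lambda>\<omega>. of_bool (near_zero l k j \<omega>) :: real) \<in> borel_measurable (F i)"
proof -
  assume "j \<le> i"
  then have "S m \<in> borel_measurable (F i)" if "m \<in> {k * l..<k * l + l} \<inter> {..j}" for m
    using that by (intro measurable_S_F) auto
  then have "Measurable.pred (F i) (near_zero l k j)"
    unfolding near_zero_def[abs_def] by (intro pred_intros_finite) auto
  then show ?thesis
    unfolding of_bool_def by measurable
qed

text \<open>The first approach happens within the first \<open>l\<close> of the \<open>2 * l\<close>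
  steps of the window, so at least \<open>l\<close> steps remain and \<open>H_ge\<close> bounds the
  expected local time below. At the end of the window it is \<open>H 0 = 0\<close>, and in between
  the identity \<open>H_S_Suc\<close> telescopes.\<close>

lemma hits_le_block:
  assumes l: "l > 0"
  shows "sqrt (real l * d) / 4 * of_bool (near_zero l k (k * l + l) \<omega>)
    \<le> (\<Sum>j<2 * l. of_bool (near_zero l k (k * l + j) \<omega>)
          * (H 1 (S (k * l + j) \<omega>) - eps (2 * l - Suc j) (S (k * l + j) \<omega>) (D (k * l + j) \<omega>)))"
proof -
  define P where "P j \<longleftrightarrow> near_zero l k (k * l + j) \<omega>" for j
  define U where "U j = H (2 * l - j) (S (k * l + j) \<omega>)" for j
  have U: "U j - U (Suc j)
      = H 1 (S (k * l + j) \<omega>) - eps (2 * l - Suc j) (S (k * l + j) \<omega>) (D (k * l + j) \<omega>)" if "j < 2 * l" for j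
    using H_S_Suc[of "2 * l - Suc j" "k * l + j" \<omega>] that by (simp add: U_def Suc_diff_Suc)
  have "sqrt (real l * d) / 4 * of_bool (P l) \<le> (\<Sum>j<2 * l. of_bool (P j) * (U j - U (Suc j)))"
  proof (cases "P l")
    case False
    then have "\<not> P j" for j
      using near_zero_imp by (auto simp: P_def)
    then show ?thesis by simp
  next
    case True
    then obtain i0 where i0: "i0 < l" "\<bar>S (k * l + i0) \<omega>\<bar> \<le> sqrt (real l * d) / 4"
      unfolding P_def near_zero_def
      by (metis Int_iff add_less_cancel_left atLeastLessThan_iff le_Suc_ex)
    have "P i0"
      using i0 by (auto simp: P_def near_zero_def)
    moreover have "i0 < 2 * l"
      using i0 by simp
    moreover have "P j" if "i \<le> j" "P i" for i j
      using that by (auto simp: P_def near_zero_def)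
    ultimately have "\<exists>i\<le>i0. P i \<and> (\<forall>j<i. \<not> P j) \<and>
      (\<Sum>j<2 * l. of_bool (P j) * (U j - U (Suc j))) = U i - U (2 * l)"
      by (rule telescope_from_first)
    then obtain i where i: "i \<le> i0" "P i" "\<And>j. j < i \<Longrightarrow> \<not> P j"
      "(\<Sum>j<2 * l. of_bool (P j) * (U j - U (Suc j))) = U i - U (2 * l)"
      by blast
    obtain j where j: "j \<le> i" "j < l" "\<bar>S (k * l + j) \<omega>\<bar> \<le> sqrt (real l * d) / 4"
      using i(2) unfolding P_def near_zero_def
      by (metis Int_iff add_less_cancel_left add_le_cancel_left atLeastLessThan_iff atMost_iff le_Suc_ex)
    have "P j"
      using j by (auto simp: P_def near_zero_def)
    then have "j = i"
      using i(3) j(1) by (meson le_neq_implies_less)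
    have "sqrt (real l * d) / 4 \<le> H l (S (k * l + i) \<omega>)"
      using j \<open>j = i\<close> by (intro H_ge) simp
    also have "\<dots> \<le> U i"
      unfolding U_def using j \<open>j = i\<close> by (intro H_mono) simp
    finally show ?thesis
      using i(4) True by (simp add: U_def)
  qed
  also have "\<dots> = (\<Sum>j<2 * l. of_bool (P j)
      * (H 1 (S (k * l + j) \<omega>) - eps (2 * l - Suc j) (S (k * l + j) \<omega>) (D (k * l + j) \<omega>)))"
    using U by simp
  finally show ?thesis
    by (simp add: P_def)
qed

lemma abs_le_square_div:
  fixes x c :: real
  assumes "c > 0"
  shows "\<bar>x\<bar> \<le> x\<^sup>2 / (2 * c) + c / 2"
proof -
  have "0 \<le> (\<bar>x\<bar> - c)\<^sup>2 / (2 * c)"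
    using assms by simp
  then show ?thesis
    using assms by (simp add: power2_diff field_simps power2_eq_square)
qed

text \<open>The weight \<open>c\<close> is free, so that a circular estimate can absorb the
  resulting second moment into its left-hand side.\<close>

lemma expectation_abs_le:
  fixes Q :: "'a \<Rightarrow> real"
  assumes Q [measurable]: "Q \<in> borel_measurable M" and int: "integrable M (\<lambda>\<omega>. (Q \<omega>)\<^sup>2)" and c: "c > 0"
  shows "integrable M (\<lambda>\<omega>. \<bar>Q \<omega>\<bar>)"
    and "(\<integral>\<omega>. \<bar>Q \<omega>\<bar> \<partial>M) \<le> (\<integral>\<omega>. (Q \<omega>)\<^sup>2 \<partial>M) / (2 * c) + c / 2"
proof -
  show i: "integrable M (\<lambda>\<omega>. \<bar>Q \<omega>\<bar>)"
  proof (rule Bochner_Integration.integrable_bound[where f = "\<lambda>\<omega>. (Q \<omega>)\<^sup>2 / (2 * c) + c / 2"])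
    show "AE \<omega> in M. norm \<bar>Q \<omega>\<bar> \<le> norm ((Q \<omega>)\<^sup>2 / (2 * c) + c / 2)"
      using abs_le_square_div[OF c] c by (intro AE_I2) (simp add: abs_of_nonneg)
  qed (use int in auto)
  have "(\<integral>\<omega>. \<bar>Q \<omega>\<bar> \<partial>M) \<le> (\<integral>\<omega>. (Q \<omega>)\<^sup>2 / (2 * c) + c / 2 \<partial>M)"
    using abs_le_square_div[OF c] i int by (intro integral_mono) auto
  also have "\<dots> = (\<integral>\<omega>. (Q \<omega>)\<^sup>2 \<partial>M) / (2 * c) + c / 2"
    using int by (simp add: M.prob_space)
  finally show "(\<integral>\<omega>. \<bar>Q \<omega>\<bar> \<partial>M) \<le> (\<integral>\<omega>. (Q \<omega>)\<^sup>2 \<partial>M) / (2 * c) + c / 2" .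
qed

lemma measurable_eps_sum [measurable]:
  assumes "\<And>i. i < n \<Longrightarrow> a i \<in> borel_measurable (F i)"
  shows "eps_sum a q n \<in> borel_measurable M"
  unfolding eps_sum_def[abs_def] eps_def
  using measurable_F_M[OF assms] by measurable

text \<open>A block may be hit at its very end, so local time is collected until the end of the following
  block. Every time thus belongs to the windows of two blocks, which are treated by the flags \<open>a1\<close> and
  \<open>a2\<close>. The second moment of \<open>Q\<close> is bounded by the mean of \<open>hits\<close>, which in turn is bounded by the
  mean of \<open>2 V + \<bar>Q\<bar>\<close>; a suitably weighted AM-GM inequality closes this circle.\<close>

lemma hits_bound:
  assumes l: "l > 0" and h: "h = real l * d"
  obtains Q where "Q \<in> borel_measurable M" "integrable M (\<lambda>\<omega>. (Q \<omega>)\<^sup>2)"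
    "(\<integral>\<omega>. (Q \<omega>)\<^sup>2 \<partial>M) \<le> 128 * sqrt h * (2 * (\<integral>\<omega>. V (K * l + l) \<omega> \<partial>M) + 32 * sqrt h)"
    "\<And>\<omega>. sqrt h / 4 * hits l K \<omega> \<le> 2 * V (K * l + l) \<omega> + \<bar>Q \<omega>\<bar>"
proof -
  have hpos: "h > 0"
    using h l d_pos by simp
  define a1 :: "nat \<Rightarrow> 'a \<Rightarrow> real" where "a1 i \<omega> = of_bool (near_zero l (i div l) i \<omega>)" for i \<omega>
  define a2 :: "nat \<Rightarrow> 'a \<Rightarrow> real" where "a2 i \<omega> = (if i < l then 0 else of_bool (near_zero l (i div l - 1) i \<omega>))" for i \<omega>
  \<comment> \<open>Steps left after step \<open>i\<close> in the window opened by its own block;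
    \<open>q2\<close> is the same for the window opened by the previous block.\<close>
  define q1 where "q1 i = 2 * l - Suc (i mod l)" for i
  define q2 where "q2 i = l - Suc (i mod l)" for i
  define Q1 where "Q1 = eps_sum a1 q1 (K * l)"
  define Q2 where "Q2 = eps_sum a2 q2 (l + K * l)"
  have a1F: "a1 i \<in> borel_measurable (F i)" for i
    unfolding a1_def by (intro measurable_near_zero) simp
  have a2F: "a2 i \<in> borel_measurable (F i)" for i
    unfolding a2_def by (cases "i < l") (simp_all add: measurable_near_zero)
  have a1b: "\<bar>a1 i \<omega>\<bar> \<le> 1" and a2b: "\<bar>a2 i \<omega>\<bar> \<le> 1" for i \<omega>
    by (auto simp: a1_def a2_def)
  have [measurable]: "Q1 \<in> borel_measurable M" "Q2 \<in> borel_measurable M"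
    unfolding Q1_def Q2_def using a1F a2F by (auto intro: measurable_eps_sum)
  have [measurable]: "(\<lambda>\<omega>. of_bool (near_zero l k j \<omega>) :: real) \<in> borel_measurable M" for k j
    using measurable_F_M[OF measurable_near_zero[of j j l k]] by simp
  have [measurable]: "hits l K \<in> borel_measurable M"
    unfolding hits_def[abs_def] by measurable
  have [simp]: "integrable M (hits l K)"
  proof (rule M.integrable_const_bound[where B = "real K"])
    have "\<bar>hits l K \<omega>\<bar> \<le> real K" for \<omega>
      using sum_bounded_above[of "{..<K}" "\<lambda>k. of_bool (near_zero l k (k * l + l) \<omega>)" "1::real"]
      by (simp add: hits_def sum_nonneg)
    then show "AE \<omega> in M. norm (hits l K \<omega>) \<le> real K"
      by simp
  qed measurable
  have dm: "(k * l + j) div l = k" "(k * l + j) mod l = j" if "j < l" for k j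
    using that l by (simp_all add: div_mult_self1 div_mult_self3)
  have dm2: "(l + (k * l + j)) div l = Suc k" "(l + (k * l + j)) mod l = j" if "j < l" for k j
    using dm[OF that, of "Suc k"] by (simp_all add: add.assoc)
  have shift: "k * l + (l + j) = l + (k * l + j)" for k j
    by simp
  \<comment> \<open>A block that is hit raises this flag at most \<open>l\<close> times, hence
    \<open>4 * d * l = 4 * h\<close> per hit in the second moment.\<close>
  have sum_a1: "(\<Sum>i<K * l. (a1 i \<omega>)\<^sup>2) \<le> real l * hits l K \<omega>" for \<omega>
  proof -
    have "(\<Sum>i<K * l. (a1 i \<omega>)\<^sup>2) = (\<Sum>k<K. \<Sum>j<l. (a1 (k * l + j) \<omega>)\<^sup>2)"
      by (rule sum_blocks)
    also have "\<dots> \<le> (\<Sum>k<K. \<Sum>j<l. of_bool (near_zero l k (k * l + l) \<omega>))"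
      using near_zero_imp by (intro sum_mono) (auto simp: a1_def dm)
    also have "\<dots> = real l * hits l K \<omega>"
      by (simp add: hits_def sum_distrib_left)
    finally show ?thesis .
  qed
  have sum_a2: "(\<Sum>i<l + K * l. (a2 i \<omega>)\<^sup>2) \<le> real l * hits l K \<omega>" for \<omega>
  proof -
    have "(\<Sum>i<l + K * l. (a2 i \<omega>)\<^sup>2) = (\<Sum>k<K. \<Sum>j<l. (a2 (l + (k * l + j)) \<omega>)\<^sup>2)"
      by (simp add: sum_lessThan_add sum_blocks) (simp add: a2_def)
    also have "\<dots> \<le> (\<Sum>k<K. \<Sum>j<l. of_bool (near_zero l k (k * l + l) \<omega>))"
      using near_zero_imp by (intro sum_mono) (auto simp: a2_def dm2)
    also have "\<dots> = real l * hits l K \<omega>"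
      by (simp add: hits_def sum_distrib_left)
    finally show ?thesis .
  qed
  have key: "(\<Sum>i<n. \<integral>\<omega>. (a i \<omega>)\<^sup>2 \<partial>M) \<le> real l * (\<integral>\<omega>. hits l K \<omega> \<partial>M)"
    if "\<And>\<omega>. (\<Sum>i<n. (a i \<omega>)\<^sup>2) \<le> real l * hits l K \<omega>" "\<And>i. a i \<in> borel_measurable (F i)"
      "\<And>i \<omega>. \<bar>a i \<omega>\<bar> \<le> 1" for a and n :: nat
  proof -
    have [measurable]: "a i \<in> borel_measurable M" for i
      using measurable_F_M[OF that(2)] .
    have i: "integrable M (\<lambda>\<omega>. (a i \<omega>)\<^sup>2)" for i
      using that(3)
      by (intro M.integrable_const_bound[where B = 1] AE_I2) (auto simp: abs_square_le_1)
    have "(\<Sum>i<n. \<integral>\<omega>. (a i \<omega>)\<^sup>2 \<partial>M) = (\<integral>\<omega>. (\<Sum>i<n. (a i \<omega>)\<^sup>2) \<partial>M)"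
      using i by simp
    also have "\<dots> \<le> (\<integral>\<omega>. real l * hits l K \<omega> \<partial>M)"
      using i that(1) by (intro integral_mono) auto
    finally show ?thesis by simp
  qed
  define N where "N = (\<integral>\<omega>. hits l K \<omega> \<partial>M)"
  have N: "N \<ge> 0"
    unfolding N_def by (intro integral_nonneg_AE AE_I2) (simp add: hits_def sum_nonneg)
  note Q1 = eps_sum_square[of "K * l" a1 1 q1, folded Q1_def, OF a1F a1b]
  note Q2 = eps_sum_square[of "l + K * l" a2 1 q2, folded Q2_def, OF a2F a2b]
  have "4 * d * (\<Sum>i<K * l. \<integral>\<omega>. (a1 i \<omega>)\<^sup>2 \<partial>M) \<le> 4 * d * (real l * N)"
    unfolding N_def using key[OF sum_a1 a1F a1b] d_pos by (intro mult_left_mono) auto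
  then have EQ1: "(\<integral>\<omega>. (Q1 \<omega>)\<^sup>2 \<partial>M) \<le> 4 * h * N"
    using Q1(2) by (simp add: h mult_ac)
  have "4 * d * (\<Sum>i<l + K * l. \<integral>\<omega>. (a2 i \<omega>)\<^sup>2 \<partial>M) \<le> 4 * d * (real l * N)"
    unfolding N_def using key[OF sum_a2 a2F a2b] d_pos by (intro mult_left_mono) auto
  then have EQ2: "(\<integral>\<omega>. (Q2 \<omega>)\<^sup>2 \<partial>M) \<le> 4 * h * N"
    using Q2(2) by (simp add: h mult_ac)
  define Q where "Q \<omega> = Q1 \<omega> + Q2 \<omega>" for \<omega>
  have [measurable]: "Q \<in> borel_measurable M"
    unfolding Q_def[abs_def] by measurable
  have Qle: "(Q \<omega>)\<^sup>2 \<le> 2 * (Q1 \<omega>)\<^sup>2 + 2 * (Q2 \<omega>)\<^sup>2" for \<omega>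
    using sum_squares_bound[of "Q1 \<omega>" "Q2 \<omega>"] by (simp add: Q_def power2_sum)
  have intQ: "integrable M (\<lambda>\<omega>. (Q \<omega>)\<^sup>2)"
    by (rule Bochner_Integration.integrable_bound[where f = "\<lambda>\<omega>. 2 * (Q1 \<omega>)\<^sup>2 + 2 * (Q2 \<omega>)\<^sup>2"])
      (use Q1(1) Q2(1) Qle in \<open>auto intro!: AE_I2\<close>)
  have "(\<integral>\<omega>. (Q \<omega>)\<^sup>2 \<partial>M) \<le> (\<integral>\<omega>. 2 * (Q1 \<omega>)\<^sup>2 + 2 * (Q2 \<omega>)\<^sup>2 \<partial>M)"
    using Qle intQ Q1(1) Q2(1) by (intro integral_mono) auto
  also have "\<dots> \<le> 16 * h * N"
    using EQ1 EQ2 Q1(1) Q2(1) by simp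
  finally have EQ: "(\<integral>\<omega>. (Q \<omega>)\<^sup>2 \<partial>M) \<le> 16 * h * N" .
  have main: "sqrt h / 4 * hits l K \<omega> \<le> 2 * V (K * l + l) \<omega> + \<bar>Q \<omega>\<bar>" for \<omega>
  proof -
    define e1 where "e1 i = H 1 (S i \<omega>) - eps (q1 i) (S i \<omega>) (D i \<omega>)" for i
    define e2 where "e2 i = H 1 (S i \<omega>) - eps (q2 i) (S i \<omega>) (D i \<omega>)" for i
    have "sqrt h / 4 * hits l K \<omega> \<le> (\<Sum>k<K. \<Sum>j<2 * l. of_bool (near_zero l k (k * l + j) \<omega>)
          * (H 1 (S (k * l + j) \<omega>) - eps (2 * l - Suc j) (S (k * l + j) \<omega>) (D (k * l + j) \<omega>)))"
      unfolding hits_def sum_distrib_left h by (intro sum_mono hits_le_block l)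
    also have "\<dots> = (\<Sum>k<K. (\<Sum>j<l. a1 (k * l + j) \<omega> * e1 (k * l + j))
        + (\<Sum>j<l. a2 (l + (k * l + j)) \<omega> * e2 (l + (k * l + j))))"
      unfolding mult_2 sum_lessThan_add
      by (intro sum.cong arg_cong2[where f = "(+)"] refl)
        (simp_all add: a1_def e1_def a2_def e2_def q1_def q2_def dm dm2 shift mult_2)
    also have "\<dots> = (\<Sum>i<K * l. a1 i \<omega> * e1 i) + (\<Sum>i<l + K * l. a2 i \<omega> * e2 i)"
      by (simp add: sum.distrib sum_lessThan_add sum_blocks) (simp add: a2_def)
    also have "(\<Sum>i<K * l. a1 i \<omega> * e1 i) = (\<Sum>i<K * l. a1 i \<omega> * H 1 (S i \<omega>)) - Q1 \<omega>"
      by (simp add: e1_def Q1_def eps_sum_def right_diff_distrib sum_subtractf)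
    also have "(\<Sum>i<l + K * l. a2 i \<omega> * e2 i) = (\<Sum>i<l + K * l. a2 i \<omega> * H 1 (S i \<omega>)) - Q2 \<omega>"
      by (simp add: e2_def Q2_def eps_sum_def right_diff_distrib sum_subtractf)
    also have "(\<Sum>i<K * l. a1 i \<omega> * H 1 (S i \<omega>)) \<le> V (K * l) \<omega>"
      unfolding V_def by (intro sum_mono) (auto simp: a1_def)
    also have "V (K * l) \<omega> \<le> V (K * l + l) \<omega>"
      by (rule V_mono) simp
    also have "(\<Sum>i<l + K * l. a2 i \<omega> * H 1 (S i \<omega>)) \<le> V (K * l + l) \<omega>"
      unfolding V_def add.commute[of l] by (intro sum_mono) (auto simp: a2_def)
    finally show ?thesis
      using abs_ge_minus_self[of "Q1 \<omega> + Q2 \<omega>"] unfolding Q_def by linarith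
  qed
  have "sqrt h / 4 * N \<le> (\<integral>\<omega>. 2 * V (K * l + l) \<omega> + \<bar>Q \<omega>\<bar> \<partial>M)"
    unfolding N_def using main expectation_abs_le(1)[of Q 1] intQ
    by (subst integral_mult_right_zero[symmetric], intro integral_mono) auto
  \<comment> \<open>The weight \<open>64 * sqrt h\<close> turns \<open>16 * h * N\<close> into
    \<open>sqrt h / 8 * N\<close>, half of the left-hand side, which can then be absorbed.\<close>
  also have "\<dots> \<le> 2 * (\<integral>\<omega>. V (K * l + l) \<omega> \<partial>M) + ((\<integral>\<omega>. (Q \<omega>)\<^sup>2 \<partial>M) / (2 * (64 * sqrt h)) + 64 * sqrt h / 2)"
    using expectation_abs_le[of Q "64 * sqrt h"] intQ hpos by simp
  also have "(\<integral>\<omega>. (Q \<omega>)\<^sup>2 \<partial>M) / (2 * (64 * sqrt h)) \<le> (16 * h * N) / (2 * (64 * sqrt h))"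
    using EQ hpos by (intro divide_right_mono) auto
  also have "(16 * h * N) / (2 * (64 * sqrt h)) = sqrt h / 8 * N"
    using hpos by (simp add: field_simps)
  finally have "sqrt h * N \<le> 8 * (2 * (\<integral>\<omega>. V (K * l + l) \<omega> \<partial>M) + 32 * sqrt h)"
    by (simp add: algebra_simps)
  then have "16 * sqrt h * (sqrt h * N) \<le> 16 * sqrt h * (8 * (2 * (\<integral>\<omega>. V (K * l + l) \<omega> \<partial>M) + 32 * sqrt h))"
    using hpos by (intro mult_left_mono) auto
  also have "16 * sqrt h * (sqrt h * N) = 16 * h * N"
    using hpos by (simp add: mult.assoc[symmetric])
  finally have "(\<integral>\<omega>. (Q \<omega>)\<^sup>2 \<partial>M) \<le> 128 * sqrt h * (2 * (\<integral>\<omega>. V (K * l + l) \<omega> \<partial>M) + 32 * sqrt h)"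
    using EQ by (simp add: algebra_simps)
  with intQ main show thesis
    by (intro that[of Q]) auto
qed

section \<open>Squared local times of blocks\<close>

definition block :: "nat \<Rightarrow> nat \<Rightarrow> 'a \<Rightarrow> real" where
  "block l k \<omega> = (\<Sum>j<l. H 1 (S (k * l + j) \<omega>))"

lemma measurable_block [measurable]: "block l k \<in> borel_measurable M"
  unfolding block_def[abs_def] by measurable

lemma block_nonneg [simp]: "0 \<le> block l k \<omega>"
  by (simp add: block_def sum_nonneg)

lemma H1_le: "H 1 x \<le> sqrt d"
  using H_le[of 1 x] by simp

lemma block_le: "block l k \<omega> \<le> real l * sqrt d"
  unfolding block_def using sum_bounded_above[of "{..<l}" "\<lambda>j. H 1 (S (k * l + j) \<omega>)" "sqrt d"] H1_le by simp

lemma sum_block: "(\<Sum>k<K. block l k \<omega>) = V (K * l) \<omega>"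
  by (simp add: block_def V_def sum_blocks)

text \<open>This is summation by parts for \<open>A j * U j\<close>, where \<open>A j\<close> is the local time collected so far in the
  block and \<open>U j\<close> the expected local time until its end.\<close>

lemma block_square_le:
  assumes l: "l > 0" and h: "h = real l * d"
  shows "(block l k \<omega>)\<^sup>2 \<le> 3 * sqrt h * block l k \<omega>
    + 2 * (\<Sum>j<l. (\<Sum>i<j. H 1 (S (k * l + i) \<omega>)) * eps (l - Suc j) (S (k * l + j) \<omega>) (D (k * l + j) \<omega>))"
proof -
  define v where "v j = H 1 (S (k * l + j) \<omega>)" for j
  define e where "e j = eps (l - Suc j) (S (k * l + j) \<omega>) (D (k * l + j) \<omega>)" for j
  define A where "A j = (\<Sum>i<j. v i)" for j
  define U where "U j = H (l - j) (S (k * l + j) \<omega>)" for j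
  have v: "v j \<ge> 0" "v j \<le> sqrt d" for j
    using H1_le by (auto simp: v_def)
  have dh: "sqrt d \<le> sqrt h"
    using l d_pos by (simp add: h mult_le_cancel_right1)
  have U: "U (Suc j) - U j = e j - v j" if "j < l" for j
    using H_S_Suc[of "l - Suc j" "k * l + j" \<omega>] that by (simp add: U_def e_def v_def Suc_diff_Suc)
  have Ule: "U j \<le> sqrt h" for j
  proof -
    have "U j \<le> sqrt (real (l - j) * d)"
      unfolding U_def by (rule H_le)
    also have "\<dots> \<le> sqrt h"
      using d_pos by (simp add: h)
    finally show ?thesis .
  qed
  \<comment> \<open>Both ends vanish: nothing has been collected at the start, nothing is to come at
    the end.\<close>
  have "(\<Sum>j<l. A (Suc j) * U (Suc j) - A j * U j) = A l * U l - A 0 * U 0"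
    by (rule sum_lessThan_telescope)
  also have "\<dots> = 0"
    by (simp add: A_def U_def)
  finally have "0 = (\<Sum>j<l. A (Suc j) * U (Suc j) - A j * U j)" ..
  also have "\<dots> = (\<Sum>j<l. v j * U (Suc j) + A j * e j - A j * v j)"
  proof (intro sum.cong refl)
    fix j assume "j \<in> {..<l}"
    then have "U (Suc j) = U j + e j - v j"
      using U[of j] by simp
    then have "A j * U (Suc j) = A j * (U j + e j - v j)"
      by simp
    then show "A (Suc j) * U (Suc j) - A j * U j = v j * U (Suc j) + A j * e j - A j * v j"
      by (simp add: A_def algebra_simps)
  qed
  finally have Av: "(\<Sum>j<l. A j * v j) = (\<Sum>j<l. v j * U (Suc j)) + (\<Sum>j<l. A j * e j)"
    by (simp add: sum.distrib sum_subtractf)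
  have "(A l)\<^sup>2 = (\<Sum>j<l. (A (Suc j))\<^sup>2 - (A j)\<^sup>2)"
    by (subst sum_lessThan_telescope) (simp add: A_def)
  also have "\<dots> = (\<Sum>j<l. 2 * (A j * v j) + v j * v j)"
    by (intro sum.cong) (simp_all add: A_def power2_eq_square algebra_simps)
  also have "\<dots> = 2 * (\<Sum>j<l. A j * v j) + (\<Sum>j<l. v j * v j)"
    by (simp add: sum.distrib sum_distrib_left)
  also have "(\<Sum>j<l. v j * v j) \<le> (\<Sum>j<l. v j * sqrt h)"
    using v(1) order_trans[OF v(2) dh] by (intro sum_mono mult_left_mono)
  also have "(\<Sum>j<l. A j * v j) \<le> (\<Sum>j<l. v j * sqrt h) + (\<Sum>j<l. A j * e j)"
    unfolding Av using v Ule by (intro add_right_mono sum_mono mult_left_mono)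
  finally have "(A l)\<^sup>2 \<le> 3 * sqrt h * A l + 2 * (\<Sum>j<l. A j * e j)"
    unfolding sum_distrib_right[symmetric] by (simp add: A_def algebra_simps)
  then show ?thesis
    by (simp add: block_def A_def v_def e_def)
qed

text \<open>The same circle as for the hits: the coefficient \<open>a i\<close> is the local time
  collected in the current block before time \<open>i\<close>, never more than that of the whole
  block, so the second moment of \<open>R\<close> is at most \<open>4 * h\<close> times the mean
  \<open>X\<close> of the sum of squares, and \<open>X\<close> is bounded by the means of
  \<open>V\<close> and \<open>|R|\<close>.\<close>

lemma blocks_bound:
  assumes l: "l > 0" and h: "h = real l * d"
  obtains R where "R \<in> borel_measurable M" "integrable M (\<lambda>\<omega>. (R \<omega>)\<^sup>2)"
    "(\<integral>\<omega>. (R \<omega>)\<^sup>2 \<partial>M) \<le> 24 * h * sqrt h * (\<integral>\<omega>. V (K * l) \<omega> \<partial>M) + 64 * h\<^sup>2"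
    "\<And>\<omega>. (\<Sum>k<K. (block l k \<omega>)\<^sup>2) \<le> 3 * sqrt h * V (K * l) \<omega> + 2 * \<bar>R \<omega>\<bar>"
proof -
  have hpos: "h > 0"
    using h l d_pos by simp
  define a :: "nat \<Rightarrow> 'a \<Rightarrow> real" where "a i \<omega> = (\<Sum>j<i mod l. H 1 (S (i div l * l + j) \<omega>))" for i \<omega>
  define q where "q i = l - Suc (i mod l)" for i
  define R where "R = eps_sum a q (K * l)"
  have dm: "(k * l + j) div l = k" "(k * l + j) mod l = j" if "j < l" for k j
    using that l by (simp_all add: div_mult_self1 div_mult_self3)
  have aF: "a i \<in> borel_measurable (F i)" for i
  proof -
    have "(\<lambda>\<omega>. H 1 (S (i div l * l + j) \<omega>)) \<in> borel_measurable (F i)" if "j < i mod l" for j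
    proof (rule measurable_compose[OF measurable_S_F measurable_H])
      have "i div l * l + j \<le> i div l * l + i mod l"
        using that by (intro add_left_mono) simp
      then show "i div l * l + j \<le> i"
        by (simp only: div_mult_mod_eq)
    qed
    then show ?thesis
      unfolding a_def[abs_def] by (intro borel_measurable_sum) auto
  qed
  have a0: "0 \<le> a i \<omega>" for i \<omega>
    by (simp add: a_def sum_nonneg)
  have a_le: "a i \<omega> \<le> block l (i div l) \<omega>" for i \<omega>
    unfolding a_def block_def using less_imp_le[OF mod_less_divisor[OF l, of i]]
    by (intro sum_mono2) auto
  have ab: "\<bar>a i \<omega>\<bar> \<le> real l * sqrt d" for i \<omega>
    using a0[of i \<omega>] a_le[of i \<omega>] block_le[of l "i div l" \<omega>] by linarith
  have [measurable]: "a i \<in> borel_measurable M" for i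
    using measurable_F_M[OF aF] .
  have Rm [measurable]: "R \<in> borel_measurable M"
    unfolding R_def using aF by (intro measurable_eps_sum)
  note R = eps_sum_square[of "K * l" a "real l * sqrt d" q, folded R_def, OF aF ab]
  have intb: "integrable M (\<lambda>\<omega>. (block l k \<omega>)\<^sup>2)" for k
  proof (rule M.integrable_const_bound[where B = "(real l * sqrt d)\<^sup>2"])
    show "AE \<omega> in M. norm ((block l k \<omega>)\<^sup>2) \<le> (real l * sqrt d)\<^sup>2"
      using power_mono[OF block_le block_nonneg, of l k _ 2] by (intro AE_I2) simp
  qed measurable
  have inta: "integrable M (\<lambda>\<omega>. (a i \<omega>)\<^sup>2)" for i
  proof (rule Bochner_Integration.integrable_bound[OF intb[of "i div l"]])
    show "AE \<omega> in M. norm ((a i \<omega>)\<^sup>2) \<le> norm ((block l (i div l) \<omega>)\<^sup>2)"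
      using power_mono[OF a_le a0, of i _ 2] by (intro AE_I2) simp
  qed measurable
  define X where "X = (\<integral>\<omega>. (\<Sum>k<K. (block l k \<omega>)\<^sup>2) \<partial>M)"
  have "(\<Sum>i<K * l. \<integral>\<omega>. (a i \<omega>)\<^sup>2 \<partial>M) = (\<integral>\<omega>. (\<Sum>i<K * l. (a i \<omega>)\<^sup>2) \<partial>M)"
    using inta by simp
  also have "\<dots> \<le> (\<integral>\<omega>. real l * (\<Sum>k<K. (block l k \<omega>)\<^sup>2) \<partial>M)"
  proof (intro integral_mono)
    fix \<omega>
    have "(\<Sum>i<K * l. (a i \<omega>)\<^sup>2) = (\<Sum>k<K. \<Sum>j<l. (a (k * l + j) \<omega>)\<^sup>2)"
      by (rule sum_blocks)
    also have "\<dots> \<le> (\<Sum>k<K. \<Sum>j<l. (block l k \<omega>)\<^sup>2)"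
    proof (intro sum_mono)
      fix k j assume "j \<in> {..<l}"
      then show "(a (k * l + j) \<omega>)\<^sup>2 \<le> (block l k \<omega>)\<^sup>2"
        using power_mono[OF a_le a0, of "k * l + j" \<omega> 2] by (simp add: dm)
    qed
    finally show "(\<Sum>i<K * l. (a i \<omega>)\<^sup>2) \<le> real l * (\<Sum>k<K. (block l k \<omega>)\<^sup>2)"
      by (simp add: sum_distrib_left)
  qed (use inta intb in auto)
  also have "\<dots> = real l * X"
    by (simp add: X_def)
  finally have "4 * d * (\<Sum>i<K * l. \<integral>\<omega>. (a i \<omega>)\<^sup>2 \<partial>M) \<le> 4 * d * (real l * X)"
    using d_pos by (intro mult_left_mono) auto
  then have ER: "(\<integral>\<omega>. (R \<omega>)\<^sup>2 \<partial>M) \<le> 4 * h * X"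
    using R(2) by (simp add: h mult_ac)
  have main: "(\<Sum>k<K. (block l k \<omega>)\<^sup>2) \<le> 3 * sqrt h * V (K * l) \<omega> + 2 * \<bar>R \<omega>\<bar>" for \<omega>
  proof -
    have "(\<Sum>k<K. (block l k \<omega>)\<^sup>2) \<le> (\<Sum>k<K. 3 * sqrt h * block l k \<omega>
      + 2 * (\<Sum>j<l. (\<Sum>i<j. H 1 (S (k * l + i) \<omega>)) * eps (l - Suc j) (S (k * l + j) \<omega>) (D (k * l + j) \<omega>)))"
      by (intro sum_mono block_square_le l h)
    also have "\<dots> = 3 * sqrt h * V (K * l) \<omega> + 2 * R \<omega>"
      by (simp add: sum.distrib sum_distrib_left[symmetric] sum_block R_def eps_sum_def sum_blocks
          a_def q_def dm)
    finally show ?thesis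
      using abs_ge_self[of "R \<omega>"] by linarith
  qed
  have "X \<le> (\<integral>\<omega>. 3 * sqrt h * V (K * l) \<omega> + 2 * \<bar>R \<omega>\<bar> \<partial>M)"
    unfolding X_def using main intb expectation_abs_le(1)[OF Rm R(1) zero_less_one]
    by (intro integral_mono) auto
  \<comment> \<open>The weight \<open>8 * h\<close> makes the second moment of \<open>R\<close>
    contribute \<open>X / 2\<close>, which is absorbed.\<close>
  also have "\<dots> \<le> 3 * sqrt h * (\<integral>\<omega>. V (K * l) \<omega> \<partial>M) + 2 * ((\<integral>\<omega>. (R \<omega>)\<^sup>2 \<partial>M) / (2 * (8 * h)) + 8 * h / 2)"
    using expectation_abs_le[OF Rm R(1), of "8 * h"] hpos by simp
  also have "(\<integral>\<omega>. (R \<omega>)\<^sup>2 \<partial>M) / (2 * (8 * h)) \<le> (4 * h * X) / (2 * (8 * h))"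
    using ER hpos by (intro divide_right_mono) auto
  also have "(4 * h * X) / (2 * (8 * h)) = X / 4"
    using hpos by simp
  finally have "X \<le> 6 * sqrt h * (\<integral>\<omega>. V (K * l) \<omega> \<partial>M) + 16 * h"
    by simp
  then have "4 * h * X \<le> 4 * h * (6 * sqrt h * (\<integral>\<omega>. V (K * l) \<omega> \<partial>M) + 16 * h)"
    using hpos by (intro mult_left_mono) auto
  then have "(\<integral>\<omega>. (R \<omega>)\<^sup>2 \<partial>M) \<le> 24 * h * sqrt h * (\<integral>\<omega>. V (K * l) \<omega> \<partial>M) + 64 * h\<^sup>2"
    using ER by (simp add: algebra_simps power2_eq_square)
  with R(1) main show thesis
    by (intro that[of R]) auto
qed

end

section \<open>One constant for all scales of a sampling level\<close>

text \<open>\<open>x i\<close> stands for the path at time \<open>i / 4 ^ m\<close>, and the weights \<open>w\<close> are going to be the increments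
  of the discrete local time \<open>V\<close>; \<open>K\<close> is a random constant that must not depend on \<open>n\<close>.\<close>

definition spread_zeros :: "nat \<Rightarrow> (nat \<Rightarrow> real) \<Rightarrow> real \<Rightarrow> bool" where
  "spread_zeros m x K \<longleftrightarrow> (\<exists>w :: nat \<Rightarrow> real. (\<forall>i. 0 \<le> w i) \<and>
     (\<forall>n\<le>m. real (card {k. k < 4 ^ n \<and> (\<exists>j<4 ^ (m - n). \<bar>x (k * 4 ^ (m - n) + j)\<bar> \<le> (1 / 2) ^ n / 4)})
        \<le> (12 * K + 4) * 2 ^ n) \<and>
     (\<forall>n\<le>m. (\<Sum>k<4 ^ n. (\<Sum>j<4 ^ (m - n). w (k * 4 ^ (m - n) + j))\<^sup>2) \<le> (5 * K + 2) / 2 ^ n) \<and>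
     \<bar>x (4 ^ m)\<bar> \<le> K * sqrt ((\<Sum>i<4 ^ m. w i) + (1 / 4) ^ m) \<and>
     (\<Sum>i<4 ^ m. w i * \<bar>x i\<bar> ^ 3) \<le> 6 / 4 ^ m)"

lemma spread_zeros_mono:
  assumes "spread_zeros m x K" "K \<le> K'"
  shows "spread_zeros m x K'"
proof -
  from assms(1) obtain w where w: "\<forall>i. 0 \<le> w i"
    "\<And>n. n \<le> m \<Longrightarrow> real (card {k. k < 4 ^ n \<and> (\<exists>j<4 ^ (m - n). \<bar>x (k * 4 ^ (m - n) + j)\<bar> \<le> (1 / 2) ^ n / 4)})
        \<le> (12 * K + 4) * 2 ^ n"
    "\<And>n. n \<le> m \<Longrightarrow> (\<Sum>k<4 ^ n. (\<Sum>j<4 ^ (m - n). w (k * 4 ^ (m - n) + j))\<^sup>2) \<le> (5 * K + 2) / 2 ^ n"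
    "\<bar>x (4 ^ m)\<bar> \<le> K * sqrt ((\<Sum>i<4 ^ m. w i) + (1 / 4) ^ m)" "(\<Sum>i<4 ^ m. w i * \<bar>x i\<bar> ^ 3) \<le> 6 / 4 ^ m"
    unfolding spread_zeros_def by blast
  have le: "(12 * K + 4) * 2 ^ n \<le> (12 * K' + 4) * 2 ^ n" "(5 * K + 2) / 2 ^ n \<le> (5 * K' + 2) / 2 ^ n" for n :: nat
    using assms(2) by (auto intro!: mult_right_mono divide_right_mono)
  have "K * sqrt ((\<Sum>i<4 ^ m. w i) + (1 / 4) ^ m) \<le> K' * sqrt ((\<Sum>i<4 ^ m. w i) + (1 / 4) ^ m)"
    using assms(2) w(1) by (intro mult_right_mono) (auto intro!: add_nonneg_nonneg sum_nonneg)
  then show ?thesis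
    unfolding spread_zeros_def using w order_trans[OF w(2) le(1)] order_trans[OF w(3) le(2)]
    by (intro exI[of _ w]) auto
qed

lemma sum_half_powers: "(\<Sum>n\<le>m. (1 / 2) ^ n :: real) \<le> 2"
proof -
  have "(\<Sum>n\<le>m. (1 / 2) ^ n :: real) = 2 - (1 / 2) ^ m"
    by (induction m) simp_all
  then show ?thesis
    by simp
qed

context iid_walk begin

lemma near_zero_iff:
  "near_zero l k (k * l + l) \<omega> \<longleftrightarrow> (\<exists>j<l. \<bar>S (k * l + j) \<omega>\<bar> \<le> sqrt (real l * d) / 4)"
proof
  assume "near_zero l k (k * l + l) \<omega>"
  then obtain i where i: "k * l \<le> i" "i < k * l + l" "\<bar>S i \<omega>\<bar> \<le> sqrt (real l * d) / 4"
    by (auto simp: near_zero_def)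
  then have "i - k * l < l" "k * l + (i - k * l) = i"
    by auto
  with i(3) show "\<exists>j<l. \<bar>S (k * l + j) \<omega>\<bar> \<le> sqrt (real l * d) / 4"
    by metis
qed (auto simp: near_zero_def)

lemma hits_eq_card:
  "hits l K \<omega> = real (card {k. k < K \<and> (\<exists>j<l. \<bar>S (k * l + j) \<omega>\<bar> \<le> sqrt (real l * d) / 4)})"
proof -
  have "{k. k < K \<and> (\<exists>j<l. \<bar>S (k * l + j) \<omega>\<bar> \<le> sqrt (real l * d) / 4)} = {..<K} \<inter> {k. near_zero l k (k * l + l) \<omega>}"
    by (auto simp: near_zero_iff)
  then show ?thesis
    by (simp add: hits_def of_bool_def sum.If_cases)
qed

text \<open>A sum over the levels dominates each level, and its mean is bounded uniformly in
  \<open>m\<close> because the second moments are geometric in \<open>n\<close>.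
  \<open>10000\<close> rounds up \<open>2 + 6 + 2 * 4608 + 2 * 88\<close>.\<close>

lemma exists_spread_constant:
  assumes d: "d = (1 / 4) ^ m"
  shows "\<exists>\<Phi>. \<Phi> \<in> borel_measurable M \<and> (\<forall>\<omega>. 0 \<le> \<Phi> \<omega>) \<and> (\<integral>\<^sup>+\<omega>. ennreal (\<Phi> \<omega>) \<partial>M) \<le> ennreal 10000 \<and>
    (\<forall>\<omega>. spread_zeros m (\<lambda>i. S i \<omega>) (\<Phi> \<omega>))"
proof -
  define l :: "nat \<Rightarrow> nat" where "l n = 4 ^ (m - n)" for n
  define h where "h n = real (l n) * d" for n
  have l: "l n > 0" for n
    by (simp add: l_def)
  have Kl: "4 ^ n * l n = 4 ^ m" if "n \<le> m" for n
    using that by (simp add: l_def power_add[symmetric])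
  have hn: "h n = (1 / 4) ^ n" if "n \<le> m" for n
  proof -
    have "4 ^ n * real (l n) = 4 ^ m"
      using Kl[OF that] by (metis of_nat_mult of_nat_numeral of_nat_power)
    then show ?thesis
      by (simp add: h_def d power_divide field_simps)
  qed
  have sqrt_h: "sqrt (h n) = (1 / 2) ^ n" if "n \<le> m" for n
    unfolding hn[OF that] by (rule real_sqrt_unique) (simp_all add: power2_eq_square power_mult_distrib[symmetric])
  have d1: "d \<le> 1"
    by (simp add: d power_le_one)
  \<comment> \<open>The windows of \<open>hits_bound\<close> run one block past the end; at level 0
    that block is as long as the whole time interval, hence the doubling.\<close>
  have V2: "(\<integral>\<omega>. V (2 * 4 ^ m) \<omega> \<partial>M) \<le> 2"
  proof -
    have "(\<integral>\<omega>. V (2 * 4 ^ m) \<omega> \<partial>M) \<le> sqrt (real (2 * 4 ^ m) * d)"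
      by (rule expectation_V_le)
    also have "real (2 * 4 ^ m) * d = 2"
      by (simp add: d power_divide)
    also have "sqrt 2 \<le> 2"
      by (intro real_le_lsqrt) simp_all
    finally show ?thesis .
  qed
  have V1: "(\<integral>\<omega>. V (4 ^ m) \<omega> \<partial>M) \<le> 1"
    using expectation_V_le[of "4 ^ m"] by (simp add: d power_divide)
  have "\<exists>Q. Q \<in> borel_measurable M \<and> integrable M (\<lambda>\<omega>. (Q \<omega>)\<^sup>2) \<and>
      (\<integral>\<omega>. (Q \<omega>)\<^sup>2 \<partial>M) \<le> 4608 * (1 / 2) ^ n \<and>
      (\<forall>\<omega>. (1 / 2) ^ n / 4 * hits (l n) (4 ^ n) \<omega> \<le> 2 * V (2 * 4 ^ m) \<omega> + \<bar>Q \<omega>\<bar>)" if n: "n \<le> m" for n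
  proof -
    have le: "4 ^ n * l n + l n \<le> 2 * 4 ^ m"
      using Kl[OF n] by (simp add: l_def)
    obtain Q where Q: "Q \<in> borel_measurable M" "integrable M (\<lambda>\<omega>. (Q \<omega>)\<^sup>2)"
      "(\<integral>\<omega>. (Q \<omega>)\<^sup>2 \<partial>M) \<le> 128 * sqrt (h n) * (2 * (\<integral>\<omega>. V (4 ^ n * l n + l n) \<omega> \<partial>M) + 32 * sqrt (h n))"
      "\<And>\<omega>. sqrt (h n) / 4 * hits (l n) (4 ^ n) \<omega> \<le> 2 * V (4 ^ n * l n + l n) \<omega> + \<bar>Q \<omega>\<bar>"
      by (rule hits_bound[where l = "l n" and h = "h n" and K = "4 ^ n", OF l h_def]) blast
    have "(\<integral>\<omega>. V (4 ^ n * l n + l n) \<omega> \<partial>M) \<le> (\<integral>\<omega>. V (2 * 4 ^ m) \<omega> \<partial>M)"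
      using le by (intro integral_mono V_mono) auto
    moreover have "(1 / 2 :: real) ^ n \<le> 1"
      by (simp add: power_le_one)
    ultimately have "2 * (\<integral>\<omega>. V (4 ^ n * l n + l n) \<omega> \<partial>M) + 32 * (1 / 2) ^ n \<le> 36"
      using V2 by linarith
    \<comment> \<open>\<open>36\<close> is \<open>2 * 2 + 32\<close>, and
      \<open>4608 = 128 * 36\<close>.\<close>
    then have "128 * (1 / 2) ^ n * (2 * (\<integral>\<omega>. V (4 ^ n * l n + l n) \<omega> \<partial>M) + 32 * (1 / 2) ^ n) \<le> 128 * (1 / 2) ^ n * 36"
      by (intro mult_left_mono) auto
    then have "(\<integral>\<omega>. (Q \<omega>)\<^sup>2 \<partial>M) \<le> 4608 * (1 / 2) ^ n"
      using Q(3) unfolding sqrt_h[OF n] by linarith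
    moreover have "(1 / 2) ^ n / 4 * hits (l n) (4 ^ n) \<omega> \<le> 2 * V (2 * 4 ^ m) \<omega> + \<bar>Q \<omega>\<bar>" for \<omega>
      using Q(4)[of \<omega>] V_mono[OF le, of \<omega>] unfolding sqrt_h[OF n] by linarith
    ultimately show ?thesis
      using Q(1,2) by blast
  qed
  then obtain Q where Q: "\<And>n. n \<le> m \<Longrightarrow> Q n \<in> borel_measurable M"
    "\<And>n. n \<le> m \<Longrightarrow> integrable M (\<lambda>\<omega>. (Q n \<omega>)\<^sup>2)"
    "\<And>n. n \<le> m \<Longrightarrow> (\<integral>\<omega>. (Q n \<omega>)\<^sup>2 \<partial>M) \<le> 4608 * (1 / 2) ^ n"
    "\<And>n \<omega>. n \<le> m \<Longrightarrow> (1 / 2) ^ n / 4 * hits (l n) (4 ^ n) \<omega> \<le> 2 * V (2 * 4 ^ m) \<omega> + \<bar>Q n \<omega>\<bar>"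
    by metis
  have "\<exists>R. R \<in> borel_measurable M \<and> integrable M (\<lambda>\<omega>. (R \<omega>)\<^sup>2) \<and>
      (\<integral>\<omega>. (R \<omega>)\<^sup>2 \<partial>M) \<le> 88 * (1 / 2) ^ n * (1 / 4) ^ n \<and>
      (\<forall>\<omega>. (\<Sum>k<4 ^ n. (block (l n) k \<omega>)\<^sup>2) \<le> 3 * (1 / 2) ^ n * V (2 * 4 ^ m) \<omega> + 2 * \<bar>R \<omega>\<bar>)" if n: "n \<le> m" for n
  proof -
    obtain R where R: "R \<in> borel_measurable M" "integrable M (\<lambda>\<omega>. (R \<omega>)\<^sup>2)"
      "(\<integral>\<omega>. (R \<omega>)\<^sup>2 \<partial>M) \<le> 24 * h n * sqrt (h n) * (\<integral>\<omega>. V (4 ^ n * l n) \<omega> \<partial>M) + 64 * (h n)\<^sup>2"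
      "\<And>\<omega>. (\<Sum>k<4 ^ n. (block (l n) k \<omega>)\<^sup>2) \<le> 3 * sqrt (h n) * V (4 ^ n * l n) \<omega> + 2 * \<bar>R \<omega>\<bar>"
      by (rule blocks_bound[where l = "l n" and h = "h n" and K = "4 ^ n", OF l h_def]) blast
    have "24 * (1 / 4) ^ n * (1 / 2) ^ n * (\<integral>\<omega>. V (4 ^ m) \<omega> \<partial>M) \<le> 24 * (1 / 4) ^ n * (1 / 2) ^ n * 1"
      using V1 by (intro mult_left_mono) auto
    moreover have "64 * ((1 / 4) ^ n)\<^sup>2 \<le> 64 * ((1 / 4) ^ n * (1 / 2 :: real) ^ n)"
      unfolding power2_eq_square by (intro mult_left_mono power_mono) auto
    moreover have "24 * (1 / 4) ^ n * (1 / 2) ^ n * 1 + 64 * ((1 / 4) ^ n * (1 / 2) ^ n)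
        = 88 * (1 / 2) ^ n * (1 / 4 :: real) ^ n"
      by simp
    ultimately have "(\<integral>\<omega>. (R \<omega>)\<^sup>2 \<partial>M) \<le> 88 * (1 / 2) ^ n * (1 / 4) ^ n"
      using R(3) unfolding hn[OF n, symmetric] sqrt_h[OF n] Kl[OF n] by linarith
    moreover have "(\<Sum>k<4 ^ n. (block (l n) k \<omega>)\<^sup>2) \<le> 3 * (1 / 2) ^ n * V (2 * 4 ^ m) \<omega> + 2 * \<bar>R \<omega>\<bar>" for \<omega>
    proof -
      have "3 * (1 / 2) ^ n * V (4 ^ m) \<omega> \<le> 3 * (1 / 2) ^ n * V (2 * 4 ^ m) \<omega>"
        by (intro mult_left_mono V_mono) auto
      then show ?thesis
        using R(4)[of \<omega>] unfolding sqrt_h[OF n] Kl[OF n] by linarith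
    qed
    ultimately show ?thesis
      using R(1,2) by blast
  qed
  then obtain R where R: "\<And>n. n \<le> m \<Longrightarrow> R n \<in> borel_measurable M"
    "\<And>n. n \<le> m \<Longrightarrow> integrable M (\<lambda>\<omega>. (R n \<omega>)\<^sup>2)"
    "\<And>n. n \<le> m \<Longrightarrow> (\<integral>\<omega>. (R n \<omega>)\<^sup>2 \<partial>M) \<le> 88 * (1 / 2) ^ n * (1 / 4) ^ n"
    "\<And>n \<omega>. n \<le> m \<Longrightarrow> (\<Sum>k<4 ^ n. (block (l n) k \<omega>)\<^sup>2) \<le> 3 * (1 / 2) ^ n * V (2 * 4 ^ m) \<omega> + 2 * \<bar>R n \<omega>\<bar>"
    by metis
  \<comment> \<open>The regularisation is \<open>e = d = 4^-m\<close>: it keeps the denominator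
    positive and disappears in the limit.\<close>
  define \<Psi> where "\<Psi> \<omega> = \<bar>S (4 ^ m) \<omega>\<bar> / sqrt (V (4 ^ m) \<omega> + d)" for \<omega>
  \<comment> \<open>\<open>R n\<close> has to be of order \<open>2^-n\<close>, hence the weight
    \<open>4^n\<close> on its square; its second moment leaves just a summable
    \<open>2^-n\<close>.\<close>
  define \<Phi> where "\<Phi> \<omega> = V (2 * 4 ^ m) \<omega> + \<Psi> \<omega> + (\<Sum>n\<le>m. (Q n \<omega>)\<^sup>2) + (\<Sum>n\<le>m. 4 ^ n * (R n \<omega>)\<^sup>2)" for \<omega>
  note \<Psi> = expectation_abs_S_over_sqrt_V[OF d_pos, of "4 ^ m", folded \<Psi>_def]
  have \<Psi>0: "0 \<le> \<Psi> \<omega>" for \<omega>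
    using d_pos by (simp add: \<Psi>_def add_nonneg_nonneg)
  have int: "integrable M \<Phi>"
    unfolding \<Phi>_def[abs_def] using \<Psi>(1) Q(2) R(2) by (intro Bochner_Integration.integrable_add Bochner_Integration.integrable_sum) auto
  have nonneg: "0 \<le> \<Phi> \<omega>" for \<omega>
    unfolding \<Phi>_def using \<Psi>0 by (intro add_nonneg_nonneg sum_nonneg) auto
  have "(\<integral>\<omega>. \<Phi> \<omega> \<partial>M) = (\<integral>\<omega>. V (2 * 4 ^ m) \<omega> \<partial>M) + (\<integral>\<omega>. \<Psi> \<omega> \<partial>M)
      + (\<Sum>n\<le>m. \<integral>\<omega>. (Q n \<omega>)\<^sup>2 \<partial>M) + (\<Sum>n\<le>m. 4 ^ n * (\<integral>\<omega>. (R n \<omega>)\<^sup>2 \<partial>M))"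
  proof -
    have iQ: "integrable M (\<lambda>\<omega>. \<Sum>n\<le>m. (Q n \<omega>)\<^sup>2)"
      and iR: "integrable M (\<lambda>\<omega>. \<Sum>n\<le>m. 4 ^ n * (R n \<omega>)\<^sup>2)"
      using Q(2) R(2) by (auto intro!: Bochner_Integration.integrable_sum)
    have sQ: "(\<integral>\<omega>. (\<Sum>n\<le>m. (Q n \<omega>)\<^sup>2) \<partial>M) = (\<Sum>n\<le>m. \<integral>\<omega>. (Q n \<omega>)\<^sup>2 \<partial>M)"
      using Q(2) by (intro Bochner_Integration.integral_sum) auto
    have "(\<integral>\<omega>. (\<Sum>n\<le>m. 4 ^ n * (R n \<omega>)\<^sup>2) \<partial>M) = (\<Sum>n\<le>m. \<integral>\<omega>. 4 ^ n * (R n \<omega>)\<^sup>2 \<partial>M)"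
      using R(2) by (intro Bochner_Integration.integral_sum) auto
    then have sR: "(\<integral>\<omega>. (\<Sum>n\<le>m. 4 ^ n * (R n \<omega>)\<^sup>2) \<partial>M) = (\<Sum>n\<le>m. 4 ^ n * (\<integral>\<omega>. (R n \<omega>)\<^sup>2 \<partial>M))"
      by simp
    have "(\<integral>\<omega>. \<Phi> \<omega> \<partial>M) = (\<integral>\<omega>. V (2 * 4 ^ m) \<omega> \<partial>M) + (\<integral>\<omega>. \<Psi> \<omega> \<partial>M)
      + (\<integral>\<omega>. (\<Sum>n\<le>m. (Q n \<omega>)\<^sup>2) \<partial>M) + (\<integral>\<omega>. (\<Sum>n\<le>m. 4 ^ n * (R n \<omega>)\<^sup>2) \<partial>M)"
      unfolding \<Phi>_def using \<Psi>(1) iQ iR by simp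
    then show ?thesis
      by (simp only: sQ sR)
  qed
  also have "\<dots> \<le> 2 + 6 + (\<Sum>n\<le>m. 4608 * (1 / 2) ^ n) + (\<Sum>n\<le>m. 88 * (1 / 2) ^ n)"
  proof (intro add_mono sum_mono V2)
    show "(\<integral>\<omega>. \<Psi> \<omega> \<partial>M) \<le> 6"
      using \<Psi>(2) V1 d1 by simp
    fix n assume n: "n \<in> {..m}"
    show "(\<integral>\<omega>. (Q n \<omega>)\<^sup>2 \<partial>M) \<le> 4608 * (1 / 2) ^ n"
      using Q(3) n by simp
    have "4 ^ n * (\<integral>\<omega>. (R n \<omega>)\<^sup>2 \<partial>M) \<le> 4 ^ n * (88 * (1 / 2) ^ n * (1 / 4) ^ n)"
      using R(3)[of n] n by (intro mult_left_mono) auto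
    then show "4 ^ n * (\<integral>\<omega>. (R n \<omega>)\<^sup>2 \<partial>M) \<le> 88 * (1 / 2) ^ n"
      by (simp add: power_divide)
  qed
  also have "\<dots> \<le> 10000"
    using sum_half_powers[of m] unfolding sum_distrib_left[symmetric] by linarith
  finally have "(\<integral>\<omega>. \<Phi> \<omega> \<partial>M) \<le> 10000" .
  then have "ennreal (\<integral>\<omega>. \<Phi> \<omega> \<partial>M) \<le> ennreal 10000"
    by (rule ennreal_leI)
  then have E: "(\<integral>\<^sup>+\<omega>. ennreal (\<Phi> \<omega>) \<partial>M) \<le> ennreal 10000"
    using nn_integral_eq_integral[OF int] nonneg by simp
  have abs_le: "\<bar>y\<bar> \<le> y\<^sup>2 + 1" for y :: real
    using abs_le_square_div[of 1 y] zero_le_power2[of y] by (simp del: zero_le_power2)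
  have spread: "spread_zeros m (\<lambda>i. S i \<omega>) (\<Phi> \<omega>)" for \<omega>
  proof -
    have V\<Phi>: "V (2 * 4 ^ m) \<omega> \<le> \<Phi> \<omega>" and \<Psi>\<Phi>: "\<Psi> \<omega> \<le> \<Phi> \<omega>"
      unfolding \<Phi>_def using \<Psi>0[of \<omega>] by (auto intro!: add_nonneg_nonneg sum_nonneg simp: add.assoc)
    have Q\<Phi>: "(Q n \<omega>)\<^sup>2 \<le> \<Phi> \<omega>" if "n \<le> m" for n
    proof -
      have "(Q n \<omega>)\<^sup>2 \<le> (\<Sum>n\<le>m. (Q n \<omega>)\<^sup>2)"
        using that by (intro member_le_sum) auto
      moreover have "0 \<le> (\<Sum>n\<le>m. 4 ^ n * (R n \<omega>)\<^sup>2)"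
        by (intro sum_nonneg) simp
      ultimately show ?thesis
        unfolding \<Phi>_def using \<Psi>0[of \<omega>] V_nonneg[of "2 * 4 ^ m" \<omega>] by linarith
    qed
    have R\<Phi>: "4 ^ n * (R n \<omega>)\<^sup>2 \<le> \<Phi> \<omega>" if "n \<le> m" for n
    proof -
      have "4 ^ n * (R n \<omega>)\<^sup>2 \<le> (\<Sum>n\<le>m. 4 ^ n * (R n \<omega>)\<^sup>2)"
        using that by (intro member_le_sum) auto
      moreover have "0 \<le> (\<Sum>n\<le>m. (Q n \<omega>)\<^sup>2)"
        by (intro sum_nonneg) simp
      ultimately show ?thesis
        unfolding \<Phi>_def using \<Psi>0[of \<omega>] V_nonneg[of "2 * 4 ^ m" \<omega>] by linarith
    qed
    have 1: "real (card {k. k < 4 ^ n \<and> (\<exists>j<4 ^ (m - n). \<bar>S (k * 4 ^ (m - n) + j) \<omega>\<bar> \<le> (1 / 2) ^ n / 4)})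
        \<le> (12 * \<Phi> \<omega> + 4) * 2 ^ n" if n: "n \<le> m" for n
    proof -
      \<comment> \<open>Here \<open>2 * V\<close> is at most \<open>2 * \<Phi>\<close> and
        \<open>|Q n|\<close> at most \<open>(Q n)^2 + 1\<close>, so at most
        \<open>\<Phi> + 1\<close>; clearing the factor \<open>2^-n / 4\<close> yields the constants
        \<open>12\<close> and \<open>4\<close> of \<open>spread_zeros\<close>.\<close>
      have "(1 / 2) ^ n / 4 * hits (l n) (4 ^ n) \<omega> \<le> 3 * \<Phi> \<omega> + 1"
        using Q(4)[OF n, of \<omega>] V\<Phi> Q\<Phi>[OF n] abs_le[of "Q n \<omega>"] by linarith
      then have "hits (l n) (4 ^ n) \<omega> \<le> (12 * \<Phi> \<omega> + 4) * 2 ^ n"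
        by (simp add: field_simps power_divide)
      then show ?thesis
        unfolding hits_eq_card h_def[symmetric] sqrt_h[OF n] by (simp add: l_def)
    qed
    have 2: "(\<Sum>k<4 ^ n. (\<Sum>j<4 ^ (m - n). H 1 (S (k * 4 ^ (m - n) + j) \<omega>))\<^sup>2) \<le> (5 * \<Phi> \<omega> + 2) / 2 ^ n"
      if n: "n \<le> m" for n
    proof -
      have "(2 ^ n * R n \<omega>)\<^sup>2 = 4 ^ n * (R n \<omega>)\<^sup>2"
        by (simp add: power_mult_distrib power2_eq_square flip: power_mult_distrib)
      then have "2 ^ n * \<bar>R n \<omega>\<bar> \<le> \<Phi> \<omega> + 1"
        using abs_le[of "2 ^ n * R n \<omega>"] R\<Phi>[OF n] by (simp add: abs_mult)
      then have "\<bar>R n \<omega>\<bar> \<le> (\<Phi> \<omega> + 1) / 2 ^ n"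
        by (simp add: pos_le_divide_eq mult.commute)
      moreover have "3 * (1 / 2) ^ n * V (2 * 4 ^ m) \<omega> \<le> 3 * (1 / 2) ^ n * \<Phi> \<omega>"
        using V\<Phi> by (intro mult_left_mono) auto
      ultimately have "(\<Sum>k<4 ^ n. (block (l n) k \<omega>)\<^sup>2) \<le> 3 * (1 / 2) ^ n * \<Phi> \<omega> + 2 * ((\<Phi> \<omega> + 1) / 2 ^ n)"
        using R(4)[OF n, of \<omega>] by linarith
      also have "\<dots> = (5 * \<Phi> \<omega> + 2) / 2 ^ n"
        by (simp add: power_divide add_divide_distrib)
      finally show ?thesis
        by (simp add: block_def l_def)
    qed
    have 3: "\<bar>S (4 ^ m) \<omega>\<bar> \<le> \<Phi> \<omega> * sqrt ((\<Sum>i<4 ^ m. H 1 (S i \<omega>)) + (1 / 4) ^ m)"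
    proof -
      have "sqrt (V (4 ^ m) \<omega> + d) > 0"
        using d_pos by (simp add: add_nonneg_pos)
      then have "\<bar>S (4 ^ m) \<omega>\<bar> \<le> \<Phi> \<omega> * sqrt (V (4 ^ m) \<omega> + d)"
        using \<Psi>\<Phi> by (simp add: \<Psi>_def pos_divide_le_eq)
      then show ?thesis
        unfolding V_def d .
    qed
    have 4: "(\<Sum>i<4 ^ m. H 1 (S i \<omega>) * \<bar>S i \<omega>\<bar> ^ 3) \<le> 6 / 4 ^ m"
    proof -
      have "(\<Sum>i<4 ^ m. H 1 (S i \<omega>) * \<bar>S i \<omega>\<bar> ^ 3) \<le> (\<Sum>i<(4 :: nat) ^ m. 6 * d\<^sup>2)"
        using H1_decay by (intro sum_mono) (simp add: mult.commute)
      also have "\<dots> = 6 / 4 ^ m"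
        by (simp add: d power2_eq_square power_divide)
      finally show ?thesis .
    qed
    show ?thesis
      unfolding spread_zeros_def using 1 2 3 4
      by (intro exI[of _ "\<lambda>i. H 1 (S i \<omega>)"] conjI allI impI) simp_all
  qed
  show ?thesis
    using int nonneg E spread by (intro exI[of _ \<Phi>]) auto
qed

end

section \<open>Brownian motion\<close>

lemma step_distribution_normal:
  assumes "d > 0"
  shows "step_distribution (density lborel (normal_density 0 (sqrt d))) d"
proof -
  define \<gamma> where "\<gamma> = density lborel (\<lambda>x. ennreal (normal_density 0 (sqrt d) x))"
  have s: "sqrt d > 0"
    using assms by simp
  have m: "has_bochner_integral \<gamma> (\<lambda>x. x ^ k) c"
    if "has_bochner_integral lborel (\<lambda>x. normal_density 0 (sqrt d) x * x ^ k) c" for k c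
    unfolding \<gamma>_def using that by (intro has_bochner_integral_density) auto
  have m2: "has_bochner_integral \<gamma> (\<lambda>x. x ^ 2) d"
    using normal_moment_even[OF s, of 0 1] assms by (intro m) (simp add: fact_numeral)
  have m4: "has_bochner_integral \<gamma> (\<lambda>x. x ^ 4) (3 * d\<^sup>2)"
  proof (rule m)
    have "fact (2 * 2) / ((2 / (sqrt d)\<^sup>2) ^ 2 * fact 2) = 3 * d\<^sup>2"
      using assms by (simp add: fact_numeral field_simps power2_eq_square)
    then show "has_bochner_integral lborel (\<lambda>x. normal_density 0 (sqrt d) x * x ^ 4) (3 * d\<^sup>2)"
      using normal_moment_even[OF s, of 0 2] by simp
  qed
  have m1: "has_bochner_integral \<gamma> (\<lambda>x. x ^ 1) 0"
    using normal_moment_odd[OF s, of 0 0] by (intro m) simp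
  have m3: "has_bochner_integral \<gamma> (\<lambda>x. x ^ 3) 0"
    using normal_moment_odd[OF s, of 0 1] by (intro m) (simp add: numeral_3_eq_3)
  interpret prob_space \<gamma>
    unfolding \<gamma>_def using s by (rule prob_space_normal_density)
  have "step_distribution \<gamma> d"
  proof
    show "sets \<gamma> = sets borel"
      by (simp add: \<gamma>_def)
    show "0 < d" by fact
    show "integrable \<gamma> (\<lambda>x. x ^ 4)" "(\<integral>x. x ^ 4 \<partial>\<gamma>) = 3 * d\<^sup>2"
      using m4 by (simp_all add: has_bochner_integral_iff)
    show "(\<integral>x. x \<partial>\<gamma>) = 0" "(\<integral>x. x\<^sup>2 \<partial>\<gamma>) = d" "(\<integral>x. x ^ 3 \<partial>\<gamma>) = 0"
      using m1 m2 m3 by (simp_all add: has_bochner_integral_iff)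
  qed
  then show ?thesis
    by (simp add: \<gamma>_def)
qed

section \<open>Sampling Brownian motion\<close>

context brownian_motion begin

lemma iid_walk_increments:
  assumes d: "d > 0"
  shows "iid_walk (density lborel (normal_density 0 (sqrt d))) d M
    (\<lambda>i \<omega>. B (real (Suc i) * d) \<omega> - B (real i * d) \<omega>)"
proof -
  define D where "D i \<omega> = B (real (Suc i) * d) \<omega> - B (real i * d) \<omega>" for i \<omega>
  have D [measurable]: "D i \<in> borel_measurable M" for i
    unfolding D_def[abs_def] using d by (intro borel_measurable_diff random_variable) auto
  have ind: "indep_vars (\<lambda>_. borel) D {..<n}" for n
    unfolding D_def[abs_def] using indep_increments[of "\<lambda>i. real i * d" n] d by simp
  \<comment> \<open>Independence of an infinite family is tested on finite subfamilies, and each of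
    them lies in an initial segment covered by \<open>indep_increments\<close>.\<close>
  have "indep_sets (\<lambda>i. {D i -` A \<inter> space M | A. A \<in> sets borel}) UNIV"
  proof (subst indep_sets_finite_index_sets, intro allI impI)
    fix J :: "nat set" assume "finite J"
    then obtain n where "J \<subseteq> {..<n}"
      using finite_nat_iff_bounded by blast
    then show "indep_sets (\<lambda>i. {D i -` A \<inter> space M | A. A \<in> sets borel}) J"
      using ind[of n] by (auto simp: indep_vars_def2 intro: indep_sets_mono_index)
  qed
  then have indU: "indep_vars (\<lambda>_. borel) D UNIV"
    by (simp add: indep_vars_def2)
  have distr: "distr M borel (D i) = density lborel (normal_density 0 (sqrt d))" for i
  proof -
    have "distributed M lborel (D i) (normal_density 0 (sqrt (real (Suc i) * d - real i * d)))"
      unfolding D_def[abs_def] using d by (intro normal_increments) (auto intro: mult_strict_right_mono)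
    then have "distr M lborel (D i) = density lborel (normal_density 0 (sqrt d))"
      by (simp add: distributed_distr_eq_density algebra_simps)
    moreover have "distr M borel (D i) = distr M lborel (D i)"
      by (rule distr_cong) auto
    ultimately show ?thesis by simp
  qed
  show ?thesis
    unfolding D_def[symmetric]
    by (intro iid_walk.intro iid_walk_axioms.intro step_distribution_normal d prob_space_axioms indU distr)
qed

lemma exists_spread_constant:
  "\<exists>\<Phi>. \<Phi> \<in> borel_measurable M \<and> (\<integral>\<^sup>+\<omega>. ennreal (\<Phi> \<omega>) \<partial>M) \<le> ennreal 10000 \<and>
    (\<forall>\<omega>. 0 \<le> \<Phi> \<omega> \<and> spread_zeros m (\<lambda>i. B (real i / 4 ^ m) \<omega> - B 0 \<omega>) (\<Phi> \<omega>))"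
proof -
  define d :: real where "d = (1 / 4) ^ m"
  interpret W: iid_walk "density lborel (normal_density 0 (sqrt d))" d M
    "\<lambda>i \<omega>. B (real (Suc i) * d) \<omega> - B (real i * d) \<omega>"
    by (rule iid_walk_increments) (simp add: d_def)
  have "W.S i \<omega> = B (real i / 4 ^ m) \<omega> - B 0 \<omega>" for i \<omega>
  proof -
    have "W.S i \<omega> = B (real i * d) \<omega> - B 0 \<omega>"
      by (induction i) (simp_all add: W.S_Suc del: of_nat_Suc)
    then show ?thesis
      by (simp add: d_def power_divide)
  qed
  then show ?thesis
    using W.exists_spread_constant[OF d_def] by auto
qed

lemma AE_frequently_spread:
  "AE \<omega> in M. \<exists>K\<ge>1. \<exists>\<^sub>F m in sequentially. spread_zeros m (\<lambda>i. B (real i / 4 ^ m) \<omega> - B 0 \<omega>) K"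
proof -
  obtain \<Phi> where \<Phi>: "\<And>m. \<Phi> m \<in> borel_measurable M" "\<And>m. (\<integral>\<^sup>+\<omega>. ennreal (\<Phi> m \<omega>) \<partial>M) \<le> ennreal 10000"
    "\<And>m \<omega>. 0 \<le> \<Phi> m \<omega>" "\<And>m \<omega>. spread_zeros m (\<lambda>i. B (real i / 4 ^ m) \<omega> - B 0 \<omega>) (\<Phi> m \<omega>)"
    using exists_spread_constant by metis
  have "(\<integral>\<^sup>+\<omega>. liminf (\<lambda>m. ennreal (\<Phi> m \<omega>)) \<partial>M) \<le> liminf (\<lambda>m. \<integral>\<^sup>+\<omega>. ennreal (\<Phi> m \<omega>) \<partial>M)"
    using \<Phi>(1) by (intro nn_integral_liminf) auto
  also have "\<dots> \<le> limsup (\<lambda>m. \<integral>\<^sup>+\<omega>. ennreal (\<Phi> m \<omega>) \<partial>M)"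
    by (rule Liminf_le_Limsup) simp
  also have "\<dots> \<le> ennreal 10000"
    using \<Phi>(2) by (intro Limsup_bounded always_eventually) auto
  finally have "(\<integral>\<^sup>+\<omega>. liminf (\<lambda>m. ennreal (\<Phi> m \<omega>)) \<partial>M) \<noteq> \<infinity>"
    by (auto simp: top_unique)
  then have "AE \<omega> in M. liminf (\<lambda>m. ennreal (\<Phi> m \<omega>)) \<noteq> \<infinity>"
    using \<Phi>(1) by (intro nn_integral_PInf_AE) auto
  then show ?thesis
  proof eventually_elim
    case (elim \<omega>)
    then obtain L where L: "liminf (\<lambda>m. ennreal (\<Phi> m \<omega>)) = ennreal L" "L \<ge> 0"
      by (cases "liminf (\<lambda>m. ennreal (\<Phi> m \<omega>))") auto
    have "\<not> (\<forall>\<^sub>F m in sequentially. ennreal (L + 1) \<le> ennreal (\<Phi> m \<omega>))"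
    proof
      assume "\<forall>\<^sub>F m in sequentially. ennreal (L + 1) \<le> ennreal (\<Phi> m \<omega>)"
      then have "ennreal (L + 1) \<le> liminf (\<lambda>m. ennreal (\<Phi> m \<omega>))"
        by (rule Liminf_bounded)
      then show False
        using L by simp
    qed
    moreover have "\<forall>\<^sub>F m in sequentially. ennreal (L + 1) \<le> ennreal (\<Phi> m \<omega>)"
      if "\<forall>\<^sub>F m in sequentially. L + 1 < \<Phi> m \<omega>"
      using that by eventually_elim (simp add: ennreal_leI)
    ultimately have "\<exists>\<^sub>F m in sequentially. \<Phi> m \<omega> \<le> L + 1"
      by (auto simp: frequently_def not_le)
    then have "\<exists>\<^sub>F m in sequentially. spread_zeros m (\<lambda>i. B (real i / 4 ^ m) \<omega> - B 0 \<omega>) (L + 1)"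
      by (rule frequently_elim1) (rule spread_zeros_mono[OF \<Phi>(4)])
    then show ?case
      using L(2) by (intro exI[of _ "L + 1"]) simp
  qed
qed

text \<open>Used twice: through the bound on \<open>|S| / sqrt V\<close> it makes the total local
  time positive, and it keeps the endpoint 1 out of the zero set.\<close>

lemma AE_B_1_nonzero: "AE \<omega> in M. B 1 \<omega> - B 0 \<omega> \<noteq> 0"
proof -
  have d: "distributed M lborel (\<lambda>\<omega>. B 1 \<omega> - B 0 \<omega>) (normal_density 0 (sqrt (1 - 0)))"
    by (rule normal_increments) auto
  have "AE x in lborel. x \<noteq> (0 :: real)"
    by (rule AE_lborel_singleton)
  then have "AE x in density lborel (\<lambda>x. ennreal (normal_density 0 (sqrt (1 - 0)) x)). x \<noteq> 0"
    by (subst AE_density) auto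
  then have "AE x in distr M lborel (\<lambda>\<omega>. B 1 \<omega> - B 0 \<omega>). x \<noteq> 0"
    by (simp only: distributed_distr_eq_density[OF d])
  then show ?thesis
    using distributed_measurable[OF d] by (subst (asm) AE_distr_iff) auto
qed

end

lemma half_dimensional_if_spread_zeros:
  fixes g :: "real \<Rightarrow> real"
  assumes cont: "continuous_on {0..1} g" and g1: "g 1 \<noteq> 0" and K: "K \<ge> 1"
    and freq: "\<exists>\<^sub>F m in sequentially. spread_zeros m (\<lambda>i. g (real i / 4 ^ m)) K"
  shows "\<exists>C. half_dimensional C {t \<in> {0..1}. g t = 0}"
proof -
  \<comment> \<open>From \<open>(g 1)^2 \<le> K^2 * (W + 4^-m)\<close> one gets
    \<open>W + 4^-m \<ge> 2 * c\<close>; levels with \<open>4^-m < c\<close> then have total weight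
    \<open>W\<close> at least \<open>c\<close>.\<close>
  define c where "c = (g 1)\<^sup>2 / (2 * K\<^sup>2)"
  have c: "c > 0"
    using g1 K by (simp add: c_def)
  have "(\<lambda>m. (1 / 4 :: real) ^ m) \<longlonglongrightarrow> 0"
    by (intro LIMSEQ_realpow_zero) auto
  then have "\<forall>\<^sub>F m in sequentially. (1 / 4 :: real) ^ m < c"
    using c by (auto simp: order_tendsto_iff)
  with freq have "\<exists>\<^sub>F m in sequentially. spread_zeros m (\<lambda>i. g (real i / 4 ^ m)) K \<and> (1 / 4) ^ m < c"
    by (auto elim: frequently_rev_mp eventually_mono)
  then have "infinite {m. spread_zeros m (\<lambda>i. g (real i / 4 ^ m)) K \<and> (1 / 4) ^ m < c}"
    by (simp add: frequently_cofinite[symmetric] cofinite_eq_sequentially)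
  then obtain s :: "nat \<Rightarrow> nat" where s: "strict_mono s"
    "\<And>r. spread_zeros (s r) (\<lambda>i. g (real i / 4 ^ s r)) K \<and> (1 / 4) ^ s r < c"
    using infinite_enumerate by blast
  define P where "P r w \<longleftrightarrow> (\<forall>i. 0 \<le> w i) \<and>
     (\<forall>n\<le>s r. real (card {k. k < 4 ^ n \<and> (\<exists>j<4 ^ (s r - n). \<bar>g (real (k * 4 ^ (s r - n) + j) / 4 ^ s r)\<bar> \<le> (1 / 2) ^ n / 4)})
        \<le> (12 * K + 4) * 2 ^ n) \<and>
     (\<forall>n\<le>s r. (\<Sum>k<4 ^ n. (\<Sum>j<4 ^ (s r - n). w (k * 4 ^ (s r - n) + j))\<^sup>2) \<le> (5 * K + 2) / 2 ^ n) \<and>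
     \<bar>g (real (4 ^ s r) / 4 ^ s r)\<bar> \<le> K * sqrt ((\<Sum>i<4 ^ s r. w i) + (1 / 4) ^ s r) \<and>
     (\<Sum>i<4 ^ s r. w i * \<bar>g (real i / 4 ^ s r)\<bar> ^ 3) \<le> 6 / 4 ^ s r" for r and w :: "nat \<Rightarrow> real"
  have "\<exists>w. P r w" for r
    using s(2)[of r] unfolding spread_zeros_def P_def by blast
  then obtain w where P: "\<And>r. P r (w r)"
    by metis
  have w: "\<And>r i. 0 \<le> w r i"
    "\<And>r n. n \<le> s r \<Longrightarrow>
      real (card {k. k < 4 ^ n \<and> (\<exists>j<4 ^ (s r - n). \<bar>g (real (k * 4 ^ (s r - n) + j) / 4 ^ s r)\<bar> \<le> (1 / 2) ^ n / 4)})
        \<le> (12 * K + 4) * 2 ^ n"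
    "\<And>r n. n \<le> s r \<Longrightarrow>
      (\<Sum>k<4 ^ n. (\<Sum>j<4 ^ (s r - n). w r (k * 4 ^ (s r - n) + j))\<^sup>2) \<le> (5 * K + 2) / 2 ^ n"
    "\<And>r. \<bar>g (real (4 ^ s r) / 4 ^ s r)\<bar> \<le> K * sqrt ((\<Sum>i<4 ^ s r. w r i) + (1 / 4) ^ s r)"
    "\<And>r. (\<Sum>i<4 ^ s r. w r i * \<bar>g (real i / 4 ^ s r)\<bar> ^ 3) \<le> 6 / 4 ^ s r"
    using P unfolding P_def by blast+
  show ?thesis
  proof (rule half_dimensional_zero_set[OF cont g1 s(1), where C = "12 * K + 4" and w = w and c = c])
    fix r n assume n: "n \<le> s r"
    show "real (card {k. k < 4 ^ n \<and> (\<exists>j<4 ^ (s r - n). \<bar>g (real (k * 4 ^ (s r - n) + j) / 4 ^ s r)\<bar> \<le> (1 / 2) ^ n / 4)})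
        \<le> (12 * K + 4) * 2 ^ n"
      by (rule w(2)[OF n])
    have "(5 * K + 2) / 2 ^ n \<le> (12 * K + 4) / 2 ^ n"
      using K by (intro divide_right_mono) auto
    with w(3)[OF n]
    show "(\<Sum>k<4 ^ n. (\<Sum>j<4 ^ (s r - n). w r (k * 4 ^ (s r - n) + j))\<^sup>2) \<le> (12 * K + 4) / 2 ^ n"
      by (rule order_trans)
  next
    fix r
    define W where "W = (\<Sum>i<4 ^ s r. w r i)"
    have W: "W \<ge> 0"
      unfolding W_def using w(1) by (intro sum_nonneg) auto
    have "\<bar>g 1\<bar> \<le> K * sqrt (W + (1 / 4) ^ s r)"
      using w(4)[of r] by (simp add: W_def)
    then have "\<bar>g 1\<bar>\<^sup>2 \<le> (K * sqrt (W + (1 / 4) ^ s r))\<^sup>2"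
      by (intro power_mono) auto
    then have "(g 1)\<^sup>2 \<le> K\<^sup>2 * (W + (1 / 4) ^ s r)"
      using W by (simp add: power_mult_distrib)
    moreover have "K\<^sup>2 * (2 * c) = (g 1)\<^sup>2"
      using K by (simp add: c_def)
    ultimately have "K\<^sup>2 * (2 * c) \<le> K\<^sup>2 * (W + (1 / 4) ^ s r)"
      by simp
    then have "2 * c \<le> W + (1 / 4) ^ s r"
      using K by simp
    then show "c \<le> (\<Sum>i<4 ^ s r. w r i)"
      using s(2)[of r] unfolding W_def by linarith
  qed (use w c in auto)
qed

theorem theorem1p6:
  fixes M :: "'a measure" and B :: "real \<Rightarrow> 'a \<Rightarrow> real"
  assumes "brownian_motion M B"
  shows "AE \<omega> in M. capacity_equivalent (zero_set B \<omega>) middle_half_cantor"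
proof -
  interpret brownian_motion M B by fact
  show ?thesis
    using AE_frequently_spread AE_B_1_nonzero start_zero continuous_paths
  proof eventually_elim
    case (elim \<omega>)
    then obtain K where "K \<ge> 1" "\<exists>\<^sub>F m in sequentially. spread_zeros m (\<lambda>i. B (real i / 4 ^ m) \<omega>) K"
      by auto
    moreover have "continuous_on {0..1} (\<lambda>t. B t \<omega>)"
      using elim(4) by (rule continuous_on_subset) auto
    ultimately obtain C where "half_dimensional C (zero_set B \<omega>)"
      unfolding zero_set_def using half_dimensional_if_spread_zeros[of "\<lambda>t. B t \<omega>" K] elim(2,3) by auto
    then show ?case
      using half_dimensional_cantor by (rule half_dimensional_capacity_equivalent)
  qed
qed

end
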